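(* Let $(G,C)$ be a strongly connected inhomogeneous Mauldin-Williams graph in $\mathbb{R}^d$ with vertex set $V$, satisfying the strong open set condition (SOSC), and let $s_0(G)$, $G_M$, $(K_i^C)_{i\in V}$ and $K^C=\bigcup_{i\in V}K_i^C$ be as defined in the context. Suppose that $$\int_0^\infty e^{-s_0(G)t}N_{e^{-t}}(C_i)\,\mathrm{d}t<\infty$$ for all $i\in V$. Then precisely one of the following two statements holds: (1) $G_M=\mathbb{R}$ and for every $i\in V$ there exists a constant $h_i>0$ such that $$\lim_{t\to\infty}\frac{N_{e^{-t}}(K_i^C)}{h_i e^{s_0(G)t}}=1.$$ In particular, $\lim_{t\to\infty}e^{-s_0(G)t}N_{e^{-t}}(K^C)=\sum_{i\in V}h_i$. (2) $G_M=\langle\{\tau\}\rangle=\tau\mathbb{Z}$ for some $\tau>0$, and for every $i\in V$ there exist $\delta>0$ and a $\tau$-periodic function $h_i\colon\mathbb{R}\to[\delta,\infty)$ such that $$\lim_{n\to\infty}\frac{N_{e^{-(n\tau+y)}}(K_i^C)}{h_i(y)e^{s_0(G)(n\tau+y)}}=1$$ for all $y\in[0,\tau)$. In particular, $\lim_{n\to\infty}e^{-s_0(G)(n\tau+y)}N_{e^{-(n\tau+y)}}(K^C)=\sum_{i\in V}h_i(y)$ for all $y\in[0,\tau)$.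
   Context: **Covering number.** For a bounded set $A\subset\mathbb{R}^d$ and $r>0$, $N_r(A)$ is the least number of closed balls of radius $r$ (with arbitrary centres in $\mathbb{R}^d$) needed to cover $A$; $N_r(\emptyset)=0$. **Mauldin-Williams graph.** $G=((V,E),(X_i)_{i\in V},(S_e)_{e\in E})$, where $(V,E)$ is a finite directed multigraph (each edge $e\in E$ has an initial vertex $i(e)$ and a terminal vertex $t(e)$; parallel edges and loops are allowed), each $X_i\subset\mathbb{R}^d$ is a non-empty compact set equal to the closure of its interior $X_i^o$, and each $S_e\colon X_{t(e)}\to X_{i(e)}$ is a contractive similarity with contraction ratio $0<r_e<1$, i.e. $|S_e(x)-S_e(y)|=r_e|x-y|$. Write $E_i=\{e\in E: i(e)=i\}$ and $E_{ij}=\{e\in E_i: t(e)=j\}$. **Paths.** A path of length $n\ge 1$ is a list $\gamma=(e_1,\dots,e_n)$ of edges with $t(e_k)=i(e_{k+1})$ for $1\le k<n$; it goes from $i(e_1)$ to $t(e_n)$. Put $r_\gamma=r_{e_1}\cdots r_{e_n}$. Let $\Gamma_{i,j}^n$ be the set of paths of length $n$ from $i$ to $j$. $G$ is strongly connected if for each pair $i,j\in V$ (including $i=j$) there is a path of length at least $1$ from $i$ to $j$. **Inhomogeneous Mauldin-Williams graph.** A pair $(G,C)$, where $G$ is a Mauldin-Williams graph and $C=(C_i)_{i\in V}$ is a list of (possibly empty) compact sets with $C_i\subset X_i$. $(G,C)$ is strongly connected if $G$ is. There are unique lists of non-empty compact sets $K_i\subset X_i$ and $K_i^C\subset X_i$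 ($i\in V$) with $$K_i=\bigcup_{e\in E_i}S_e(K_{t(e)}),\qquad K_i^C=C_i\cup\bigcup_{e\in E_i}S_e(K_{t(e)}^C).$$ When considering the union $K^C=\bigcup_{i\in V}K_i^C$, it is assumed that the sets $X_i$ are embedded in $\mathbb{R}^d$ so that $X_i^o\cap X_j^o=\emptyset$ whenever $i\ne j$. **SOSC.** $(G,C)$ satisfies the strong open set condition if there are non-empty bounded open sets $U_i\subset X_i$ ($i\in V$) such that for all $i\in V$: $\bigcup_{e\in E_i}S_e(U_{t(e)})\subset U_i$; $S_e(U_{t(e)})\cap S_{e'}(U_{t(e')})=\emptyset$ for all distinct $e,e'\in E_i$; $U_i\cap K_i\ne\emptyset$; and $C_i\subset\overline{U_i}$. **The exponent $s_0(G)$.** For $s\ge 0$ let $A_G^s=\bigl(\sum_{e\in E_{ij}}r_e^s\bigr)_{i,j\in V}$. $s_0(G)\ge 0$ is the unique solution $s$ of $\rho(A_G^s)=1$, where $\rho$ denotes the spectral radius. **The group $G_M$.** For $B\subset\mathbb{R}$, $\langle B\rangle$ denotes the smallest closed subgroup of $(\mathbb{R},+)$ containing $B$. Set $$G_M=\Bigl\langle\bigcup_{i\in V}\bigcup_{n=1}^\infty\{-\log r_\gamma:\gamma\in\Gamma_{i,i}^n\}\Bigr\rangle.$$ *)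

theory Defs
  imports
    "HOL-Analysis.Analysis"
    "Graph_Theory.Arc_Walk"
    "Jordan_Normal_Form.Spectral_Radius"
begin

(* F is the set of centres; the empty set of centres gives covering number 0 for the empty set. *)
definition covering_number :: "real \<Rightarrow> 'a::euclidean_space set \<Rightarrow> nat" where
  "covering_number \<rho> A = (LEAST n. \<exists>F. finite F \<and> card F = n \<and> A \<subseteq> (\<Union>c\<in>F. cball c \<rho>))"

(* S e is only constrained on X (head G e); its values elsewhere are irrelevant.
   The initial and terminal vertex of an edge e are tail G e and head G e. *)
locale mauldin_williams_graph = fin_digraph G
  for G :: "('v, 'e) pre_digraph" +
  fixes X :: "'v \<Rightarrow> 'a::euclidean_space set"
    and S :: "'e \<Rightarrow> 'a \<Rightarrow> 'a"
    and r :: "'e \<Rightarrow> real"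
  assumes verts_nonempty: "verts G \<noteq> {}"
    and X_nonempty: "i \<in> verts G \<Longrightarrow> X i \<noteq> {}"
    and X_compact: "i \<in> verts G \<Longrightarrow> compact (X i)"
    and X_regular: "i \<in> verts G \<Longrightarrow> X i = closure (interior (X i))"
    and S_maps: "e \<in> arcs G \<Longrightarrow> S e ` X (head G e) \<subseteq> X (tail G e)"
    and ratio_pos: "e \<in> arcs G \<Longrightarrow> 0 < r e"
    and ratio_less_1: "e \<in> arcs G \<Longrightarrow> r e < 1"
    and S_similarity: "\<lbrakk>e \<in> arcs G; x \<in> X (head G e); y \<in> X (head G e)\<rbrakk>
      \<Longrightarrow> dist (S e x) (S e y) = r e * dist x y"

locale inhomogeneous_mw_graph = mauldin_williams_graph G X S r
  for G :: "('v, 'e) pre_digraph"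
    and X :: "'v \<Rightarrow> 'a::euclidean_space set"
    and S :: "'e \<Rightarrow> 'a \<Rightarrow> 'a"
    and r :: "'e \<Rightarrow> real" +
  fixes C :: "'v \<Rightarrow> 'a set"
  assumes C_compact: "i \<in> verts G \<Longrightarrow> compact (C i)"
    and C_subset: "i \<in> verts G \<Longrightarrow> C i \<subseteq> X i"

definition paths_of_length ::
    "('v, 'e) pre_digraph \<Rightarrow> 'v \<Rightarrow> 'v \<Rightarrow> nat \<Rightarrow> 'e list set" where
  "paths_of_length G i j n = {p. pre_digraph.awalk G i p j \<and> length p = n}"

definition path_ratio :: "('e \<Rightarrow> real) \<Rightarrow> 'e list \<Rightarrow> real" where
  "path_ratio r p = prod_list (map r p)"

(* Unlike Digraph.strongly_connected, this requires a path of positive length even if i = j. *)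
definition mw_strongly_connected :: "('v, 'e) pre_digraph \<Rightarrow> bool" where
  "mw_strongly_connected G \<longleftrightarrow>
    (\<forall>i\<in>verts G. \<forall>j\<in>verts G. \<exists>n\<ge>1. paths_of_length G i j n \<noteq> {})"

(* Extensionality only pins down the irrelevant values outside the vertex set,
   so that the attractor is unique as a function. *)
definition inhomogeneous_attractor ::
    "('v, 'e) pre_digraph \<Rightarrow> ('v \<Rightarrow> 'a::euclidean_space set) \<Rightarrow> ('e \<Rightarrow> 'a \<Rightarrow> 'a)
      \<Rightarrow> ('v \<Rightarrow> 'a set) \<Rightarrow> 'v \<Rightarrow> 'a set" where
  "inhomogeneous_attractor G X S C = (THE K. K \<in> extensional (verts G) \<and>
    (\<forall>i\<in>verts G. K i \<noteq> {} \<and> compact (K i) \<and> K i \<subseteq> X i \<and>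
      K i = C i \<union> (\<Union>e\<in>out_arcs G i. S e ` K (head G e))))"

abbreviation homogeneous_attractor ::
    "('v, 'e) pre_digraph \<Rightarrow> ('v \<Rightarrow> 'a::euclidean_space set) \<Rightarrow> ('e \<Rightarrow> 'a \<Rightarrow> 'a)
      \<Rightarrow> 'v \<Rightarrow> 'a set" where
  "homogeneous_attractor G X S \<equiv> inhomogeneous_attractor G X S (\<lambda>_. {})"

definition strong_open_set_condition ::
    "('v, 'e) pre_digraph \<Rightarrow> ('v \<Rightarrow> 'a::euclidean_space set) \<Rightarrow> ('e \<Rightarrow> 'a \<Rightarrow> 'a)
      \<Rightarrow> ('v \<Rightarrow> 'a set) \<Rightarrow> bool" where
  "strong_open_set_condition G X S C \<longleftrightarrow> (\<exists>U. \<forall>i\<in>verts G.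
    U i \<noteq> {} \<and> bounded (U i) \<and> open (U i) \<and> U i \<subseteq> X i \<and>
    (\<Union>e\<in>out_arcs G i. S e ` U (head G e)) \<subseteq> U i \<and>
    (\<forall>e\<in>out_arcs G i. \<forall>e'\<in>out_arcs G i. e \<noteq> e' \<longrightarrow>
      S e ` U (head G e) \<inter> S e' ` U (head G e') = {}) \<and>
    U i \<inter> homogeneous_attractor G X S i \<noteq> {} \<and>
    C i \<subseteq> closure (U i))"

(* Library matrices are indexed by {0..<n}, so the vertices are enumerated by from_nat_into;
   the spectral radius does not depend on the enumeration. *)
definition mw_matrix :: "('v, 'e) pre_digraph \<Rightarrow> ('e \<Rightarrow> real) \<Rightarrow> real \<Rightarrow> complex Matrix.mat" where
  "mw_matrix G r s = Matrix.mat (card (verts G)) (card (verts G))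
    (\<lambda>(k, l). complex_of_real
      (\<Sum>e\<in>out_arcs G (from_nat_into (verts G) k) \<inter> in_arcs G (from_nat_into (verts G) l).
        r e powr s))"

definition critical_exponent :: "('v, 'e) pre_digraph \<Rightarrow> ('e \<Rightarrow> real) \<Rightarrow> real" where
  "critical_exponent G r = (THE s. 0 \<le> s \<and> spectral_radius (mw_matrix G r s) = 1)"

definition closed_subgroup_generated :: "real set \<Rightarrow> real set" where
  "closed_subgroup_generated B =
    (\<lambda>H. closed H \<and> 0 \<in> H \<and> (\<forall>x\<in>H. \<forall>y\<in>H. x + y \<in> H) \<and> (\<forall>x\<in>H. - x \<in> H)) hull B"

definition mw_group :: "('v, 'e) pre_digraph \<Rightarrow> ('e \<Rightarrow> real) \<Rightarrow> real set" where
  "mw_group G r = closed_subgroup_generated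
    (\<Union>i\<in>verts G. \<Union>n\<in>{1..}. (\<lambda>p. - ln (path_ratio r p)) ` paths_of_length G i i n)"

end

theory Submission
  imports Defs
begin

text \<open>
  Let \<open>s\<close> be the critical exponent and \<open>w\<close> the positive vector with \<open>A\<^sup>s w = w\<close>. Then
  \<open>p e = r e powr s * w (head e) / w (tail e)\<close> are transition probabilities, and with
  \<open>a e = - ln (r e)\<close> the normalized covering numbers
  \<open>f i t = exp (- s t) N (exp (- t)) (K i) / w i\<close> satisfy
  \<open>f i t \<le> \<Sum>e. p e * f (head e) (t - a e)\<close> up to an integrable error coming from \<open>C\<close>.
  The part of \<open>K i\<close> at distance more than \<open>2 exp (- t)\<close> from the complement of \<open>U i\<close> satisfies the
  reverse inequality without any error, because no ball meets two of its pieces. The difference of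
  the two is the layer of \<open>K i\<close> near the complement of \<open>U i\<close>; it is negligible since \<open>U i\<close> contains
  a whole piece of \<open>K i\<close>, which makes the recursion for the layer strictly substochastic. A function
  squeezed in this way between a super- and a subsolution converges along every coset of the closed
  group generated by the cycle lengths.
\<close>

no_notation Matrix.scalar_prod (infix "\<bullet>" 70)

section \<open>Covering numbers\<close>

text \<open>The obstacle is the overlap of neighbouring pieces of \<open>K i\<close>: balls that
  meet several pieces make the covering recursion a strict inequality, and no integrable bound for
  the resulting defect is at hand. A renewal theorem for equations with integrable error therefore
  does not apply; all that is available is a defect tending to 0 without a rate, and the argument is
  built to live on that. The integrable contribution of \<open>C\<close> is removed beforehand: a
  tail integral \<open>rest\<close> drops over every edge delay by at least that contribution, so
  \<open>f + rest\<close> is an honest subsolution. Covering numbers do not decrease as the radius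
  \<open>exp (- t)\<close> shrinks, hence \<open>f i (t + x) \<ge> exp (- s x) f i t\<close> for
  \<open>x \<ge> 0\<close>; this one-sided inequality takes the place of continuity and is the
  reason why approximating walks may be slightly too long but never too short. Working on one coset
  of the cycle group at a time treats the dense and the lattice case together; the final dichotomy
  is read off from the classification of closed subgroups of the reals.\<close>

lemma covering_number_le:
  assumes "finite F" "A \<subseteq> (\<Union>c\<in>F. cball c \<rho>)"
  shows "covering_number \<rho> A \<le> card F"
  unfolding covering_number_def by (rule Least_le) (use assms in blast)

text \<open>\<open>LEAST\<close> says nothing unless some finite cover exists; total boundedness of
  the compact closure supplies one, so a minimal cover can be picked.\<close>

lemma covering_number_attained:
  fixes A :: "'a::euclidean_space set"
  assumes "bounded A" "\<rho> > 0"
  obtains F where "finite F" "card F = covering_number \<rho> A" "A \<subseteq> (\<Union>c\<in>F. cball c \<rho>)"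
proof -
  have "compact (closure A)" using assms(1) by (simp add: compact_closure)
  with assms(2) obtain K where K: "finite K" "closure A \<subseteq> (\<Union>c\<in>K. ball c \<rho>)"
    unfolding compact_eq_totally_bounded by blast
  have "(\<Union>c\<in>K. ball c \<rho>) \<subseteq> (\<Union>c\<in>K. cball c \<rho>)" by (rule UN_mono) auto
  with K(2) closure_subset[of A] have "A \<subseteq> (\<Union>c\<in>K. cball c \<rho>)" by (meson subset_trans)
  hence "\<exists>n F. finite F \<and> card F = n \<and> A \<subseteq> (\<Union>c\<in>F. cball c \<rho>)"
    using K(1) by blast
  from LeastI_ex[OF this] obtain F
    where "finite F" "card F = covering_number \<rho> A" "A \<subseteq> (\<Union>c\<in>F. cball c \<rho>)"
    unfolding covering_number_def by metis
  thus thesis by (rule that)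
qed

text \<open>Monotonicity in the radius is the source of the one-sided regularity in time of all
  normalized covering numbers.\<close>

lemma covering_number_mono:
  fixes A :: "'a::euclidean_space set"
  assumes "A \<subseteq> B" "bounded B" "0 < \<rho>" "\<rho> \<le> \<rho>'"
  shows "covering_number \<rho>' A \<le> covering_number \<rho> B"
proof -
  obtain F where F: "finite F" "card F = covering_number \<rho> B" "B \<subseteq> (\<Union>c\<in>F. cball c \<rho>)"
    by (rule covering_number_attained[OF assms(2,3)])
  have "(\<Union>c\<in>F. cball c \<rho>) \<subseteq> (\<Union>c\<in>F. cball c \<rho>')"
    by (rule UN_mono) (use assms(4) in auto)
  hence "A \<subseteq> (\<Union>c\<in>F. cball c \<rho>')"
    using F(3) assms(1) by (meson subset_trans)
  thus ?thesis using covering_number_le[OF F(1)] F(2) by metis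
qed

lemma covering_number_empty [simp]: "covering_number \<rho> {} = 0"
  using covering_number_le[of "{}" "{}"] by simp

lemma covering_number_pos:
  fixes A :: "'a::euclidean_space set"
  assumes "bounded A" "A \<noteq> {}" "\<rho> > 0"
  shows "covering_number \<rho> A \<ge> 1"
proof -
  obtain F where F: "finite F" "card F = covering_number \<rho> A" "A \<subseteq> (\<Union>c\<in>F. cball c \<rho>)"
    by (rule covering_number_attained[OF assms(1,3)])
  hence "F \<noteq> {}" using assms(2) by blast
  hence "card F > 0" using F(1) by (simp add: card_gt_0_iff)
  thus ?thesis using F(2) by simp
qed

lemma covering_number_Un:
  fixes A :: "'a::euclidean_space set"
  assumes "bounded A" "bounded B" "\<rho> > 0"
  shows "covering_number \<rho> (A \<union> B) \<le> covering_number \<rho> A + covering_number \<rho> B"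
proof -
  obtain F where F: "finite F" "card F = covering_number \<rho> A" "A \<subseteq> (\<Union>c\<in>F. cball c \<rho>)"
    by (rule covering_number_attained[OF assms(1,3)])
  obtain F' where F': "finite F'" "card F' = covering_number \<rho> B" "B \<subseteq> (\<Union>c\<in>F'. cball c \<rho>)"
    by (rule covering_number_attained[OF assms(2,3)])
  have "covering_number \<rho> (A \<union> B) \<le> card (F \<union> F')"
    by (rule covering_number_le) (use F F' in \<open>blast+\<close>)
  thus ?thesis using card_Un_le[of F F'] F F' by linarith
qed

lemma covering_number_UN:
  fixes A :: "'i \<Rightarrow> 'a::euclidean_space set"
  assumes "finite I" "\<And>i. i \<in> I \<Longrightarrow> bounded (A i)" "\<rho> > 0"
  shows "covering_number \<rho> (\<Union>i\<in>I. A i) \<le> (\<Sum>i\<in>I. covering_number \<rho> (A i))"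
  using assms(1,2)
proof (induction I)
  case (insert i I)
  have "covering_number \<rho> (A i \<union> (\<Union>i\<in>I. A i)) \<le> covering_number \<rho> (A i) + covering_number \<rho> (\<Union>i\<in>I. A i)"
    by (rule covering_number_Un) (use insert assms(3) in auto)
  thus ?case using insert by simp
qed simp

text \<open>A ball of radius \<rho> has diameter at most \<open>2 * \<rho>\<close> and so meets at
  most one of the sets. The balls of an optimal cover of \<open>B\<close> that meet the various
  \<open>A i\<close> thus form disjoint subfamilies, each covering its own set.\<close>

lemma sum_covering_number_le:
  fixes A :: "'i \<Rightarrow> 'a::euclidean_space set"
  assumes I: "finite I" and bd: "bounded B" and sub: "\<And>i. i \<in> I \<Longrightarrow> A i \<subseteq> B" and \<rho>: "\<rho> > 0"
    and sep: "\<And>i j x y. i \<in> I \<Longrightarrow> j \<in> I \<Longrightarrow> i \<noteq> j \<Longrightarrow> x \<in> A i \<Longrightarrow> y \<in> A j \<Longrightarrow> dist x y > 2 * \<rho>"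
  shows "(\<Sum>i\<in>I. covering_number \<rho> (A i)) \<le> covering_number \<rho> B"
proof -
  obtain F where F: "finite F" "card F = covering_number \<rho> B" "B \<subseteq> (\<Union>c\<in>F. cball c \<rho>)"
    by (rule covering_number_attained[OF bd \<rho>])
  define Fi where "Fi i = {c\<in>F. cball c \<rho> \<inter> A i \<noteq> {}}" for i
  have "covering_number \<rho> (A i) \<le> card (Fi i)" if i: "i \<in> I" for i
  proof (rule covering_number_le)
    show "A i \<subseteq> (\<Union>c\<in>Fi i. cball c \<rho>)"
    proof
      fix x assume x: "x \<in> A i"
      hence "x \<in> B" using sub[OF i] by blast
      then obtain c where "c \<in> F" "x \<in> cball c \<rho>" using F(3) by blast
      with x show "x \<in> (\<Union>c\<in>Fi i. cball c \<rho>)" unfolding Fi_def by blast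
    qed
  qed (use F in \<open>simp add: Fi_def\<close>)
  hence "(\<Sum>i\<in>I. covering_number \<rho> (A i)) \<le> (\<Sum>i\<in>I. card (Fi i))"
    by (rule sum_mono)
  also have "\<dots> = card (\<Union>i\<in>I. Fi i)"
  proof (rule card_UN_disjoint[symmetric])
    show "\<forall>i\<in>I. \<forall>j\<in>I. i \<noteq> j \<longrightarrow> Fi i \<inter> Fi j = {}"
    proof (intro ballI impI, rule ccontr)
      fix i j assume ij: "i \<in> I" "j \<in> I" "i \<noteq> j" "Fi i \<inter> Fi j \<noteq> {}"
      then obtain c where "cball c \<rho> \<inter> A i \<noteq> {}" "cball c \<rho> \<inter> A j \<noteq> {}"
        unfolding Fi_def by blast
      then obtain x y where "x \<in> A i" "y \<in> A j" "dist c x \<le> \<rho>" "dist c y \<le> \<rho>"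
        by (metis disjoint_iff mem_cball)
      moreover have "dist x y \<le> dist c x + dist c y"
        by (metis dist_commute dist_triangle)
      ultimately show False using sep[of i j x y] ij by linarith
    qed
  qed (use F I in \<open>auto simp: Fi_def\<close>)
  also have "\<dots> \<le> card F"
    by (rule card_mono) (use F in \<open>auto simp: Fi_def\<close>)
  finally show ?thesis using F by simp
qed

section \<open>Similarities\<close>

text \<open>Defined on the whole space and onto, unlike the maps \<open>S e\<close>: bijectivity
  lets images commute with complements, which all distances to complements rely on.\<close>

definition similarity :: "real \<Rightarrow> ('a::euclidean_space \<Rightarrow> 'a) \<Rightarrow> bool" where
  "similarity \<rho> T \<longleftrightarrow> \<rho> > 0 \<and> surj T \<and> (\<forall>x y. dist (T x) (T y) = \<rho> * dist x y)"

lemma similarityD: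
  assumes "similarity \<rho> T"
  shows "\<rho> > 0" "surj T" "dist (T x) (T y) = \<rho> * dist x y" "inj T" "bij T"
proof -
  show *: "\<rho> > 0" "surj T" "dist (T x) (T y) = \<rho> * dist x y" for x y
    using assms by (auto simp: similarity_def)
  show "inj T"
  proof (rule injI)
    fix x y assume "T x = T y"
    hence "\<rho> * dist x y = 0" using *(3)[of x y] by simp
    thus "x = y" using *(1) by simp
  qed
  thus "bij T" using * by (simp add: bij_def)
qed

text \<open>After normalization the map preserves distances and fixes 0, hence preserves inner
  products by polarization. An interior ball contains scaled basis vectors, whose images determine
  an orthogonal map that agrees with the given one on all of \<open>X\<close>.\<close>

lemma similarity_extension:
  fixes f :: "'a::euclidean_space \<Rightarrow> 'a"
  assumes \<rho>: "\<rho> > 0" and int: "interior X \<noteq> {}"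
    and f: "\<And>x y. x \<in> X \<Longrightarrow> y \<in> X \<Longrightarrow> dist (f x) (f y) = \<rho> * dist x y"
  obtains T where "similarity \<rho> T" "\<And>x. x \<in> X \<Longrightarrow> T x = f x"
proof -
  obtain z \<delta> where \<delta>: "\<delta> > 0" "cball z \<delta> \<subseteq> X"
    using int mem_interior_cball by blast
  hence z: "z \<in> X" using centre_in_cball[of z \<delta>] less_imp_le subsetD by metis
  define g where "g v = (f (z + v) - f z) /\<^sub>R \<rho>" for v
  define D where "D = {v. z + v \<in> X}"
  have dg: "dist (g u) (g v) = dist u v" if "u \<in> D" "v \<in> D" for u v
  proof -
    have "dist (g u) (g v) = norm ((f (z+u) - f (z+v)) /\<^sub>R \<rho>)"
      unfolding g_def dist_norm by (simp add: algebra_simps)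
    also have "\<dots> = dist (f (z+u)) (f (z+v)) / \<rho>" using \<rho> by (simp add: dist_norm divide_inverse_commute)
    also have "\<dots> = dist u v" using that f[of "z+u" "z+v"] \<rho> by (simp add: D_def)
    finally show ?thesis .
  qed
  have zD: "0 \<in> D" and g0: "g 0 = 0" using z by (auto simp: D_def g_def)
  have ng: "norm (g u) = norm u" if "u \<in> D" for u
    using dg[OF that zD] g0 by simp
  have ig: "g u \<bullet> g v = u \<bullet> v" if "u \<in> D" "v \<in> D" for u v
    using dg[OF that] ng that by (simp add: dist_norm dot_norm_neg)
  have bD: "\<delta> *\<^sub>R b \<in> D" if "b \<in> Basis" for b
  proof -
    have "z + \<delta> *\<^sub>R b \<in> cball z \<delta>" using \<delta>(1) that by (simp add: dist_norm)
    thus ?thesis using \<delta>(2) unfolding D_def by blast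
  qed
  \<comment> \<open>The ball radius \<delta> brings the basis vectors into the domain
    \<open>D\<close> of \<open>g\<close>; dividing it out again makes the images
    orthonormal.\<close>
  define q where "q b = g (\<delta> *\<^sub>R b) /\<^sub>R \<delta>" for b
  have iq: "q b \<bullet> q c = (if b = c then 1 else 0)" if "b \<in> Basis" "c \<in> Basis" for b c
  proof -
    have "q b \<bullet> q c = (\<delta> * \<delta> * (b \<bullet> c)) / (\<delta> * \<delta>)"
      unfolding q_def using ig[OF bD[OF that(1)] bD[OF that(2)]] by (simp add: field_simps)
    thus ?thesis using that \<delta>(1) by (simp add: inner_Basis)
  qed
  have iqg: "g v \<bullet> q b = v \<bullet> b" if "b \<in> Basis" "v \<in> D" for b v
    unfolding q_def using ig[OF that(2) bD[OF that(1)]] \<delta>(1) by simp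
  define L where "L v = (\<Sum>b\<in>Basis. (v \<bullet> b) *\<^sub>R q b)" for v
  have linL: "linear L"
    unfolding L_def by (rule linearI) (simp_all add: inner_add_left scaleR_add_left sum.distrib scaleR_sum_right)
  have iL: "L u \<bullet> q c = u \<bullet> c" if "c \<in> Basis" for u c
  proof -
    have "L u \<bullet> q c = (\<Sum>b\<in>Basis. (u \<bullet> b) * (q b \<bullet> q c))" by (simp add: L_def inner_sum_left)
    also have "\<dots> = (\<Sum>b\<in>Basis. if b = c then u \<bullet> b else 0)"
      by (rule sum.cong) (use iq that in auto)
    also have "\<dots> = u \<bullet> c" using that by simp
    finally show ?thesis .
  qed
  have LL: "L u \<bullet> L v = u \<bullet> v" for u v
  proof -
    have "L u \<bullet> L v = (\<Sum>b\<in>Basis. (v \<bullet> b) * (L u \<bullet> q b))"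
      by (subst (2) L_def) (simp add: inner_sum_right)
    also have "\<dots> = (\<Sum>b\<in>Basis. (u \<bullet> b) * (v \<bullet> b))"
      by (rule sum.cong) (simp_all add: iL)
    also have "\<dots> = u \<bullet> v" by (rule euclidean_inner[symmetric])
    finally show ?thesis .
  qed
  have orth: "orthogonal_transformation L"
    using linL LL by (simp add: orthogonal_transformation_def)
  have Lg: "L v = g v" if v: "v \<in> D" for v
  proof -
    \<comment> \<open>Both vectors have norm \<open>norm v\<close>, so an inner product equal to
      \<open>v \<bullet> v\<close> forces them to coincide.\<close>
    have "g v \<bullet> L v = (\<Sum>b\<in>Basis. (v \<bullet> b) * (g v \<bullet> q b))"
      unfolding L_def by (simp add: inner_sum_right)
    also have "\<dots> = (\<Sum>b\<in>Basis. (v \<bullet> b) * (v \<bullet> b))"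
      by (rule sum.cong) (simp_all add: iqg v)
    also have "\<dots> = v \<bullet> v" by (rule euclidean_inner[symmetric])
    finally have "g v \<bullet> L v = v \<bullet> v" .
    hence "(L v - g v) \<bullet> (L v - g v) = 0"
      using LL[of v v] ig[OF v v] by (simp add: inner_diff_left inner_diff_right inner_commute)
    thus ?thesis by simp
  qed
  define T where "T x = f z + \<rho> *\<^sub>R L (x - z)" for x
  have Tf: "T x = f x" if "x \<in> X" for x
    using Lg[of "x - z"] that \<rho> by (simp add: T_def g_def D_def)
  have "similarity \<rho> T"
    unfolding similarity_def
  proof (intro conjI allI)
    show "dist (T x) (T y) = \<rho> * dist x y" for x y
    proof -
      have "dist (T x) (T y) = norm (\<rho> *\<^sub>R L (x - y))"
      proof -
        have "T x - T y = \<rho> *\<^sub>R (L (x - z) - L (y - z))"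
          unfolding T_def by (simp add: scaleR_diff_right)
        also have "L (x - z) - L (y - z) = L ((x - z) - (y - z))" by (rule linear_diff[OF linL, symmetric])
        finally show ?thesis by (simp add: dist_norm)
      qed
      also have "\<dots> = \<rho> * norm (L (x - y))" using \<rho> by simp
      also have "norm (L (x - y)) = dist x y" using orthogonal_transformation_norm[OF orth] by (simp add: dist_norm)
      finally show ?thesis .
    qed
    show "surj T"
    proof (rule surjI)
      fix y
      show "T (z + inv_into UNIV L ((y - f z) /\<^sub>R \<rho>)) = y"
      proof -
        have "L (inv_into UNIV L ((y - f z) /\<^sub>R \<rho>)) = (y - f z) /\<^sub>R \<rho>"
          by (rule surj_f_inv_f[OF orthogonal_transformation_surj[OF orth]])
        thus ?thesis unfolding T_def using \<rho> by simp
      qed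
    qed
  qed (rule \<rho>)
  thus thesis using Tf by (rule that)
qed

lemma similarity_inv:
  assumes "similarity \<rho> T"
  shows "similarity (1/\<rho>) (inv_into UNIV T)"
  unfolding similarity_def
proof (intro conjI allI)
  note s = similarityD[OF assms]
  show "1/\<rho> > 0" using s(1) by simp
  show "surj (inv_into UNIV T)" using s(5) by (simp add: bij_imp_bij_inv bij_is_surj)
  fix x y
  have "dist x y = \<rho> * dist (inv_into UNIV T x) (inv_into UNIV T y)"
    using s(3)[of "(inv_into UNIV T x)" "(inv_into UNIV T y)"] s(2) by (simp add: surj_f_inv_f)
  thus "dist (inv_into UNIV T x) (inv_into UNIV T y) = 1/\<rho> * dist x y" using s(1) by simp
qed

lemma bounded_similarity_image:
  assumes "similarity \<rho> T" "bounded A"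
  shows "bounded (T ` A)"
proof -
  obtain B where "\<forall>x\<in>A. \<forall>y\<in>A. dist x y \<le> B" using assms(2) by (auto simp: bounded_two_points)
  hence "\<forall>x\<in>T`A. \<forall>y\<in>T`A. dist x y \<le> \<rho> * B"
    using similarityD(1,3)[OF assms(1)] by auto
  thus ?thesis by (auto simp: bounded_two_points)
qed

lemma covering_number_similarity_le:
  fixes A :: "'a::euclidean_space set"
  assumes T: "similarity \<rho> T" and "bounded A" "\<epsilon> > 0"
  shows "covering_number (\<rho> * \<epsilon>) (T ` A) \<le> covering_number \<epsilon> A"
proof -
  obtain F where F: "finite F" "card F = covering_number \<epsilon> A" "A \<subseteq> (\<Union>c\<in>F. cball c \<epsilon>)"
    by (rule covering_number_attained[OF assms(2,3)])
  have "covering_number (\<rho> * \<epsilon>) (T ` A) \<le> card (T ` F)"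
  proof (rule covering_number_le)
    show "T ` A \<subseteq> (\<Union>c\<in>T ` F. cball c (\<rho> * \<epsilon>))"
    proof
      fix y assume "y \<in> T ` A"
      then obtain x c where "y = T x" "c \<in> F" "dist c x \<le> \<epsilon>" using F(3) by auto
      thus "y \<in> (\<Union>c\<in>T ` F. cball c (\<rho> * \<epsilon>))"
        using similarityD(1,3)[OF T] by auto
    qed
  qed (use F in simp)
  also have "\<dots> \<le> card F" using F(1) by (rule card_image_le)
  finally show ?thesis using F(2) by simp
qed

text \<open>The reverse inequality is the same estimate applied to the inverse similarity, of ratio
  \<open>1 / \<rho>\<close>.\<close>

lemma covering_number_similarity:
  fixes A :: "'a::euclidean_space set"
  assumes T: "similarity \<rho> T" and A: "bounded A" and \<epsilon>: "\<epsilon> > 0"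
  shows "covering_number (\<rho> * \<epsilon>) (T ` A) = covering_number \<epsilon> A"
proof (rule antisym)
  note s = similarityD[OF T]
  show "covering_number (\<rho> * \<epsilon>) (T ` A) \<le> covering_number \<epsilon> A"
    by (rule covering_number_similarity_le[OF assms])
  have "covering_number (1/\<rho> * (\<rho> * \<epsilon>)) (inv_into UNIV T ` (T ` A)) \<le> covering_number (\<rho> * \<epsilon>) (T ` A)"
    by (rule covering_number_similarity_le[OF similarity_inv[OF T] bounded_similarity_image[OF T A]])
      (use s(1) \<epsilon> in simp)
  thus "covering_number \<epsilon> A \<le> covering_number (\<rho> * \<epsilon>) (T ` A)"
    using s(1,4) by (simp add: image_comp)
qed

lemma similarity_infdist_ge:
  assumes "similarity \<rho> T" "W \<noteq> {}"
  shows "infdist (T x) (T ` W) \<ge> \<rho> * infdist x W"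
proof -
  have "\<rho> * infdist x W \<le> dist (T x) y" if y: "y \<in> T ` W" for y
  proof -
    obtain w where "w \<in> W" "y = T w" using y by blast
    thus ?thesis using similarityD(1,3)[OF assms(1)] infdist_le[of w W x] by simp
  qed
  hence "\<rho> * infdist x W \<le> (INF y\<in>T ` W. dist (T x) y)"
    by (intro cINF_greatest) (use assms(2) in simp_all)
  thus ?thesis using assms(2) by (simp add: infdist_def)
qed

lemma similarity_infdist:
  assumes T: "similarity \<rho> T" and W: "W \<noteq> {}"
  shows "infdist (T x) (T ` W) = \<rho> * infdist x W"
proof (rule antisym)
  note s = similarityD[OF T]
  have "1/\<rho> * infdist (T x) (T ` W) \<le> infdist (inv_into UNIV T (T x)) (inv_into UNIV T ` T ` W)"
    by (rule similarity_infdist_ge[OF similarity_inv[OF T]]) (use W in simp)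
  also have "\<dots> = infdist x W" using s(4) by (simp add: image_comp)
  finally show "infdist (T x) (T ` W) \<le> \<rho> * infdist x W" using s(1) by (simp add: field_simps)
qed (rule similarity_infdist_ge[OF assms])

text \<open>Depth inside a set, measured as distance to its complement, scales like any other
  distance because a bijection maps complements to complements.\<close>

lemma infdist_Compl_similarity:
  assumes "similarity \<rho> T" "- W \<noteq> {}"
  shows "infdist (T x) (- T ` W) = \<rho> * infdist x (- W)"
proof -
  have "- T ` W = T ` (- W)" using similarityD(5)[OF assms(1)] by (rule bij_image_Compl_eq[symmetric])
  thus ?thesis using similarity_infdist[OF assms] by simp
qed

no_notation vec_nth (infixl "$" 90)

section \<open>Perron-Frobenius eigenvectors and the critical exponent\<close>

lemma finite_family_convergent_subsequence:
  fixes u :: "nat \<Rightarrow> 'v \<Rightarrow> real"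
  assumes "finite V" "\<And>n i. i \<in> V \<Longrightarrow> \<bar>u n i\<bar> \<le> B"
  obtains \<phi> :: "nat \<Rightarrow> nat" and l where "strict_mono \<phi>" "\<And>i. i \<in> V \<Longrightarrow> (\<lambda>n. u (\<phi> n) i) \<longlonglongrightarrow> l i"
proof -
  have "\<exists>\<phi> l. strict_mono (\<phi>::nat\<Rightarrow>nat) \<and> (\<forall>i\<in>V. (\<lambda>n. u (\<phi> n) i) \<longlonglongrightarrow> l i)"
    using assms
  proof (induction V)
    case empty
    show ?case by (rule exI[of _ id]) (simp add: strict_mono_def)
  next
    case (insert j V)
    then obtain \<phi> l where \<phi>: "strict_mono (\<phi>::nat\<Rightarrow>nat)" "\<forall>i\<in>V. (\<lambda>n. u (\<phi> n) i) \<longlonglongrightarrow> l i"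
      by auto
    have "bounded (range (\<lambda>n. u (\<phi> n) j))"
      by (rule boundedI[of _ B]) (use insert.prems in auto)
    then obtain x \<psi> where \<psi>: "strict_mono (\<psi>::nat\<Rightarrow>nat)" "((\<lambda>n. u (\<phi> n) j) \<circ> \<psi>) \<longlonglongrightarrow> x"
      using bounded_imp_convergent_subsequence by blast
    have "(\<lambda>n. u ((\<phi> \<circ> \<psi>) n) i) \<longlonglongrightarrow> (l(j := x)) i" if "i \<in> insert j V" for i
    proof (cases "i = j")
      case True
      thus ?thesis using \<psi>(2) by (simp add: o_def)
    next
      case False
      hence "(\<lambda>n. u (\<phi> n) i) \<longlonglongrightarrow> l i" using that \<phi>(2) by blast
      from LIMSEQ_subseq_LIMSEQ[OF this \<psi>(1)] show ?thesis using False by (simp add: o_def)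
    qed
    moreover have "strict_mono (\<phi> \<circ> \<psi>)" using \<phi>(1) \<psi>(1) by (rule strict_mono_o)
    ultimately show ?case by blast
  qed
  thus thesis using that by blast
qed

text \<open>Evaluating both inequalities at an index where the quotient of \<open>u\<close> and
  \<open>w\<close> is maximal, with value \<open>t\<close>, gives
  \<open>lam * u i \<le> t * \<kappa> * w i = \<kappa> * u i\<close>. This comparison later yields
  both the bound on the spectral radius and the dependence of the eigenvalue on the
  exponent.\<close>

lemma collatz_wielandt:
  fixes a :: "'v \<Rightarrow> 'v \<Rightarrow> real"
  assumes V: "finite V" and a: "\<And>i j. i \<in> V \<Longrightarrow> j \<in> V \<Longrightarrow> a i j \<ge> 0"
    and w: "\<And>i. i \<in> V \<Longrightarrow> w i > 0" "\<And>i. i \<in> V \<Longrightarrow> (\<Sum>j\<in>V. a i j * w j) \<le> \<kappa> * w i"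
    and u: "\<And>i. i \<in> V \<Longrightarrow> u i \<ge> 0" "k \<in> V" "u k > 0"
      "\<And>i. i \<in> V \<Longrightarrow> lam * u i \<le> (\<Sum>j\<in>V. a i j * u j)"
  shows "lam \<le> \<kappa>"
proof -
  define t where "t = Max ((\<lambda>i. u i / w i) ` V)"
  have "t \<in> (\<lambda>i. u i / w i) ` V" unfolding t_def using V u(2) by (intro Max_in) auto
  then obtain i where i: "i \<in> V" "t = u i / w i" by blast
  have t: "u j \<le> t * w j" if "j \<in> V" for j
  proof -
    have "u j / w j \<le> t" unfolding t_def using V that by (intro Max_ge) auto
    thus ?thesis using w(1)[OF that] by (simp add: field_simps)
  qed
  have "0 < t * w k" using t[OF u(2)] u(3) by linarith
  hence t0: "t > 0" using w(1)[OF u(2)] by (simp add: zero_less_mult_iff)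
  have ui: "u i = t * w i" using i w(1)[OF i(1)] by simp
  have "lam * u i \<le> (\<Sum>j\<in>V. a i j * u j)" by (rule u(4)[OF i(1)])
  also have "\<dots> \<le> (\<Sum>j\<in>V. t * (a i j * w j))"
  proof (rule sum_mono)
    fix j assume "j \<in> V"
    thus "a i j * u j \<le> t * (a i j * w j)"
      using mult_left_mono[OF t a[OF i(1)], of j j] by (simp add: mult.left_commute)
  qed
  also have "\<dots> = t * (\<Sum>j\<in>V. a i j * w j)" by (simp add: sum_distrib_left)
  also have "\<dots> \<le> t * (\<kappa> * w i)" using w(2)[OF i(1)] t0 by simp
  also have "\<dots> = \<kappa> * u i" by (simp add: ui)
  finally show ?thesis using ui t0 w(1)[OF i(1)] by simp
qed

text \<open>A maximiser of \<open>lam\<close> subject to \<open>lam u \<le> a u\<close> whose set of equality indices is smallest is an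
  eigenvector: by irreducibility some equality index \<open>i\<close> sees a strict index \<open>k\<close>, and increasing
  \<open>u k\<close> slightly makes \<open>i\<close> strict too.\<close>

lemma perron_frobenius:
  fixes a :: "'v \<Rightarrow> 'v \<Rightarrow> real"
  assumes V: "finite V" "V \<noteq> {}" and a: "\<And>i j. i \<in> V \<Longrightarrow> j \<in> V \<Longrightarrow> a i j \<ge> 0"
    and irr: "\<And>Z. Z \<subseteq> V \<Longrightarrow> Z \<noteq> {} \<Longrightarrow> Z \<noteq> V \<Longrightarrow> \<exists>i\<in>Z. \<exists>k\<in>V - Z. a i k > 0"
  shows "\<exists>w lam. (\<forall>i\<in>V. w i > 0) \<and> (\<forall>i\<in>V. (\<Sum>j\<in>V. a i j * w j) = lam * w i)"
proof -
  define A where "A u i = (\<Sum>j\<in>V. a i j * u j)" for u i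
  define P where "P lam u \<longleftrightarrow> (\<forall>i\<in>V. 0 \<le> u i) \<and> (\<exists>i\<in>V. 0 < u i) \<and> (\<forall>i\<in>V. lam * u i \<le> A u i)" for lam and u :: "'v \<Rightarrow> real"
  define \<Lambda> where "\<Lambda> = {lam. \<exists>u. P lam u}"
  have normal: "\<exists>u. P lam u \<and> sum u V = 1" if lam: "lam \<in> \<Lambda>" for lam
  proof -
    obtain u where u: "P lam u" using lam unfolding \<Lambda>_def by blast
    define c where "c = sum u V"
    have c: "c > 0" unfolding c_def using u V by (auto simp: P_def intro: sum_pos2)
    have Ac: "A (\<lambda>i. u i / c) i = A u i / c" for i by (simp add: A_def sum_divide_distrib)
    have "P lam (\<lambda>i. u i / c)"
      using u c unfolding P_def Ac by (auto simp: divide_right_mono zero_less_divide_iff)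
    moreover have "(\<Sum>i\<in>V. u i / c) = 1" using c by (simp add: c_def flip: sum_divide_distrib)
    ultimately show ?thesis by blast
  qed
  have zero: "0 \<in> \<Lambda>"
    unfolding \<Lambda>_def P_def A_def using V a by (auto intro!: exI[of _ "\<lambda>_. 1"] sum_nonneg)
  have le1: "u i \<le> 1" if "P lam u" "sum u V = 1" "i \<in> V" for u i lam
    using member_le_sum[of i V u] that V by (auto simp: P_def)
  have bdd: "bdd_above \<Lambda>"
  proof (rule bdd_aboveI)
    fix lam assume "lam \<in> \<Lambda>"
    then obtain u where u: "P lam u" "sum u V = 1" using normal by blast
    \<comment> \<open>Summation over all rows: the coordinates of \<open>u\<close> sum to 1 and each
      is at most 1, so \<open>lam\<close> is at most the total of the entries.\<close>
    have "lam = (\<Sum>i\<in>V. lam * u i)" using u(2) by (simp flip: sum_distrib_left)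
    also have "\<dots> \<le> (\<Sum>i\<in>V. A u i)" using u(1) by (intro sum_mono) (simp add: P_def)
    also have "\<dots> \<le> (\<Sum>i\<in>V. \<Sum>j\<in>V. a i j)"
      unfolding A_def by (intro sum_mono mult_left_le le1[OF u] a)
    finally show "lam \<le> (\<Sum>i\<in>V. \<Sum>j\<in>V. a i j)" .
  qed
  define m where "m = Sup \<Lambda>"
  have "\<exists>lam\<in>\<Lambda>. m - 1 / (real n + 1) < lam" for n
    unfolding m_def by (rule less_cSupD) (use zero in auto)
  hence "\<exists>lam u. m - 1 / (real n + 1) < lam \<and> P lam u \<and> sum u V = 1" for n
    using normal by blast
  then obtain l u where lu: "\<And>n. m - 1 / (real n + 1) < l n" "\<And>n. P (l n) (u n)" "\<And>n. sum (u n) V = 1"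
    by metis
  obtain \<phi> v where v: "strict_mono (\<phi>::nat\<Rightarrow>nat)" "\<And>i. i \<in> V \<Longrightarrow> (\<lambda>n. u (\<phi> n) i) \<longlonglongrightarrow> v i"
  proof (rule finite_family_convergent_subsequence[OF V(1), of u 1])
    show "\<bar>u n i\<bar> \<le> 1" if "i \<in> V" for n i
      using le1[OF lu(2,3) that] lu(2)[of n] that by (simp add: P_def)
  qed (use that in blast)
  have v0: "0 \<le> v i" if "i \<in> V" for i
    by (rule LIMSEQ_le_const[OF v(2)[OF that]]) (use lu(2) that in \<open>auto simp: P_def\<close>)
  have "(\<lambda>n. sum (u (\<phi> n)) V) \<longlonglongrightarrow> sum v V"
    by (intro tendsto_sum v(2))
  hence "sum v V = 1" using lu(3) by (simp add: LIMSEQ_const_iff)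
  hence "\<not> (\<forall>i\<in>V. v i \<le> 0)" using sum_nonpos[of V v] by auto
  hence v1: "\<exists>i\<in>V. 0 < v i" by (simp add: not_le)
  \<comment> \<open>Weak inequalities and the normalization survive the limit, so the supremum
    \<open>m\<close> is attained by \<open>v\<close>.\<close>
  have "m * v i \<le> A v i" if i: "i \<in> V" for i
  proof -
    have "(\<lambda>n. 1 / (real n + 1)) \<longlonglongrightarrow> 0"
      using LIMSEQ_inverse_real_of_nat by (simp add: inverse_eq_divide add.commute)
    hence "(\<lambda>n. 1 / (real (\<phi> n) + 1)) \<longlonglongrightarrow> 0"
      using LIMSEQ_subseq_LIMSEQ[OF _ v(1)] by (simp add: o_def)
    hence "(\<lambda>n. (m - 1 / (real (\<phi> n) + 1)) * u (\<phi> n) i) \<longlonglongrightarrow> (m - 0) * v i"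
      by (intro tendsto_intros v(2)[OF i])
    moreover have "(\<lambda>n. A (u (\<phi> n)) i) \<longlonglongrightarrow> A v i"
      unfolding A_def by (intro tendsto_intros v(2))
    moreover have "(m - 1 / (real (\<phi> n) + 1)) * u (\<phi> n) i \<le> A (u (\<phi> n)) i" for n
    proof -
      have "(m - 1 / (real (\<phi> n) + 1)) * u (\<phi> n) i \<le> l (\<phi> n) * u (\<phi> n) i"
        using lu(1)[of "\<phi> n"] lu(2)[of "\<phi> n"] i by (intro mult_right_mono) (auto simp: P_def)
      also have "\<dots> \<le> A (u (\<phi> n)) i" using lu(2) i by (simp add: P_def)
      finally show ?thesis .
    qed
    ultimately show ?thesis using LIMSEQ_le by fastforce
  qed
  hence Pv: "P m v" using v0 v1 by (simp add: P_def)
  define Eq where "Eq u = {i\<in>V. A u i = m * u i}" for u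
  obtain w where w: "P m w" and wmin: "\<And>u. P m u \<Longrightarrow> card (Eq w) \<le> card (Eq u)"
    using ex_has_least_nat[of "P m" v "\<lambda>u. card (Eq u)"] Pv by blast
  have sub: "m * w i < A w i" if "i \<in> V" "i \<notin> Eq w" for i
    using w that by (auto simp: P_def Eq_def order_less_le)
  have ne: "Eq w \<noteq> {}"
  proof
    assume E: "Eq w = {}"
    \<comment> \<open>Slack in every row would allow a larger value than \<open>m\<close>. The
      summand 1 keeps the denominator positive where \<open>w i\<close> vanishes.\<close>
    define \<epsilon> where "\<epsilon> = Min ((\<lambda>i. (A w i - m * w i) / (1 + w i)) ` V)"
    have \<epsilon>0: "\<epsilon> > 0"
      unfolding \<epsilon>_def using V sub E w by (subst Min_gr_iff) (auto simp: P_def add_pos_nonneg)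
    have "P (m + \<epsilon>) w"
      unfolding P_def
    proof (intro conjI ballI)
      fix i assume i: "i \<in> V"
      have "\<epsilon> \<le> (A w i - m * w i) / (1 + w i)" unfolding \<epsilon>_def using V i by (intro Min_le) auto
      moreover have "w i \<ge> 0" using w i by (simp add: P_def)
      ultimately have "\<epsilon> * (1 + w i) \<le> A w i - m * w i" by (simp add: field_simps)
      thus "(m + \<epsilon>) * w i \<le> A w i" using \<epsilon>0 by (simp add: algebra_simps)
    qed (use w in \<open>auto simp: P_def\<close>)
    hence "m + \<epsilon> \<le> m" unfolding m_def by (intro cSup_upper bdd) (auto simp: \<Lambda>_def)
    thus False using \<epsilon>0 by simp
  qed
  have "Eq w = V"
  proof (rule ccontr)
    assume "Eq w \<noteq> V"
    then obtain i k where ik: "i \<in> Eq w" "k \<in> V" "k \<notin> Eq w" "a i k > 0"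
      using irr[of "Eq w"] ne by (auto simp: Eq_def)
    \<comment> \<open>The increase spends at most half of the slack at \<open>k\<close>; the form
      \<open>1 + \<bar>m\<bar>\<close> covers \<open>m = 0\<close> as well. In the other rows it
      does no harm, since the entries of \<open>a\<close> are nonnegative.\<close>
    define \<eta> where "\<eta> = (A w k - m * w k) / (2 * (1 + \<bar>m\<bar>))"
    have dk: "A w k - m * w k > 0" using sub[OF ik(2,3)] by simp
    hence \<eta>: "\<eta> > 0" unfolding \<eta>_def by (intro divide_pos_pos) auto
    have "m * \<eta> \<le> \<bar>m\<bar> * \<eta>" using \<eta> by (intro mult_right_mono) auto
    also have "\<dots> < 2 * (1 + \<bar>m\<bar>) * \<eta>" using \<eta> by (intro mult_strict_right_mono) auto
    also have "\<dots> = A w k - m * w k" unfolding \<eta>_def by (simp add: field_simps)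
    finally have m\<eta>: "m * \<eta> < A w k - m * w k" .
    define w' where "w' = w(k := w k + \<eta>)"
    have A': "A w' j = A w j + a j k * \<eta>" if "j \<in> V" for j
    proof -
      have "A w' j = (\<Sum>l\<in>V. a j l * w l + (if l = k then a j k * \<eta> else 0))"
        unfolding A_def w'_def by (rule sum.cong) (auto simp: algebra_simps)
      also have "\<dots> = A w j + a j k * \<eta>" using V ik(2) by (simp add: sum.distrib A_def)
      finally show ?thesis .
    qed
    have A'ge: "A w j \<le> A w' j" if "j \<in> V" for j
      using A'[OF that] a[OF that ik(2)] \<eta> by simp
    have strict_k: "m * w' k < A w' k"
      using m\<eta> A'ge[OF ik(2)] by (simp add: w'_def algebra_simps)
    have "P m w'"
      unfolding P_def
    proof (intro conjI ballI)
      fix j assume j: "j \<in> V"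
      show "0 \<le> w' j" using w j \<eta> by (auto simp: P_def w'_def)
      show "m * w' j \<le> A w' j"
      proof (cases "j = k")
        case False
        hence "w' j = w j" by (simp add: w'_def)
        moreover have "m * w j \<le> A w j" using w j by (simp add: P_def)
        ultimately show ?thesis using A'ge[OF j] by simp
      qed (use strict_k in simp)
    next
      have "0 \<le> w k" using w ik(2) by (simp add: P_def)
      thus "\<exists>i\<in>V. 0 < w' i" using ik(2) \<eta> by (intro bexI[of _ k]) (auto simp: w'_def)
    qed
    moreover have "Eq w' \<subset> Eq w"
    proof -
      have "j \<in> Eq w - {i}" if "j \<in> Eq w'" for j
      proof -
        have j: "j \<in> V" "A w' j = m * w' j" using that by (auto simp: Eq_def)
        hence jk: "j \<noteq> k" using strict_k by auto
        hence "w' j = w j" by (simp add: w'_def)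
        hence *: "A w j + a j k * \<eta> = m * w j" using j A'[OF j(1)] by simp
        have "m * w j \<le> A w j" using w j(1) by (simp add: P_def)
        moreover have "a j k * \<eta> \<ge> 0" using a[OF j(1) ik(2)] \<eta> by simp
        ultimately have "A w j = m * w j" "a j k * \<eta> = 0" using * by linarith+
        thus ?thesis using j(1) \<eta> ik(4) by (auto simp: Eq_def)
      qed
      thus ?thesis using ik(1) by blast
    qed
    hence "card (Eq w') < card (Eq w)" using V by (intro psubset_card_mono) (auto simp: Eq_def)
    ultimately show False using wmin[of w'] by simp
  qed
  hence eig: "A w i = m * w i" if "i \<in> V" for i using that by (auto simp: Eq_def)
  have "w i > 0" if "i \<in> V" for i
  proof (rule ccontr)
    assume "\<not> w i > 0"
    \<comment> \<open>An eigenvector vanishing at \<open>j\<close> vanishes at every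
      \<open>k\<close> with \<open>a j k > 0\<close>, so a nonempty zero set would contradict
      irreducibility.\<close>
    define Z where "Z = {i\<in>V. w i = 0}"
    have "i \<in> Z" using \<open>\<not> w i > 0\<close> w that by (force simp: P_def Z_def)
    moreover have "Z \<noteq> V"
    proof -
      obtain k where "k \<in> V" "0 < w k" using w unfolding P_def by blast
      hence "k \<notin> Z" by (simp add: Z_def)
      thus ?thesis using \<open>k \<in> V\<close> by blast
    qed
    ultimately obtain j k where jk: "j \<in> Z" "k \<in> V - Z" "a j k > 0"
      using irr[of Z] by (auto simp: Z_def)
    have "w k > 0" using jk(2) w by (auto simp: Z_def P_def order_less_le)
    hence "0 < a j k * w k" using jk(3) by simp
    also have "\<dots> \<le> A w j" unfolding A_def
      using jk w V a by (intro member_le_sum) (auto simp: Z_def P_def)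
    also have "\<dots> = 0" using eig[of j] jk(1) by (simp add: Z_def)
    finally show False by simp
  qed
  thus ?thesis using eig unfolding A_def by blast
qed

text \<open>\<open>lam\<close> is itself an eigenvalue. Conversely, absolute values in an
  eigenvector equation for \<mu> give a nonnegative vector \<open>u\<close> with
  \<open>norm \<mu> * u \<le> a u\<close> entrywise, and comparison with the positive eigenvector
  \<open>w\<close> bounds \<open>norm \<mu>\<close> by \<open>lam\<close>.\<close>

lemma spectral_radius_positive_eigenvector:
  fixes a :: "nat \<Rightarrow> nat \<Rightarrow> real"
  assumes n: "n > 0" and a: "\<And>i j. i < n \<Longrightarrow> j < n \<Longrightarrow> a i j \<ge> 0"
    and w: "\<And>i. i < n \<Longrightarrow> w i > 0" "\<And>i. i < n \<Longrightarrow> (\<Sum>j<n. a i j * w j) = lam * w i"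
  shows "spectral_radius (Matrix.mat n n (\<lambda>(i, j). complex_of_real (a i j))) = lam" (is "spectral_radius ?A = _")
proof (rule antisym)
  have A: "?A \<in> carrier_mat n n" by simp
  have mult: "(?A *\<^sub>v v) $ i = (\<Sum>j<n. complex_of_real (a i j) * v $ j)"
    if "v \<in> carrier_vec n" "i < n" for v i
    using that by (simp add: scalar_prod_def atLeast0LessThan)
  have "0 \<le> (\<Sum>j<n. a 0 j * w j)"
    by (rule sum_nonneg) (use a n w(1) in \<open>auto simp: less_imp_le\<close>)
  hence "0 \<le> lam * w 0" using w(2)[OF n] by simp
  hence lam0: "lam \<ge> 0" using w(1)[OF n] by (simp add: zero_le_mult_iff)
  define W where "W = Matrix.vec n (\<lambda>i. complex_of_real (w i))"
  have W: "W \<in> carrier_vec n" by (simp add: W_def)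
  have "?A *\<^sub>v W = complex_of_real lam \<cdot>\<^sub>v W"
  proof (rule eq_vecI)
    fix i assume "i < dim_vec (complex_of_real lam \<cdot>\<^sub>v W)"
    hence i: "i < n" by (simp add: W_def)
    have "(?A *\<^sub>v W) $ i = complex_of_real (\<Sum>j<n. a i j * w j)"
      using mult[OF W i] by (simp add: W_def)
    thus "(?A *\<^sub>v W) $ i = (complex_of_real lam \<cdot>\<^sub>v W) $ i"
      using w(2)[OF i] i by (simp add: W_def)
  qed (simp add: W_def)
  moreover have "W \<noteq> 0\<^sub>v n"
  proof
    assume "W = 0\<^sub>v n"
    hence "W $ 0 = 0\<^sub>v n $ 0" by simp
    thus False using n w(1)[OF n] by (simp add: W_def)
  qed
  ultimately have "complex_of_real lam \<in> spectrum ?A"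
    unfolding spectrum_def eigenvalue_def eigenvector_def using W by auto
  hence "norm (complex_of_real lam) \<in> norm ` spectrum ?A" by (rule imageI)
  from spectral_radius_mem_max(2)[OF A n this] lam0
  show "lam \<le> spectral_radius ?A" by simp
  obtain \<mu> where \<mu>: "\<mu> \<in> spectrum ?A" "spectral_radius ?A = norm \<mu>"
    using spectral_radius_mem_max(1)[OF A n] by blast
  then obtain v where v: "v \<in> carrier_vec n" "v \<noteq> 0\<^sub>v n" "?A *\<^sub>v v = \<mu> \<cdot>\<^sub>v v"
    unfolding spectrum_def eigenvalue_def eigenvector_def by auto
  obtain k where k: "k < n" "v $ k \<noteq> 0"
    using v(1,2) by (metis carrier_vecD eq_vecI index_zero_vec)
  have "norm \<mu> \<le> lam"
  proof (rule collatz_wielandt[of "{..<n}" a w lam "\<lambda>i. norm (v $ i)" k])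
    fix i assume "i \<in> {..<n}"
    hence i: "i < n" by simp
    have "norm \<mu> * norm (v $ i) = norm ((\<mu> \<cdot>\<^sub>v v) $ i)" using i v(1) by (simp add: norm_mult)
    also have "\<dots> = norm (\<Sum>j<n. complex_of_real (a i j) * v $ j)"
      using mult[OF v(1) i] v(3) by simp
    also have "\<dots> \<le> (\<Sum>j<n. norm (complex_of_real (a i j) * v $ j))" by (rule norm_sum)
    also have "\<dots> = (\<Sum>j\<in>{..<n}. a i j * norm (v $ j))"
      by (rule sum.cong) (use a i in \<open>auto simp: norm_mult\<close>)
    finally show "norm \<mu> * norm (v $ i) \<le> (\<Sum>j\<in>{..<n}. a i j * norm (v $ j))" .
  qed (use a w k in auto)
  thus "spectral_radius ?A \<le> lam" using \<mu>(2) by simp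
qed

text \<open>Converts strong connectivity into the set-wise irreducibility that the Perron-Frobenius
  argument asks for.\<close>

lemma (in wf_digraph) awalk_leaves_set:
  assumes "awalk u p v" "u \<in> Z" "v \<notin> Z"
  shows "\<exists>e\<in>arcs G. tail G e \<in> Z \<and> head G e \<notin> Z"
  using assms
proof (induction p arbitrary: u)
  case (Cons e p)
  show ?case
  proof (cases "head G e \<in> Z")
    case True
    thus ?thesis using Cons by (auto simp: awalk_Cons_iff)
  qed (use Cons in \<open>auto simp: awalk_Cons_iff\<close>)
qed (auto simp: awalk_Nil_iff)

lemma mw_strongly_connectedD:
  assumes "mw_strongly_connected G" "i \<in> verts G" "j \<in> verts G"
  obtains p where "pre_digraph.awalk G i p j" "p \<noteq> []"
  using assms unfolding mw_strongly_connected_def paths_of_length_def by force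

abbreviation (in fin_digraph) "V \<equiv> verts G"
abbreviation (in fin_digraph) "E \<equiv> out_arcs G"

section \<open>Eigenvectors of the Mauldin-Williams matrix\<close>

context mauldin_williams_graph
begin

lemma out_arcs_nonempty:
  assumes "mw_strongly_connected G" "i \<in> V"
  shows "E i \<noteq> {}"
proof -
  obtain p where "awalk i p i" "p \<noteq> []"
    by (rule mw_strongly_connectedD[OF assms(1,2,2)])
  thus ?thesis by (cases p) (auto simp: awalk_Cons_iff)
qed

text \<open>Grouping the outgoing edges by terminal vertex turns a matrix row into a sum over edges,
  the form in which the recursions are written.\<close>

lemma sum_mw_matrix:
  assumes "i \<in> V"
  shows "(\<Sum>j\<in>V. (\<Sum>e\<in>E i \<inter> in_arcs G j. r e powr s) * w j)
    = (\<Sum>e\<in>E i. r e powr s * w (head G e))"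
proof -
  have "(\<Sum>j\<in>V. (\<Sum>e\<in>E i \<inter> in_arcs G j. r e powr s) * w j)
    = (\<Sum>j\<in>V. \<Sum>e\<in>{e\<in>E i. head G e = j}. r e powr s * w (head G e))"
    unfolding sum_distrib_right by (intro sum.cong) auto
  also have "\<dots> = (\<Sum>e\<in>E i. r e powr s * w (head G e))"
    by (rule sum.group) auto
  finally show ?thesis .
qed

lemma mw_matrix_eigenvector:
  assumes sc: "mw_strongly_connected G"
  obtains w where "\<And>i. i \<in> V \<Longrightarrow> w i > 0"
    "\<And>i. i \<in> V \<Longrightarrow> (\<Sum>e\<in>E i. r e powr s * w (head G e))
      = spectral_radius (mw_matrix G r s) * w i"
proof -
  define a where "a i j = (\<Sum>e\<in>E i \<inter> in_arcs G j. r e powr s)" for i j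
  have a0: "a i j \<ge> 0" for i j unfolding a_def by (rule sum_nonneg) simp
  have irr: "\<exists>i\<in>Z. \<exists>k\<in>V - Z. a i k > 0"
    if Z: "Z \<subseteq> V" "Z \<noteq> {}" "Z \<noteq> V" for Z
  proof -
    obtain u v where uv: "u \<in> Z" "v \<in> V" "v \<notin> Z" using Z by blast
    obtain p where "awalk u p v" using mw_strongly_connectedD[OF sc] uv Z(1) by blast
    then obtain e where e: "e \<in> arcs G" "tail G e \<in> Z" "head G e \<notin> Z"
      using awalk_leaves_set uv by blast
    have "0 < r e powr s" using ratio_pos[OF e(1)] by simp
    also have "\<dots> \<le> a (tail G e) (head G e)"
      unfolding a_def by (rule member_le_sum) (use e in auto)
    finally show ?thesis using e head_in_verts by blast
  qed
  have "\<exists>w \<mu>. (\<forall>i\<in>V. w i > 0) \<and> (\<forall>i\<in>V. (\<Sum>j\<in>V. a i j * w j) = \<mu> * w i)"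
    by (rule perron_frobenius[OF finite_verts verts_nonempty a0]) (rule irr)
  then obtain w \<mu> where w: "\<And>i. i \<in> V \<Longrightarrow> w i > 0"
    "\<And>i. i \<in> V \<Longrightarrow> (\<Sum>j\<in>V. a i j * w j) = \<mu> * w i"
    by blast
  define n where "n = card (V)"
  define f where "f = from_nat_into (V)"
  have n: "n > 0" using verts_nonempty by (simp add: n_def card_gt_0_iff)
  have bij: "bij_betw f {..<n} (V)"
    unfolding f_def n_def by (rule bij_betw_from_nat_into_finite) simp
  have fV: "f k \<in> V" if "k < n" for k using bij that by (auto simp: bij_betw_def)
  \<comment> \<open>The eigenvector is transported along the enumeration \<open>f\<close> of the
    vertices by which \<open>mw_matrix\<close> is indexed.\<close>
  have "spectral_radius (Matrix.mat n n (\<lambda>(k, l). complex_of_real (a (f k) (f l)))) = \<mu>"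
  proof (rule spectral_radius_positive_eigenvector[where w = "w \<circ> f", OF n])
    fix k assume k: "k < n"
    have "(\<Sum>l<n. a (f k) (f l) * (w \<circ> f) l) = (\<Sum>j\<in>V. a (f k) j * w j)"
      using sum.reindex_bij_betw[OF bij, of "\<lambda>j. a (f k) j * w j"] by simp
    thus "(\<Sum>l<n. a (f k) (f l) * (w \<circ> f) l) = \<mu> * (w \<circ> f) k"
      using w(2)[OF fV[OF k]] by simp
  qed (use a0 w(1) fV in auto)
  hence "spectral_radius (mw_matrix G r s) = \<mu>"
    unfolding mw_matrix_def n_def f_def a_def .
  thus thesis using w that[of w] sum_mw_matrix[of _ s w] unfolding a_def by simp
qed

text \<open>Since \<open>critical_exponent\<close> is a definite description, existence and
  uniqueness have to come along with the eigenvector. The logarithm of the spectral radius is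
  continuous, has difference quotients between \<open>ln lo\<close> and \<open>ln hi < 0\<close>,
  and is nonnegative at 0; so it has exactly one zero, and this zero is nonnegative.\<close>

lemma critical_exponent_eigenvector:
  assumes sc: "mw_strongly_connected G"
  obtains w where "critical_exponent G r \<ge> 0" "\<And>i. i \<in> V \<Longrightarrow> w i > 0"
    "\<And>i. i \<in> V \<Longrightarrow>
      (\<Sum>e\<in>E i. r e powr critical_exponent G r * w (head G e)) = w i"
proof -
  define \<rho> where "\<rho> s = spectral_radius (mw_matrix G r s)" for s
  have "\<forall>s. \<exists>w. (\<forall>i\<in>V. w i > 0) \<and>
      (\<forall>i\<in>V. (\<Sum>e\<in>E i. r e powr s * w (head G e)) = \<rho> s * w i)"
    unfolding \<rho>_def using mw_matrix_eigenvector[OF sc] by metis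
  then obtain W where W: "\<And>s i. i \<in> V \<Longrightarrow> W s i > 0"
    "\<And>s i. i \<in> V \<Longrightarrow> (\<Sum>e\<in>E i. r e powr s * W s (head G e)) = \<rho> s * W s i"
    by metis
  obtain k where k: "k \<in> V" using verts_nonempty by blast
  have bound: "\<mu> \<le> \<kappa>" if u: "\<And>i. i \<in> V \<Longrightarrow> u i > 0"
      "\<And>i. i \<in> V \<Longrightarrow> \<mu> * u i \<le> (\<Sum>e\<in>E i. r e powr s * u (head G e))"
    and w: "\<And>i. i \<in> V \<Longrightarrow> w i > 0"
      "\<And>i. i \<in> V \<Longrightarrow> (\<Sum>e\<in>E i. r e powr s * w (head G e)) \<le> \<kappa> * w i"
    for \<mu> \<kappa> s u w
  proof (rule collatz_wielandt[of "V" "\<lambda>i j. \<Sum>e\<in>E i \<inter> in_arcs G j. r e powr s" w \<kappa> u k])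
    fix i assume "i \<in> V"
    thus "0 \<le> u i" using u(1) by (simp add: less_imp_le)
  qed (use u w k in \<open>auto simp: sum_mw_matrix sum_nonneg\<close>)
  define lo hi where "lo = Min (r ` arcs G)" and "hi = Max (r ` arcs G)"
  have ne: "arcs G \<noteq> {}" using out_arcs_nonempty[OF sc k] by auto
  have lh: "lo > 0" "hi < 1" "hi > 0" "\<And>e. e \<in> arcs G \<Longrightarrow> lo \<le> r e" "\<And>e. e \<in> arcs G \<Longrightarrow> r e \<le> hi"
    unfolding lo_def hi_def using ne ratio_pos ratio_less_1
    by (auto simp: Min_gr_iff Max_less_iff Max_gr_iff)
  \<comment> \<open>The eigenvector \<open>W s\<close> serves as a supersolution for the exponent
    \<open>t\<close>: passing from \<open>s\<close> to \<open>t\<close> multiplies each term by at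
    most \<open>hi powr (t - s)\<close>.\<close>
  have \<rho>1: "\<rho> t \<le> hi powr (t - s) * \<rho> s" if st: "s \<le> t" for s t
  proof (rule bound[of "W t" _ t "W s"])
    fix i assume i: "i \<in> V"
    have "(\<Sum>e\<in>E i. r e powr t * W s (head G e))
      \<le> (\<Sum>e\<in>E i. hi powr (t - s) * (r e powr s * W s (head G e)))"
    proof (rule sum_mono)
      fix e assume e: "e \<in> E i"
      have "r e powr t = r e powr (t - s) * r e powr s" by (simp flip: powr_add)
      also have "\<dots> \<le> hi powr (t - s) * r e powr s"
        using lh e ratio_pos st by (intro mult_right_mono powr_mono2) (auto simp: less_imp_le)
      finally show "r e powr t * W s (head G e) \<le> hi powr (t - s) * (r e powr s * W s (head G e))"
        using W(1)[of "head G e" s] e by (simp add: mult.assoc[symmetric] mult_right_mono)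
    qed
    thus "(\<Sum>e\<in>E i. r e powr t * W s (head G e)) \<le> hi powr (t - s) * \<rho> s * W s i"
      using W(2)[OF i] by (simp add: sum_distrib_left[symmetric] mult.assoc)
  qed (use W in auto)
  \<comment> \<open>Here \<open>W s\<close> is a subsolution for the exponent \<open>t\<close>, each
    term changing by a factor of at least \<open>lo powr (t - s)\<close>.\<close>
  have \<rho>2: "lo powr (t - s) * \<rho> s \<le> \<rho> t" if st: "s \<le> t" for s t
  proof (rule bound[of "W s" _ t "W t"])
    fix i assume i: "i \<in> V"
    have "(\<Sum>e\<in>E i. lo powr (t - s) * (r e powr s * W s (head G e)))
      \<le> (\<Sum>e\<in>E i. r e powr t * W s (head G e))"
    proof (rule sum_mono)
      fix e assume e: "e \<in> E i"
      have "lo powr (t - s) * r e powr s \<le> r e powr (t - s) * r e powr s"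
        using lh e ratio_pos st by (intro mult_right_mono powr_mono2) (auto simp: less_imp_le)
      also have "\<dots> = r e powr t" by (simp flip: powr_add)
      finally show "lo powr (t - s) * (r e powr s * W s (head G e)) \<le> r e powr t * W s (head G e)"
        using W(1)[of "head G e" s] e by (simp add: mult.assoc[symmetric] mult_right_mono)
    qed
    thus "lo powr (t - s) * \<rho> s * W s i \<le> (\<Sum>e\<in>E i. r e powr t * W s (head G e))"
      using W(2)[OF i] by (simp add: sum_distrib_left[symmetric] mult.assoc)
  qed (use W in auto)
  \<comment> \<open>At exponent 0 every coefficient is 1 and every vertex has an outgoing edge, so
    the constant vector is a subsolution with value 1.\<close>
  have \<rho>0: "\<rho> 0 \<ge> 1"
  proof (rule bound[of "\<lambda>_. 1" _ 0 "W 0"])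
    fix i assume i: "i \<in> V"
    have "card (E i) \<ge> 1"
      using out_arcs_nonempty[OF sc i] finite_out_arcs[of i] by (simp add: Suc_le_eq card_gt_0_iff)
    moreover have "(\<Sum>e\<in>E i. r e powr 0 * 1) = (\<Sum>e\<in>E i. 1)"
      by (rule sum.cong) (use ratio_pos in force)+
    ultimately show "1 * 1 \<le> (\<Sum>e\<in>E i. r e powr 0 * 1)" by simp
    show "(\<Sum>e\<in>E i. r e powr 0 * W 0 (head G e)) \<le> \<rho> 0 * W 0 i"
      using W(2)[OF i, of 0] by (rule eq_refl)
  qed (use W(1) in auto)
  have \<rho>pos: "\<rho> s > 0" for s
  proof -
    have "0 < (\<Sum>e\<in>E k. r e powr s * W s (head G e))"
      using out_arcs_nonempty[OF sc k] W(1) ratio_pos by (intro sum_pos) force+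
    thus ?thesis using W k by (simp add: zero_less_mult_iff) (metis W(1) less_asym)
  qed
  define \<phi> where "\<phi> s = ln (\<rho> s)" for s
  have \<phi>1: "\<phi> t \<le> (t - s) * ln hi + \<phi> s" if "s \<le> t" for s t
  proof -
    have "ln (\<rho> t) \<le> ln (hi powr (t - s) * \<rho> s)"
      using \<rho>1[OF that] \<rho>pos lh by (simp add: ln_le_cancel_iff)
    thus ?thesis unfolding \<phi>_def using \<rho>pos[of s] lh by (simp add: ln_mult ln_powr)
  qed
  have \<phi>2: "(t - s) * ln lo + \<phi> s \<le> \<phi> t" if "s \<le> t" for s t
  proof -
    have "ln (lo powr (t - s) * \<rho> s) \<le> ln (\<rho> t)"
      using \<rho>2[OF that] \<rho>pos lh by (simp add: ln_le_cancel_iff)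
    thus ?thesis unfolding \<phi>_def using \<rho>pos[of s] lh by (simp add: ln_mult ln_powr)
  qed
  have lnhi: "ln hi < 0" using lh by simp
  have lohi: "lo \<le> hi" using ne lh(4,5) by (meson equals0I order_trans)
  hence lnlo: "ln lo < 0" using lh by simp
  have "(- ln lo)-lipschitz_on UNIV \<phi>"
  proof (rule lipschitz_onI)
    fix s t :: real
    have *: "\<bar>\<phi> t - \<phi> s\<bar> \<le> - ln lo * (t - s)" if "s \<le> t" for s t
    proof -
      have "(t - s) * ln hi \<le> 0" using lnhi that by (simp add: mult_nonneg_nonpos)
      thus ?thesis using \<phi>1[OF that] \<phi>2[OF that] by (simp add: algebra_simps)
    qed
    show "dist (\<phi> s) (\<phi> t) \<le> - ln lo * dist s t"
      using *[of s t] *[of t s] by (cases "s \<le> t") (auto simp: dist_real_def abs_minus_commute)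
  qed (use lnlo in simp)
  hence cont: "continuous_on UNIV \<phi>" by (rule lipschitz_on_continuous_on)
  have \<phi>0: "\<phi> 0 \<ge> 0" using \<rho>0 by (simp add: \<phi>_def)
  \<comment> \<open>The point where the linear upper bound \<open>\<phi> 0 + b * ln hi\<close>
    reaches 0.\<close>
  define b where "b = \<phi> 0 / (- ln hi)"
  have b: "b \<ge> 0" unfolding b_def using \<phi>0 lnhi by (intro divide_nonneg_pos) auto
  have "\<phi> b \<le> (b - 0) * ln hi + \<phi> 0" by (rule \<phi>1[OF b])
  also have "\<dots> = 0" unfolding b_def using lnhi by (simp add: field_simps)
  finally have "\<phi> b \<le> 0" .
  then obtain s where s: "0 \<le> s" "\<phi> s = 0"
    using IVT2'[of \<phi> b 0 0] \<phi>0 b continuous_on_subset[OF cont] by blast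
  have \<rho>s: "\<rho> t = 1 \<longleftrightarrow> \<phi> t = 0" for t using \<rho>pos[of t] by (simp add: \<phi>_def)
  have uniq: "t = s" if "\<phi> t = 0" for t
  proof (rule ccontr)
    assume "t \<noteq> s"
    then consider "t < s" | "s < t" by linarith
    thus False
    proof cases
      case 1
      thus False using \<phi>1[of t s] that s(2) lnhi mult_pos_neg[of "s - t" "ln hi"] by simp
    next
      case 2
      thus False using \<phi>1[of s t] that s(2) lnhi mult_pos_neg[of "t - s" "ln hi"] by simp
    qed
  qed
  have one: "\<rho> s = 1" using \<rho>s s(2) by blast
  have crit: "critical_exponent G r = s"
    unfolding critical_exponent_def \<rho>_def[symmetric]
  proof (rule the_equality)
    show "0 \<le> s \<and> \<rho> s = 1" using s(1) one by blast
    show "t = s" if "0 \<le> t \<and> \<rho> t = 1" for t using that \<rho>s[of t] uniq[of t] by blast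
  qed
  show thesis
  proof (rule that[of "W s"])
    show "0 \<le> critical_exponent G r" using s(1) crit by simp
    show "0 < W s i" if "i \<in> V" for i by (rule W(1)[OF that])
    show "(\<Sum>e\<in>E i. r e powr critical_exponent G r * W s (head G e)) = W s i"
      if "i \<in> V" for i
      using W(2)[OF that, of s] one crit by simp
  qed
qed

end

section \<open>Closed subgroups of the reals\<close>

definition closed_real_subgroup :: "real set \<Rightarrow> bool" where
  "closed_real_subgroup H \<longleftrightarrow> closed H \<and> 0 \<in> H \<and> (\<forall>x\<in>H. \<forall>y\<in>H. x + y \<in> H) \<and> (\<forall>x\<in>H. - x \<in> H)"

lemma closed_subgroup_generated_eq: "closed_subgroup_generated B = closed_real_subgroup hull B"
  by (simp add: closed_subgroup_generated_def closed_real_subgroup_def[abs_def])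

lemma closed_real_subgroup_generated: "closed_real_subgroup (closed_subgroup_generated B)"
  unfolding closed_subgroup_generated_eq
proof (rule hull_in)
  fix T assume T: "Ball T closed_real_subgroup"
  show "closed_real_subgroup (\<Inter>T)"
    unfolding closed_real_subgroup_def
    by (intro conjI closed_Inter) (use T in \<open>auto simp: closed_real_subgroup_def\<close>)
qed

lemma closed_real_subgroupD:
  assumes "closed_real_subgroup H"
  shows "closed H" "0 \<in> H" "x \<in> H \<Longrightarrow> y \<in> H \<Longrightarrow> x + y \<in> H" "x \<in> H \<Longrightarrow> - x \<in> H"
    "x \<in> H \<Longrightarrow> y \<in> H \<Longrightarrow> x - y \<in> H" "x \<in> H \<Longrightarrow> of_int k * x \<in> H"
proof -
  show *: "closed H" "0 \<in> H" "\<And>x y. x \<in> H \<Longrightarrow> y \<in> H \<Longrightarrow> x + y \<in> H" "\<And>x. x \<in> H \<Longrightarrow> - x \<in> H"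
    using assms by (auto simp: closed_real_subgroup_def)
  show "x \<in> H \<Longrightarrow> y \<in> H \<Longrightarrow> x - y \<in> H" using *(3)[of x "- y"] *(4)[of y] by simp
  have nat: "of_nat n * x \<in> H" if "x \<in> H" for n
    by (induction n) (use * that in \<open>auto simp: algebra_simps\<close>)
  show "of_int k * x \<in> H"
    if "x \<in> H"
  proof (cases k)
    case (neg n)
    have "- (of_nat (Suc n) * x) \<in> H" using nat[OF that] *(4) by blast
    moreover have "of_int k * x = - (of_nat (Suc n) * x)" by (subst neg) (simp add: algebra_simps)
    ultimately show ?thesis by simp
  qed (use nat[OF that] in simp)
qed

lemma closed_real_subgroup_multiples: "closed_real_subgroup (range (\<lambda>k::int. \<tau> * real_of_int k))"
proof (cases "\<tau> = 0")
  case True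
  thus ?thesis by (simp add: closed_real_subgroup_def image_constant_conv)
next
  case False
  have "closed (range (\<lambda>k::int. \<tau> * real_of_int k))"
  proof -
    have eq: "range (\<lambda>k::int. \<tau> * real_of_int k) = (\<lambda>x. \<tau> *\<^sub>R x) ` \<int>" by (auto simp: Ints_def)
    show ?thesis unfolding eq by (rule closed_scaling) (rule closed_Ints)
  qed
  moreover have "x + y \<in> range (\<lambda>k::int. \<tau> * real_of_int k)"
    if xy: "x \<in> range (\<lambda>k::int. \<tau> * real_of_int k)" "y \<in> range (\<lambda>k::int. \<tau> * real_of_int k)" for x y
  proof -
    obtain a b where "x = \<tau> * real_of_int a" "y = \<tau> * real_of_int b" using xy by blast
    hence "x + y = \<tau> * real_of_int (a + b)" by (simp add: algebra_simps)
    thus ?thesis by (rule range_eqI)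
  qed
  moreover have "- x \<in> range (\<lambda>k::int. \<tau> * real_of_int k)"
    if x: "x \<in> range (\<lambda>k::int. \<tau> * real_of_int k)" for x
  proof -
    obtain a where "x = \<tau> * real_of_int a" using x by blast
    hence "- x = \<tau> * real_of_int (- a)" by simp
    thus ?thesis by (rule range_eqI)
  qed
  moreover have "0 \<in> range (\<lambda>k::int. \<tau> * real_of_int k)" by (rule range_eqI[of _ _ 0]) simp
  ultimately show ?thesis unfolding closed_real_subgroup_def by blast
qed

lemma closed_subgroup_generated_singleton:
  "closed_subgroup_generated {\<tau>} = range (\<lambda>k::int. \<tau> * real_of_int k)"
proof (rule antisym)
  have "\<tau> = \<tau> * real_of_int 1" by simp
  hence "{\<tau>} \<subseteq> range (\<lambda>k::int. \<tau> * real_of_int k)" by (metis empty_subsetI insert_subset rangeI)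
  thus "closed_subgroup_generated {\<tau>} \<subseteq> range (\<lambda>k::int. \<tau> * real_of_int k)"
    unfolding closed_subgroup_generated_eq
    by (rule hull_minimal) (rule closed_real_subgroup_multiples)
  have "\<tau> \<in> closed_subgroup_generated {\<tau>}"
    unfolding closed_subgroup_generated_eq by (rule hull_inc) simp
  thus "range (\<lambda>k::int. \<tau> * real_of_int k) \<subseteq> closed_subgroup_generated {\<tau>}"
    using closed_real_subgroupD(6)[OF closed_real_subgroup_generated] by (auto simp: mult.commute)
qed

text \<open>Let \<tau> be the infimum of the positive elements. If it is positive, closedness puts
  it into \<open>H\<close>, and division with remainder leaves nothing but its multiples. If it is
  0, multiples of arbitrarily small elements are dense, and closedness gives the whole line.\<close>

lemma closed_real_subgroup_cases:
  assumes H: "closed_real_subgroup H" and pos: "h \<in> H" "h > 0"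
  obtains "H = UNIV" | \<tau> where "\<tau> > 0" "H = range (\<lambda>k::int. \<tau> * real_of_int k)"
proof -
  note D = closed_real_subgroupD[OF H]
  define P where "P = {x\<in>H. x > 0}"
  have P: "P \<noteq> {}" "bdd_below P" using pos by (auto simp: P_def intro: bdd_belowI[of _ 0])
  define \<tau> where "\<tau> = Inf P"
  have \<tau>le: "\<tau> \<le> x" if "x \<in> P" for x unfolding \<tau>_def by (rule cInf_lower[OF that P(2)])
  have \<tau>0: "\<tau> \<ge> 0" unfolding \<tau>_def by (rule cInf_greatest[OF P(1)]) (simp add: P_def)
  have rem: "x - real_of_int \<lfloor>x / y\<rfloor> * y \<in> {0..<y}" if "y > 0" for x y
    using that floor_divide_lower[OF that, of x] floor_divide_upper[OF that, of x]
    by (simp add: algebra_simps)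
  show thesis
  proof (cases "\<tau> > 0")
    case True
    have "\<tau> \<in> closure P" unfolding \<tau>_def by (rule closure_contains_Inf[OF P])
    moreover have "closure P \<subseteq> H" by (rule closure_minimal[OF _ D(1)]) (auto simp: P_def)
    ultimately have "\<tau> \<in> H" by blast
    have "x \<in> range (\<lambda>k::int. \<tau> * real_of_int k)" if "x \<in> H" for x
    proof -
      define y where "y = x - real_of_int \<lfloor>x / \<tau>\<rfloor> * \<tau>"
      have "y \<in> H" unfolding y_def using D(5)[OF that D(6)[OF \<open>\<tau> \<in> H\<close>]] .
      moreover have "0 \<le> y" "y < \<tau>" using rem[OF True, of x] by (auto simp: y_def)
      ultimately have "y = 0" using \<tau>le[of y] by (force simp: P_def)
      hence "x = \<tau> * real_of_int \<lfloor>x / \<tau>\<rfloor>" unfolding y_def by (simp only: right_minus_eq mult.commute)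
      thus ?thesis by (rule range_eqI)
    qed
    moreover have "\<tau> * real_of_int k \<in> H" for k using D(6)[OF \<open>\<tau> \<in> H\<close>] by (simp add: mult.commute)
    ultimately show thesis using that(2)[OF True] by blast
  next
    case False
    have "x \<in> H" for x
    proof -
      have "\<exists>y\<in>H. dist y x < e" if e: "e > 0" for e
      proof -
        have "Inf P < e" using False e by (simp add: \<tau>_def)
        then obtain z where z: "z \<in> P" "z < e" using cInf_lessD[OF P(1)] by blast
        hence "z > 0" "z \<in> H" by (auto simp: P_def)
        hence "real_of_int \<lfloor>x / z\<rfloor> * z \<in> H" by (intro D(6))
        moreover have "dist (real_of_int \<lfloor>x / z\<rfloor> * z) x < e"
          using rem[OF \<open>z > 0\<close>, of x] z(2) by (simp add: dist_real_def)
        ultimately show ?thesis by blast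
      qed
      thus ?thesis using closed_approachable[OF D(1)] by blast
    qed
    thus thesis using that(1) by blast
  qed
qed

text \<open>The differences of elements of \<open>\<Lambda>\<close> form a dense subgroup of \<open>H\<close>; finitely many of them
  approximate one period \<open>[0, l]\<close>, and adding a common large element of \<open>\<Lambda>\<close> makes them all
  elements of \<open>\<Lambda>\<close>.\<close>

lemma semigroup_eventually_dense:
  fixes \<Lambda> :: "real set"
  assumes add: "\<And>x y. x \<in> \<Lambda> \<Longrightarrow> y \<in> \<Lambda> \<Longrightarrow> x + y \<in> \<Lambda>"
    and pos: "\<And>x. x \<in> \<Lambda> \<Longrightarrow> x > 0" and ne: "\<Lambda> \<noteq> {}"
    and H: "H = closed_subgroup_generated \<Lambda>" and \<epsilon>: "\<epsilon> > 0"
  obtains b where "\<And>x. x \<in> H \<Longrightarrow> x \<ge> b \<Longrightarrow> \<exists>y\<in>\<Lambda>. \<bar>x - y\<bar> \<le> \<epsilon>"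
proof -
  have Hs: "closed_real_subgroup H" unfolding H by (rule closed_real_subgroup_generated)
  note D = closed_real_subgroupD[OF Hs]
  have \<Lambda>H: "\<Lambda> \<subseteq> H" unfolding H closed_subgroup_generated_eq by (rule hull_subset)
  define \<Delta> where "\<Delta> = {x - y | x y. x \<in> \<Lambda> \<and> y \<in> \<Lambda>}"
  have \<Delta>add: "x + y \<in> \<Delta>" if xy: "x \<in> \<Delta>" "y \<in> \<Delta>" for x y
  proof -
    obtain a b c d where "x = a - b" "y = c - d" "a \<in> \<Lambda>" "b \<in> \<Lambda>" "c \<in> \<Lambda>" "d \<in> \<Lambda>"
      using xy unfolding \<Delta>_def by blast
    moreover have "a - b + (c - d) = (a + c) - (b + d)" by simp
    ultimately show ?thesis unfolding \<Delta>_def using add by blast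
  qed
  have \<Delta>neg: "- x \<in> \<Delta>" if x: "x \<in> \<Delta>" for x
  proof -
    obtain a b where "x = a - b" "a \<in> \<Lambda>" "b \<in> \<Lambda>" using x unfolding \<Delta>_def by blast
    moreover have "- (a - b) = b - a" by simp
    ultimately show ?thesis unfolding \<Delta>_def by blast
  qed
  have "closed_real_subgroup (closure \<Delta>)"
    unfolding closed_real_subgroup_def
  proof (intro conjI ballI)
    obtain x where "x \<in> \<Lambda>" using ne by blast
    hence "x - x \<in> \<Delta>" unfolding \<Delta>_def by blast
    thus "0 \<in> closure \<Delta>" using closure_subset[of \<Delta>] by auto
  next
    fix x assume "x \<in> closure \<Delta>"
    then obtain f where "\<And>n. f n \<in> \<Delta>" "f \<longlonglongrightarrow> x" unfolding closure_sequential by blast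
    hence "(\<lambda>n. - f n) \<longlonglongrightarrow> - x" "\<And>n. - f n \<in> \<Delta>" by (auto intro: tendsto_minus \<Delta>neg)
    thus "- x \<in> closure \<Delta>" unfolding closure_sequential by (intro exI[of _ "\<lambda>n. - f n"]) blast
  next
    fix x y assume "x \<in> closure \<Delta>" "y \<in> closure \<Delta>"
    then obtain f g where "\<And>n. f n \<in> \<Delta>" "f \<longlonglongrightarrow> x" "\<And>n. g n \<in> \<Delta>" "g \<longlonglongrightarrow> y"
      unfolding closure_sequential by blast
    hence "(\<lambda>n. f n + g n) \<longlonglongrightarrow> x + y" "\<And>n. f n + g n \<in> \<Delta>" by (auto intro: tendsto_add \<Delta>add)
    thus "x + y \<in> closure \<Delta>" unfolding closure_sequential by (intro exI[of _ "\<lambda>n. f n + g n"]) blast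
  qed simp
  moreover have "\<Lambda> \<subseteq> closure \<Delta>"
  proof
    fix x assume "x \<in> \<Lambda>"
    hence "(x + x) - x \<in> \<Delta>" unfolding \<Delta>_def using add by blast
    thus "x \<in> closure \<Delta>" using closure_subset[of \<Delta>] by auto
  qed
  ultimately have Hcl: "H \<subseteq> closure \<Delta>"
    unfolding H closed_subgroup_generated_eq by (intro hull_minimal)
  obtain l where l: "l \<in> \<Lambda>" using ne by blast
  have l0: "l > 0" by (rule pos[OF l])
  have "compact (H \<inter> {0..l})" by (rule closed_Int_compact[OF D(1) compact_Icc])
  moreover have "H \<inter> {0..l} \<subseteq> (\<Union>d\<in>\<Delta>. ball d \<epsilon>)"
  proof
    fix x assume "x \<in> H \<inter> {0..l}"
    hence "x \<in> closure \<Delta>" using Hcl by blast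
    then obtain d where "d \<in> \<Delta>" "dist d x < \<epsilon>" using \<epsilon> unfolding closure_approachable by blast
    thus "x \<in> (\<Union>d\<in>\<Delta>. ball d \<epsilon>)" by auto
  qed
  ultimately obtain F where F: "F \<subseteq> \<Delta>" "finite F" "H \<inter> {0..l} \<subseteq> (\<Union>d\<in>F. ball d \<epsilon>)"
    using compactE_image[of "H \<inter> {0..l}" \<Delta> "\<lambda>d. ball d \<epsilon>"] by (metis open_ball)
  have "\<exists>b\<in>\<Lambda>. \<forall>d\<in>F. d + b \<in> \<Lambda>"
    using F(2,1)
  proof (induction F)
    case empty
    thus ?case using l by blast
  next
    case (insert d F)
    then obtain b where b: "b \<in> \<Lambda>" "\<forall>d\<in>F. d + b \<in> \<Lambda>" by blast
    obtain x y where xy: "d = x - y" "x \<in> \<Lambda>" "y \<in> \<Lambda>" using insert.prems unfolding \<Delta>_def by blast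
    \<comment> \<open>Raising the common shift by \<open>y\<close> turns the new difference
      \<open>x - y\<close> into a sum of elements of \<Lambda> and merely adds such an element to
      the earlier ones.\<close>
    have "d + (b + y) = b + x" using xy by simp
    moreover have "d' + (b + y) = (d' + b) + y" for d' by simp
    ultimately have "\<forall>d'\<in>insert d F. d' + (b + y) \<in> \<Lambda>" using b xy add by (metis insert_iff)
    thus ?case using add[OF b(1) xy(3)] by blast
  qed
  then obtain b where b: "b \<in> \<Lambda>" "\<And>d. d \<in> F \<Longrightarrow> d + b \<in> \<Lambda>" by blast
  have "\<exists>y\<in>\<Lambda>. \<bar>x - y\<bar> \<le> \<epsilon>" if x: "x \<in> H" "x \<ge> b" for x
  proof -
    \<comment> \<open>Removing \<open>q\<close> copies of \<open>l\<close> moves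
      \<open>x - b\<close> into the compact window. Because \<open>x \<ge> b\<close>, the integer
      \<open>q\<close> is nonnegative, so the copies can be added back without leaving
      \<Lambda>.\<close>
    define q where "q = \<lfloor>(x - b) / l\<rfloor>"
    define s where "s = x - b - real_of_int q * l"
    have s: "0 \<le> s" "s \<le> l"
      using floor_divide_lower[OF l0, of "x - b"] floor_divide_upper[OF l0, of "x - b"]
      by (auto simp: s_def q_def algebra_simps)
    have "s \<in> H" unfolding s_def
      by (intro D(5,6)) (use x b(1) l \<Lambda>H in auto)
    then obtain d where d: "d \<in> F" "dist d s < \<epsilon>" using F(3) s by auto
    have q0: "q \<ge> 0" unfolding q_def using x(2) l0 by simp
    have "d + b + of_nat n * l \<in> \<Lambda>" for n
    proof (induction n)
      case (Suc n)
      have "d + b + of_nat (Suc n) * l = (d + b + of_nat n * l) + l" by (simp add: algebra_simps)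
      thus ?case using add[OF Suc l] by (simp only:)
    qed (use b(2)[OF d(1)] in simp)
    from this[of "nat q"] have "d + b + real_of_int q * l \<in> \<Lambda>" using q0 by simp
    moreover have "\<bar>x - (d + b + real_of_int q * l)\<bar> \<le> \<epsilon>"
      using d(2) by (simp add: s_def dist_real_def algebra_simps abs_if split: if_splits)
    ultimately show ?thesis by blast
  qed
  thus thesis using that by blast
qed

text \<open>Regularity carries lower bounds forward in time only, so approximation from above is
  required. In the dense case one aims at \<open>x + \<epsilon> / 2\<close>; in the lattice case an
  error of at most half a period is no error at all.\<close>

lemma semigroup_eventually_dense_above:
  fixes \<Lambda> :: "real set"
  assumes add: "\<And>x y. x \<in> \<Lambda> \<Longrightarrow> y \<in> \<Lambda> \<Longrightarrow> x + y \<in> \<Lambda>"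
    and pos: "\<And>x. x \<in> \<Lambda> \<Longrightarrow> x > 0" and ne: "\<Lambda> \<noteq> {}"
    and H: "H = closed_subgroup_generated \<Lambda>" and \<epsilon>: "\<epsilon> > 0"
  obtains b where "\<And>x. x \<in> H \<Longrightarrow> x \<ge> b \<Longrightarrow> \<exists>y\<in>\<Lambda>. x \<le> y \<and> y \<le> x + \<epsilon>"
proof -
  have Hs: "closed_real_subgroup H" unfolding H by (rule closed_real_subgroup_generated)
  have \<Lambda>H: "\<Lambda> \<subseteq> H" unfolding H closed_subgroup_generated_eq by (rule hull_subset)
  obtain h where h: "h \<in> \<Lambda>" using ne by blast
  have "h \<in> H" "h > 0" using h \<Lambda>H pos by auto
  from closed_real_subgroup_cases[OF Hs this] show thesis
  proof cases
    case 1
    obtain b where b: "\<And>x. x \<in> H \<Longrightarrow> x \<ge> b \<Longrightarrow> \<exists>y\<in>\<Lambda>. \<bar>x - y\<bar> \<le> \<epsilon> / 2"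
      using semigroup_eventually_dense[OF add pos ne H, of "\<epsilon> / 2"] \<epsilon> by auto
    have "\<exists>y\<in>\<Lambda>. x \<le> y \<and> y \<le> x + \<epsilon>" if "x \<ge> b" for x
    proof -
      obtain y where "y \<in> \<Lambda>" "\<bar>x + \<epsilon> / 2 - y\<bar> \<le> \<epsilon> / 2" using b[of "x + \<epsilon> / 2"] 1 \<epsilon> \<open>x \<ge> b\<close> by fastforce
      thus ?thesis by (intro bexI[of _ y]) (auto simp: abs_if field_simps split: if_splits)
    qed
    thus thesis using that by blast
  next
    case (2 \<tau>)
    obtain b where b: "\<And>x. x \<in> H \<Longrightarrow> x \<ge> b \<Longrightarrow> \<exists>y\<in>\<Lambda>. \<bar>x - y\<bar> \<le> \<tau> / 2"
      using semigroup_eventually_dense[OF add pos ne H, of "\<tau> / 2"] 2 by auto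
    have "\<exists>y\<in>\<Lambda>. x \<le> y \<and> y \<le> x + \<epsilon>" if x: "x \<in> H" "x \<ge> b" for x
    proof -
      obtain y where y: "y \<in> \<Lambda>" "\<bar>x - y\<bar> \<le> \<tau> / 2" using b x by blast
      obtain k m :: int where km: "x = \<tau> * real_of_int k" "y = \<tau> * real_of_int m"
        using x(1) y(1) \<Lambda>H 2 by blast
      have "\<tau> * \<bar>real_of_int (k - m)\<bar> = \<bar>x - y\<bar>" using km 2(1)
        by (simp add: abs_mult flip: right_diff_distrib)
      also have "\<dots> < \<tau> * 1" using y(2) 2(1) by simp
      finally have "\<bar>real_of_int (k - m)\<bar> < 1" using 2(1) by (simp only: mult_less_cancel_left_pos)
      hence "k = m" by linarith
      thus ?thesis using km y(1) \<epsilon> by (intro bexI[of _ y]) auto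
    qed
    thus thesis using that by blast
  qed
qed

section \<open>The inhomogeneous attractor\<close>

context mauldin_williams_graph
begin

lemma similarity_family:
  obtains T where "\<And>e. e \<in> arcs G \<Longrightarrow> similarity (r e) (T e)"
    "\<And>e x. e \<in> arcs G \<Longrightarrow> x \<in> X (head G e) \<Longrightarrow> T e x = S e x"
proof -
  have "\<exists>T. similarity (r e) T \<and> (\<forall>x\<in>X (head G e). T x = S e x)" if e: "e \<in> arcs G" for e
  proof -
    have h: "head G e \<in> V" using e by simp
    have "interior (X (head G e)) \<noteq> {}"
      using X_nonempty[OF h] X_regular[OF h] by auto
    from similarity_extension[OF ratio_pos[OF e] this S_similarity[OF e]]
    show ?thesis by metis
  qed
  then obtain T where "\<forall>e\<in>arcs G. similarity (r e) (T e) \<and> (\<forall>x\<in>X (head G e). T e x = S e x)"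
    by metis
  thus thesis using that by blast
qed

lemma inj_on_S: "e \<in> arcs G \<Longrightarrow> inj_on (S e) (X (head G e))"
proof (rule inj_onI)
  fix x y assume e: "e \<in> arcs G" and xy: "x \<in> X (head G e)" "y \<in> X (head G e)" "S e x = S e y"
  have "r e * dist x y = 0" using S_similarity[OF e xy(1,2)] xy(3) by simp
  thus "x = y" using ratio_pos[OF e] by simp
qed

lemma continuous_on_S: "e \<in> arcs G \<Longrightarrow> continuous_on (X (head G e)) (S e)"
proof -
  assume e: "e \<in> arcs G"
  have "(r e)-lipschitz_on (X (head G e)) (S e)"
    by (rule lipschitz_onI) (use S_similarity[OF e] ratio_pos[OF e] in auto)
  thus ?thesis by (rule lipschitz_on_continuous_on)
qed

lemma max_ratio:
  obtains \<rho> where "0 < \<rho>" "\<rho> < 1" "\<And>e. e \<in> arcs G \<Longrightarrow> r e \<le> \<rho>"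
proof -
  define \<rho> where "\<rho> = Max (insert (1/2) (r ` arcs G))"
  show thesis
  proof (rule that)
    have "1/2 \<le> \<rho>" unfolding \<rho>_def by (rule Max_ge) auto
    thus "0 < \<rho>" by simp
    show "\<rho> < 1" unfolding \<rho>_def using ratio_less_1 by (subst Max_less_iff) auto
    show "r e \<le> \<rho>" if "e \<in> arcs G" for e unfolding \<rho>_def by (rule Max_ge) (use that in auto)
  qed
qed

lemma X_diameter:
  obtains D where "D > 0" "\<And>i x y. i \<in> V \<Longrightarrow> x \<in> X i \<Longrightarrow> y \<in> X i \<Longrightarrow> dist x y \<le> D"
proof -
  have "bounded (\<Union>i\<in>V. X i)" using compact_imp_bounded[OF X_compact] by auto
  then obtain D where D: "\<And>x y. x \<in> (\<Union>i\<in>V. X i) \<Longrightarrow> y \<in> (\<Union>i\<in>V. X i) \<Longrightarrow> dist x y \<le> D"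
    unfolding bounded_two_points by blast
  show thesis
  proof (rule that[of "max D 1"])
    show "dist x y \<le> max D 1" if "i \<in> V" "x \<in> X i" "y \<in> X i" for i x y
    proof -
      have "dist x y \<le> D" by (rule D) (use that in blast)+
      thus ?thesis by simp
    qed
  qed simp
qed

end

context inhomogeneous_mw_graph
begin

definition hutchinson :: "('v \<Rightarrow> 'a set) \<Rightarrow> 'v \<Rightarrow> 'a set" where
  "hutchinson Y i = C i \<union> (\<Union>e\<in>E i. S e ` Y (head G e))"

text \<open>Starting the iteration at \<open>X\<close> makes it decreasing, so the attractor is an
  intersection of compact sets instead of a limit in the Hausdorff metric.\<close>

definition approximant :: "nat \<Rightarrow> 'v \<Rightarrow> 'a set" where
  "approximant n = (hutchinson ^^ n) X"

lemma approximant_simps: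
  "approximant 0 = X" "approximant (Suc n) = hutchinson (approximant n)"
  by (simp_all add: approximant_def)

lemma hutchinson_mono:
  assumes "\<And>j. j \<in> V \<Longrightarrow> Y j \<subseteq> Z j"
  shows "hutchinson Y i \<subseteq> hutchinson Z i"
proof -
  have "S e ` Y (head G e) \<subseteq> S e ` Z (head G e)" if "e \<in> E i" for e
    by (rule image_mono, rule assms) (use that in auto)
  thus ?thesis unfolding hutchinson_def by blast
qed

lemma hutchinson_subset_X:
  assumes "i \<in> V" "\<And>j. j \<in> V \<Longrightarrow> Y j \<subseteq> X j"
  shows "hutchinson Y i \<subseteq> X i"
proof -
  have "S e ` Y (head G e) \<subseteq> X i" if e: "e \<in> E i" for e
  proof -
    have "head G e \<in> V" using e by auto
    hence "S e ` Y (head G e) \<subseteq> S e ` X (head G e)" using assms(2) by (intro image_mono)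
    also have "\<dots> \<subseteq> X i" using S_maps[of e] e by auto
    finally show ?thesis .
  qed
  thus ?thesis unfolding hutchinson_def using C_subset[OF assms(1)] by blast
qed

lemma approximant_subset_X: "i \<in> V \<Longrightarrow> approximant n i \<subseteq> X i"
  by (induction n arbitrary: i) (simp_all add: approximant_simps hutchinson_subset_X)

lemma approximant_Suc_subset: "i \<in> V \<Longrightarrow> approximant (Suc n) i \<subseteq> approximant n i"
proof (induction n arbitrary: i)
  case 0
  thus ?case using approximant_subset_X[of i "Suc 0"] by (simp add: approximant_simps)
next
  case (Suc n)
  have "hutchinson (approximant (Suc n)) i \<subseteq> hutchinson (approximant n) i"
    by (rule hutchinson_mono) (rule Suc.IH)
  thus ?case by (simp add: approximant_simps)
qed

lemma approximant_antimono: "i \<in> V \<Longrightarrow> m \<le> n \<Longrightarrow> approximant n i \<subseteq> approximant m i"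
  by (rule lift_Suc_antimono_le[of "\<lambda>n. approximant n i"]) (rule approximant_Suc_subset)

lemma compact_approximant: "i \<in> V \<Longrightarrow> compact (approximant n i)"
proof (induction n arbitrary: i)
  case (Suc n)
  have "compact (S e ` approximant n (head G e))" if e: "e \<in> E i" for e
  proof -
    have h: "e \<in> arcs G" "head G e \<in> V" using e by auto
    show ?thesis
      by (rule compact_continuous_image[OF continuous_on_subset[OF continuous_on_S[OF h(1)]
            approximant_subset_X[OF h(2)]] Suc.IH[OF h(2)]])
  qed
  thus ?case unfolding approximant_simps hutchinson_def
    using C_compact[OF Suc.prems] by (intro compact_Un compact_UN) auto
qed (simp add: approximant_simps X_compact)

definition limit_set :: "'v \<Rightarrow> 'a set" where
  "limit_set i = (\<Inter>n. approximant n i)"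

lemma approximant_nonempty:
  assumes "mw_strongly_connected G" "i \<in> V"
  shows "approximant n i \<noteq> {}"
  using assms(2)
proof (induction n arbitrary: i)
  case (Suc n)
  obtain e where "e \<in> E i" using out_arcs_nonempty[OF assms(1) Suc.prems] by blast
  moreover from this have "approximant n (head G e) \<noteq> {}" by (intro Suc.IH) auto
  ultimately show ?case by (auto simp: approximant_simps hutchinson_def)
qed (simp add: approximant_simps X_nonempty)

text \<open>For the inclusion from left to right, a point outside \<open>C i\<close> lies at every
  level in the image under some edge; one of the finitely many edges occurs for infinitely many
  levels, and injectivity of its map makes the preimage the same point at all of them.\<close>

lemma limit_set_fixed:
  assumes i: "i \<in> V"
  shows "limit_set i = hutchinson limit_set i"
proof
  have "hutchinson limit_set i \<subseteq> approximant (Suc n) i" for n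
    unfolding approximant_simps by (rule hutchinson_mono) (auto simp: limit_set_def)
  hence "hutchinson limit_set i \<subseteq> approximant n i" for n
    using approximant_Suc_subset[OF i, of n] by blast
  thus "hutchinson limit_set i \<subseteq> limit_set i" unfolding limit_set_def by blast
  show "limit_set i \<subseteq> hutchinson limit_set i"
  proof
    fix x assume x: "x \<in> limit_set i"
    show "x \<in> hutchinson limit_set i"
    proof (cases "x \<in> C i")
      case False
      have "\<exists>e\<in>E i. x \<in> S e ` approximant n (head G e)" for n
      proof -
        have "x \<in> approximant (Suc n) i" using x unfolding limit_set_def by blast
        thus ?thesis using False by (auto simp: approximant_simps hutchinson_def)
      qed
      then obtain f where f: "\<And>n. f n \<in> E i" "\<And>n. x \<in> S (f n) ` approximant n (head G (f n))"
        by metis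
      have "finite (range f)" using f(1) finite_subset[OF _ finite_out_arcs] by blast
      then obtain e where e: "infinite (f -` {e})"
        using inf_img_fin_dom[of f UNIV] by (auto simp: vimage_def)
      have eo: "e \<in> E i"
      proof -
        have "f -` {e} \<noteq> {}" using e by auto
        thus ?thesis using f(1) by blast
      qed
      hence ea: "e \<in> arcs G" and he: "head G e \<in> V" by auto
      have "\<exists>y. \<forall>n. y \<in> approximant n (head G e) \<and> S e y = x"
      proof -
        have ex: "\<exists>y\<in>approximant n (head G e). x = S e y" for n
        proof -
          obtain m where m: "m \<in> f -` {e}" "n \<le> m" using e by (meson infinite_nat_iff_unbounded_le)
          hence "x \<in> S e ` approximant m (head G e)" using f(2)[of m] by simp
          thus ?thesis using approximant_antimono[OF he m(2)] by blast
        qed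
        then obtain y where y: "y \<in> approximant 0 (head G e)" "x = S e y" by blast
        have "y \<in> approximant n (head G e)" for n
        proof -
          obtain z where z: "z \<in> approximant n (head G e)" "x = S e z" using ex by blast
          have "z = y"
            using inj_onD[OF inj_on_S[OF ea], of z y] z y approximant_subset_X[OF he] by blast
          thus ?thesis using z by simp
        qed
        thus ?thesis using y(2) by blast
      qed
      then obtain y where "y \<in> limit_set (head G e)" "S e y = x" unfolding limit_set_def by blast
      thus ?thesis using eo unfolding hutchinson_def by blast
    qed (simp add: hutchinson_def)
  qed
qed

text \<open>By monotonicity \<open>K\<close> stays inside every iterate. Conversely, points of the
  \<open>n\<close>-th iterate are within \<open>\<rho> ^ n * D\<close> of \<open>K\<close>, since
  every edge map contracts and points of \<open>C\<close> already belong to \<open>K\<close>;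
  closedness of \<open>K\<close> finishes.\<close>

lemma attractor_unique:
  assumes K: "\<And>i. i \<in> V \<Longrightarrow> K i \<noteq> {}" "\<And>i. i \<in> V \<Longrightarrow> compact (K i)"
      "\<And>i. i \<in> V \<Longrightarrow> K i \<subseteq> X i" "\<And>i. i \<in> V \<Longrightarrow> K i = hutchinson K i"
    and i: "i \<in> V"
  shows "K i = limit_set i"
proof
  have "K j \<subseteq> approximant n j" if "j \<in> V" for n j
    using that
  proof (induction n arbitrary: j)
    case (Suc n)
    have "hutchinson K j \<subseteq> approximant (Suc n) j"
      unfolding approximant_simps by (rule hutchinson_mono) (rule Suc.IH)
    thus ?case using K(4)[OF Suc.prems] by simp
  qed (simp add: approximant_simps K(3))
  thus "K i \<subseteq> limit_set i" unfolding limit_set_def using i by blast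
  obtain \<rho> where \<rho>: "0 < \<rho>" "\<rho> < 1" "\<And>e. e \<in> arcs G \<Longrightarrow> r e \<le> \<rho>" using max_ratio by blast
  obtain D where D: "D > 0" "\<And>i x y. i \<in> V \<Longrightarrow> x \<in> X i \<Longrightarrow> y \<in> X i \<Longrightarrow> dist x y \<le> D"
    using X_diameter by blast
  have near: "\<exists>y\<in>K j. dist y x \<le> \<rho> ^ n * D" if "j \<in> V" "x \<in> approximant n j" for n j x
    using that
  proof (induction n arbitrary: j x)
    case 0
    obtain y where y: "y \<in> K j" using K(1)[OF 0(1)] by blast
    hence "y \<in> X j" using K(3)[OF 0(1)] by blast
    thus ?case using y D(2)[OF 0(1), of y x] 0(2) by (auto simp: approximant_simps)
  next
    case (Suc n)
    show ?case
    proof (cases "x \<in> C j")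
      case True
      hence "x \<in> K j" using K(4)[OF Suc.prems(1)] by (auto simp: hutchinson_def)
      thus ?thesis using \<rho> D(1) by (intro bexI[of _ x]) auto
    next
      case False
      then obtain e z where e: "e \<in> E j" "z \<in> approximant n (head G e)" "x = S e z"
        using Suc.prems(2) by (auto simp: approximant_simps hutchinson_def)
      hence ea: "e \<in> arcs G" and h: "head G e \<in> V" by auto
      obtain y where y: "y \<in> K (head G e)" "dist y z \<le> \<rho> ^ n * D" using Suc.IH[OF h e(2)] by blast
      have "y \<in> X (head G e)" "z \<in> X (head G e)"
        using K(3)[OF h] y(1) approximant_subset_X[OF h] e(2) by blast+
      hence "dist (S e y) x = r e * dist y z" using S_similarity[OF ea] e(3) by simp
      also have "\<dots> \<le> \<rho> * (\<rho> ^ n * D)"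
        using y(2) \<rho>(1) \<rho>(3)[OF ea] D(1) ratio_pos[OF ea] by (intro mult_mono) auto
      finally have "dist (S e y) x \<le> \<rho> ^ Suc n * D" by simp
      moreover have "S e y \<in> K j" using K(4)[OF Suc.prems(1)] e(1) y(1) by (auto simp: hutchinson_def)
      ultimately show ?thesis by blast
    qed
  qed
  show "limit_set i \<subseteq> K i"
  proof
    fix x assume x: "x \<in> limit_set i"
    have "\<exists>y\<in>K i. dist y x < \<epsilon>" if \<epsilon>: "\<epsilon> > 0" for \<epsilon>
    proof -
      obtain n where "\<rho> ^ n < \<epsilon> / D" using real_arch_pow_inv[of "\<epsilon> / D" \<rho>] \<rho> D(1) \<epsilon> by auto
      hence "\<rho> ^ n * D < \<epsilon>" using D(1) by (simp add: field_simps)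
      moreover have "x \<in> approximant n i" using x unfolding limit_set_def by blast
      then obtain y where "y \<in> K i" "dist y x \<le> \<rho> ^ n * D" using near[OF i] by blast
      ultimately show ?thesis by (intro bexI[of _ y]) auto
    qed
    thus "x \<in> K i" using closed_approachable[OF compact_imp_closed[OF K(2)[OF i]]] by blast
  qed
qed

lemma limit_set_props:
  assumes sc: "mw_strongly_connected G" and i: "i \<in> V"
  shows "limit_set i \<noteq> {}" "compact (limit_set i)" "limit_set i \<subseteq> X i"
proof -
  show "limit_set i \<noteq> {}"
    unfolding limit_set_def
    by (rule compact_nest) (use i compact_approximant approximant_nonempty[OF sc] approximant_antimono in auto)
  show "compact (limit_set i)"
    unfolding limit_set_def by (rule compact_Inter) (use i compact_approximant in auto)
  show "limit_set i \<subseteq> X i"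
    using approximant_simps(1) unfolding limit_set_def by (metis INT_lower UNIV_I)
qed

text \<open>The definite description ranges over functions extensional on the vertices, so its
  witness is the restriction of \<open>limit_set\<close>.\<close>

lemma attractor_eq_limit_set:
  assumes sc: "mw_strongly_connected G" and i: "i \<in> V"
  shows "inhomogeneous_attractor G X S C i = limit_set i"
proof -
  define K0 where "K0 = restrict limit_set (V)"
  have hut: "hutchinson K0 j = hutchinson limit_set j" for j
  proof -
    have "S e ` K0 (head G e) = S e ` limit_set (head G e)" if "e \<in> E j" for e
      using that by (auto simp: K0_def)
    thus ?thesis unfolding hutchinson_def by auto
  qed
  have "inhomogeneous_attractor G X S C = K0"
    unfolding inhomogeneous_attractor_def hutchinson_def[symmetric]
  proof (rule the_equality)
    show "K0 \<in> extensional (V) \<and> (\<forall>i\<in>V. K0 i \<noteq> {} \<and> compact (K0 i) \<and> K0 i \<subseteq> X i \<and> K0 i = hutchinson K0 i)"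
      unfolding hut using limit_set_props[OF sc] limit_set_fixed by (auto simp: K0_def)
    fix K assume K: "K \<in> extensional (V) \<and> (\<forall>i\<in>V. K i \<noteq> {} \<and> compact (K i) \<and> K i \<subseteq> X i \<and> K i = hutchinson K i)"
    show "K = K0"
    proof (rule extensionalityI[of _ "V"])
      show "K j = K0 j" if j: "j \<in> V" for j
      proof -
        have "K j = limit_set j" by (rule attractor_unique[OF _ _ _ _ j]) (use K in blast)+
        thus ?thesis using j by (simp add: K0_def)
      qed
    qed (use K in \<open>auto simp: K0_def\<close>)
  qed
  thus ?thesis using i by (simp add: K0_def)
qed

lemma attractor:
  assumes sc: "mw_strongly_connected G" and i: "i \<in> V"
  defines "K \<equiv> inhomogeneous_attractor G X S C"
  shows "K i \<noteq> {}" "compact (K i)" "K i \<subseteq> X i"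
    "K i = C i \<union> (\<Union>e\<in>E i. S e ` K (head G e))"
proof -
  have eq: "K j = limit_set j" if "j \<in> V" for j
    unfolding K_def by (rule attractor_eq_limit_set[OF sc that])
  show "K i \<noteq> {}" "compact (K i)" "K i \<subseteq> X i"
    unfolding eq[OF i] by (rule limit_set_props[OF sc i])+
  have "S e ` K (head G e) = S e ` limit_set (head G e)" if "e \<in> E i" for e
    using that eq by auto
  thus "K i = C i \<union> (\<Union>e\<in>E i. S e ` K (head G e))"
    using limit_set_fixed[OF i] unfolding eq[OF i] hutchinson_def by auto
qed

text \<open>The iterates without \<open>C\<close> lie in those with \<open>C\<close>, level by
  level. The open set condition provides points of the homogeneous attractor; this is how they
  become points of the inhomogeneous one.\<close>

lemma homogeneous_attractor_subset:
  assumes sc: "mw_strongly_connected G" and i: "i \<in> V"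
  shows "homogeneous_attractor G X S i \<subseteq> inhomogeneous_attractor G X S C i"
proof -
  interpret h: inhomogeneous_mw_graph G X S r "\<lambda>_. {}"
    by unfold_locales auto
  have "h.approximant n j \<subseteq> approximant n j" if "j \<in> V" for n j
    using that
  proof (induction n arbitrary: j)
    case (Suc n)
    have "hutchinson (h.approximant n) j \<subseteq> hutchinson (approximant n) j"
      by (rule hutchinson_mono) (rule Suc.IH)
    thus ?case unfolding approximant_simps h.approximant_simps h.hutchinson_def hutchinson_def by blast
  qed (simp add: approximant_simps h.approximant_simps)
  thus ?thesis
    unfolding attractor_eq_limit_set[OF assms] h.attractor_eq_limit_set[OF assms]
      limit_set_def h.limit_set_def using i by blast
qed

end

section \<open>A renewal theorem on graphs\<close>

text \<open>A Markov chain on the vertices with transition probabilities \<open>p\<close> and delay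
  \<open>a e\<close> on the edge \<open>e\<close>, present only through averages over outgoing
  edges.\<close>

locale markov_renewal = fin_digraph G for G :: "('v, 'e) pre_digraph" +
  fixes p a :: "'e \<Rightarrow> real"
  assumes connected: "mw_strongly_connected G"
    and verts_ne: "verts G \<noteq> {}"
    and p_pos: "e \<in> arcs G \<Longrightarrow> p e > 0"
    and a_pos: "e \<in> arcs G \<Longrightarrow> a e > 0"
    and p_sum: "i \<in> verts G \<Longrightarrow> (\<Sum>e\<in>out_arcs G i. p e) = 1"
begin

definition len :: "'e list \<Rightarrow> real" where "len \<gamma> = sum_list (map a \<gamma>)"

definition weight :: "'e list \<Rightarrow> real" where "weight \<gamma> = prod_list (map p \<gamma>)"

definition cycle_lengths :: "'v \<Rightarrow> real set" where
  "cycle_lengths i = {len \<gamma> | \<gamma>. awalk i \<gamma> i \<and> \<gamma> \<noteq> []}"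

definition H :: "real set" where
  "H = closed_subgroup_generated (\<Union>i\<in>V. cycle_lengths i)"

lemma len_simps [simp]: "len [] = 0" "len (e # \<gamma>) = a e + len \<gamma>" "len (\<gamma> @ \<gamma>') = len \<gamma> + len \<gamma>'"
  by (simp_all add: len_def)

lemma weight_simps [simp]: "weight [] = 1" "weight (e # \<gamma>) = p e * weight \<gamma>"
  by (simp_all add: weight_def)

lemma walk_exists:
  assumes "i \<in> V" "j \<in> V"
  obtains \<gamma> where "awalk i \<gamma> j" "\<gamma> \<noteq> []"
  by (rule mw_strongly_connectedD[OF connected assms])

lemma H_subgroup: "closed_real_subgroup H"
  unfolding H_def by (rule closed_real_subgroup_generated)

lemma cycle_in_H: "awalk i \<gamma> i \<Longrightarrow> len \<gamma> \<in> H"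
proof (cases "\<gamma> = []")
  case False
  assume w: "awalk i \<gamma> i"
  hence "len \<gamma> \<in> (\<Union>i\<in>V. cycle_lengths i)"
    using False awalk_hd_in_verts[OF w] unfolding cycle_lengths_def by blast
  thus ?thesis unfolding H_def closed_subgroup_generated_eq by (rule hull_inc)
qed (use closed_real_subgroupD(2)[OF H_subgroup] in simp)

text \<open>Closing both walks with the same return walk produces two cycles. All walks between two
  given vertices therefore have lengths in one coset of \<open>H\<close>.\<close>

lemma parallel_walks_in_H:
  assumes "awalk i \<alpha> j" "awalk i \<beta> j"
  shows "len \<alpha> - len \<beta> \<in> H"
proof -
  obtain \<gamma> where \<gamma>: "awalk j \<gamma> i"
    using walk_exists awalk_hd_in_verts[OF assms(1)] awalk_last_in_verts[OF assms(1)] by metis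
  have "len (\<alpha> @ \<gamma>) \<in> H" "len (\<beta> @ \<gamma>) \<in> H"
    by (rule cycle_in_H[OF awalk_appendI[OF assms(1) \<gamma>]], rule cycle_in_H[OF awalk_appendI[OF assms(2) \<gamma>]])
  from closed_real_subgroupD(5)[OF H_subgroup this] show ?thesis by simp
qed

lemma len_nonneg: "set \<gamma> \<subseteq> arcs G \<Longrightarrow> len \<gamma> \<ge> 0"
  by (induction \<gamma>) (auto intro!: add_nonneg_nonneg less_imp_le[OF a_pos])

lemma len_pos: "set \<gamma> \<subseteq> arcs G \<Longrightarrow> \<gamma> \<noteq> [] \<Longrightarrow> len \<gamma> > 0"
  by (cases \<gamma>) (auto intro!: add_pos_nonneg len_nonneg a_pos)

lemma cycle_lengths_semigroup:
  assumes i: "i \<in> V"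
  shows "x \<in> cycle_lengths i \<Longrightarrow> y \<in> cycle_lengths i \<Longrightarrow> x + y \<in> cycle_lengths i"
    and "x \<in> cycle_lengths i \<Longrightarrow> x > 0" and "cycle_lengths i \<noteq> {}"
proof -
  show "x + y \<in> cycle_lengths i" if "x \<in> cycle_lengths i" "y \<in> cycle_lengths i"
  proof -
    obtain \<gamma> \<gamma>' where "awalk i \<gamma> i" "\<gamma> \<noteq> []" "x = len \<gamma>" "awalk i \<gamma>' i" "y = len \<gamma>'"
      using \<open>x \<in> _\<close> \<open>y \<in> _\<close> unfolding cycle_lengths_def by blast
    hence "awalk i (\<gamma> @ \<gamma>') i" "\<gamma> @ \<gamma>' \<noteq> []" "x + y = len (\<gamma> @ \<gamma>')" by (auto intro: awalk_appendI)
    thus ?thesis unfolding cycle_lengths_def by blast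
  qed
  show "x > 0" if "x \<in> cycle_lengths i"
    using that len_pos unfolding cycle_lengths_def by (auto simp: awalk_def)
  show "cycle_lengths i \<noteq> {}"
    using walk_exists[OF i i] unfolding cycle_lengths_def by blast
qed

text \<open>Cycles can be concatenated only at a common vertex, so the density lemma for semigroups
  is applied to a single \<open>cycle_lengths i\<close>. A cycle elsewhere is inserted into a round
  trip from \<open>i\<close>; the difference to the bare round trip is its length.\<close>

lemma H_eq_local:
  assumes i: "i \<in> V"
  shows "H = closed_subgroup_generated (cycle_lengths i)"
proof
  let ?H = "closed_subgroup_generated (cycle_lengths i)"
  note D = closed_real_subgroupD[OF closed_real_subgroup_generated[of "cycle_lengths i"]]
  show "?H \<subseteq> H"
    unfolding H_def closed_subgroup_generated_eq by (rule hull_mono) (use i in blast)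
  have inc: "cycle_lengths i \<subseteq> ?H" unfolding closed_subgroup_generated_eq by (rule hull_subset)
  have "x \<in> ?H" if j: "j \<in> V" and x: "x \<in> cycle_lengths j" for j x
  proof -
    obtain \<gamma> where \<gamma>: "awalk j \<gamma> j" "x = len \<gamma>" using x unfolding cycle_lengths_def by blast
    obtain \<alpha> where \<alpha>: "awalk i \<alpha> j" "\<alpha> \<noteq> []" using walk_exists[OF i j] by blast
    obtain \<beta> where \<beta>: "awalk j \<beta> i" using walk_exists[OF j i] by blast
    have "awalk i (\<alpha> @ \<gamma> @ \<beta>) i" "awalk i (\<alpha> @ \<beta>) i"
      using \<alpha> \<beta> \<gamma> by (auto intro!: awalk_appendI)
    hence "len (\<alpha> @ \<gamma> @ \<beta>) \<in> cycle_lengths i" "len (\<alpha> @ \<beta>) \<in> cycle_lengths i"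
      using \<alpha>(2) unfolding cycle_lengths_def by blast+
    hence "len (\<alpha> @ \<gamma> @ \<beta>) - len (\<alpha> @ \<beta>) \<in> ?H" using inc by (intro D(5)) blast+
    thus ?thesis using \<gamma>(2) by simp
  qed
  hence "(\<Union>j\<in>V. cycle_lengths j) \<subseteq> ?H" by blast
  thus "H \<subseteq> ?H"
    unfolding H_def closed_subgroup_generated_eq
    by (rule hull_minimal) (use closed_real_subgroup_generated[of "cycle_lengths i"] in
      \<open>simp add: closed_subgroup_generated_eq\<close>)
qed

definition amin :: real where "amin = Min (a ` arcs G)"
definition amax :: real where "amax = Max (a ` arcs G)"
definition pmin :: real where "pmin = Min (p ` arcs G)"

lemma arcs_ne: "arcs G \<noteq> {}"
proof -
  obtain i where i: "i \<in> V" using verts_ne by blast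
  obtain \<gamma> where "awalk i \<gamma> i" "\<gamma> \<noteq> []" using walk_exists[OF i i] by blast
  thus ?thesis by (cases \<gamma>) (auto simp: awalk_Cons_iff)
qed

lemma amin_pos: "amin > 0" unfolding amin_def using arcs_ne a_pos by (subst Min_gr_iff) auto
lemma amin_le: "e \<in> arcs G \<Longrightarrow> amin \<le> a e" unfolding amin_def by (rule Min_le) auto
lemma amax_ge: "e \<in> arcs G \<Longrightarrow> a e \<le> amax" unfolding amax_def by (rule Max_ge) auto
lemma pmin_pos: "pmin > 0" unfolding pmin_def using arcs_ne p_pos by (subst Min_gr_iff) auto
lemma pmin_le: "e \<in> arcs G \<Longrightarrow> pmin \<le> p e" unfolding pmin_def by (rule Min_le) auto

lemma amax_pos: "amax > 0"
  using arcs_ne amin_pos amin_le amax_ge by (meson ex_in_conv less_le_trans)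

lemma p_le_1: "e \<in> arcs G \<Longrightarrow> p e \<le> 1"
proof -
  assume e: "e \<in> arcs G"
  have "p e \<le> (\<Sum>e\<in>E (tail G e). p e)"
    by (rule member_le_sum) (use e p_pos in \<open>auto simp: less_imp_le\<close>)
  thus ?thesis using p_sum[of "tail G e"] e by simp
qed

lemma pmin_le_1: "pmin \<le> 1"
  using arcs_ne pmin_le p_le_1 by (meson ex_in_conv order_trans)

lemma weight_ge: "set \<gamma> \<subseteq> arcs G \<Longrightarrow> pmin ^ length \<gamma> \<le> weight \<gamma>"
proof (induction \<gamma>)
  case (Cons e \<gamma>)
  hence "pmin * pmin ^ length \<gamma> \<le> p e * weight \<gamma>"
    using pmin_pos by (intro mult_mono) (auto simp: pmin_le intro: less_imp_le[OF p_pos])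
  thus ?case by simp
qed simp

lemma weight_pos: "set \<gamma> \<subseteq> arcs G \<Longrightarrow> weight \<gamma> > 0"
  by (induction \<gamma>) (auto intro!: mult_pos_pos p_pos)

lemma weight_le_1: "set \<gamma> \<subseteq> arcs G \<Longrightarrow> weight \<gamma> \<le> 1"
proof (induction \<gamma>)
  case (Cons e \<gamma>)
  have "p e * weight \<gamma> \<le> 1 * 1"
    by (rule mult_mono) (use Cons p_le_1 weight_pos in \<open>auto intro: less_imp_le\<close>)
  thus ?case by simp
qed simp

lemma len_ge: "set \<gamma> \<subseteq> arcs G \<Longrightarrow> real (length \<gamma>) * amin \<le> len \<gamma>"
  by (induction \<gamma>) (auto simp: algebra_simps intro!: add_mono amin_le)

text \<open>A walk of total delay at most \<open>Q\<close> has at most \<open>Q / amin\<close>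
  edges, each of probability at least \<open>pmin\<close>.\<close>

lemma weight_lower_bound:
  obtains q where "q > 0" "q \<le> 1" "\<And>\<gamma>. set \<gamma> \<subseteq> arcs G \<Longrightarrow> len \<gamma> \<le> Q \<Longrightarrow> q \<le> weight \<gamma>"
proof
  let ?q = "pmin ^ nat \<lceil>Q / amin\<rceil>"
  show "?q > 0" "?q \<le> 1" using pmin_pos pmin_le_1 by (simp_all add: power_le_one)
  fix \<gamma> assume \<gamma>: "set \<gamma> \<subseteq> arcs G" "len \<gamma> \<le> Q"
  have "real (length \<gamma>) \<le> Q / amin" using len_ge[OF \<gamma>(1)] \<gamma>(2) amin_pos by (simp add: field_simps)
  hence "length \<gamma> \<le> nat \<lceil>Q / amin\<rceil>" by linarith
  hence "?q \<le> pmin ^ length \<gamma>" using pmin_pos pmin_le_1 by (intro power_decreasing) auto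
  thus "?q \<le> weight \<gamma>" using weight_ge[OF \<gamma>(1)] by simp
qed

text \<open>A cycle at \<open>i\<close> of suitable length followed by a fixed walk from
  \<open>i\<close> to \<open>j\<close> comes close to every large value of the right coset; the walk
  \<gamma>' serves to name that coset.\<close>

lemma approximate_walk_length:
  assumes \<epsilon>: "\<epsilon> > 0"
  obtains R where "R \<ge> 0" "\<And>i j \<gamma>' x. awalk i \<gamma>' j \<Longrightarrow> x - len \<gamma>' \<in> H \<Longrightarrow> x \<ge> R \<Longrightarrow>
    \<exists>\<gamma>. awalk i \<gamma> j \<and> x \<le> len \<gamma> \<and> len \<gamma> \<le> x + \<epsilon>"
proof -
  have "\<exists>R. \<forall>\<gamma>' x. awalk i \<gamma>' j \<longrightarrow> x - len \<gamma>' \<in> H \<longrightarrow> x \<ge> R \<longrightarrow>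
    (\<exists>\<gamma>. awalk i \<gamma> j \<and> x \<le> len \<gamma> \<and> len \<gamma> \<le> x + \<epsilon>)" if i: "i \<in> V" and j: "j \<in> V" for i j
  proof -
    obtain \<pi> where \<pi>: "awalk i \<pi> j" using walk_exists[OF i j] by blast
    obtain b where b: "\<And>x. x \<in> H \<Longrightarrow> x \<ge> b \<Longrightarrow> \<exists>y\<in>cycle_lengths i. x \<le> y \<and> y \<le> x + \<epsilon>"
      using semigroup_eventually_dense_above[OF cycle_lengths_semigroup[OF i] H_eq_local[OF i] \<epsilon>]
      by blast
    have "\<exists>\<gamma>. awalk i \<gamma> j \<and> x \<le> len \<gamma> \<and> len \<gamma> \<le> x + \<epsilon>"
      if x: "awalk i \<gamma>' j" "x - len \<gamma>' \<in> H" "x \<ge> b + len \<pi>" for \<gamma>' x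
    proof -
      have "(x - len \<gamma>') + (len \<gamma>' - len \<pi>) \<in> H"
        by (rule closed_real_subgroupD(3)[OF H_subgroup x(2) parallel_walks_in_H[OF x(1) \<pi>]])
      hence "x - len \<pi> \<in> H" by simp
      then obtain y where y: "y \<in> cycle_lengths i" "x - len \<pi> \<le> y" "y \<le> x - len \<pi> + \<epsilon>"
        using b[of "x - len \<pi>"] x(3) by auto
      then obtain \<sigma> where \<sigma>: "awalk i \<sigma> i" "y = len \<sigma>" unfolding cycle_lengths_def by blast
      show ?thesis
        by (rule exI[of _ "\<sigma> @ \<pi>"]) (use \<sigma> \<pi> y in \<open>auto intro: awalk_appendI\<close>)
    qed
    thus ?thesis by blast
  qed
  then obtain R where R: "\<And>i j \<gamma>' x. i \<in> V \<Longrightarrow> j \<in> V \<Longrightarrow> awalk i \<gamma>' j \<Longrightarrow> x - len \<gamma>' \<in> H \<Longrightarrow>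
      x \<ge> R i j \<Longrightarrow> (\<exists>\<gamma>. awalk i \<gamma> j \<and> x \<le> len \<gamma> \<and> len \<gamma> \<le> x + \<epsilon>)"
    by metis
  \<comment> \<open>The sum of absolute values is a common threshold for the finitely many pairs of
    vertices.\<close>
  define B where "B = (\<Sum>(i, j)\<in>V \<times> V. \<bar>R i j\<bar>)"
  have RB: "R i j \<le> B" if "i \<in> V" "j \<in> V" for i j
  proof -
    have "\<bar>R i j\<bar> \<le> B"
      unfolding B_def using member_le_sum[of "(i, j)" "V \<times> V" "\<lambda>(i, j). \<bar>R i j\<bar>"] that
      by auto
    thus ?thesis by simp
  qed
  show thesis
  proof (rule that)
    show "B \<ge> 0" unfolding B_def by (rule sum_nonneg) auto
    fix i j \<gamma>' x assume *: "awalk i \<gamma>' j" "x - len \<gamma>' \<in> H" "x \<ge> B"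
    have ij: "i \<in> V" "j \<in> V"
      using awalk_hd_in_verts[OF *(1)] awalk_last_in_verts[OF *(1)] by auto
    show "\<exists>\<gamma>. awalk i \<gamma> j \<and> x \<le> len \<gamma> \<and> len \<gamma> \<le> x + \<epsilon>"
      by (rule R[OF ij *(1,2)]) (use RB[OF ij] *(3) in simp)
  qed
qed

text \<open>Induction over time slabs of width \<open>amin\<close>: every delay is at least
  \<open>amin\<close>, so the average at time \<open>t\<close> involves earlier slabs only, and at
  most \<open>amax\<close>, so it never reaches back beyond the initial window. The sets
  \<open>D j\<close> make the principle usable on a coset of times as well as on the whole
  line.\<close>

lemma maximum_principle:
  assumes D: "\<And>e t. e \<in> arcs G \<Longrightarrow> t \<in> D (tail G e) \<Longrightarrow> t - a e \<in> D (head G e)"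
    and sub: "\<And>j t. j \<in> V \<Longrightarrow> t \<in> D j \<Longrightarrow> t \<ge> T \<Longrightarrow>
      u j t \<le> (\<Sum>e\<in>E j. p e * u (head G e) (t - a e))"
    and win: "\<And>j t. j \<in> V \<Longrightarrow> t \<in> D j \<Longrightarrow> T - amax \<le> t \<Longrightarrow> t < T \<Longrightarrow> u j t \<le> M"
    and j: "j \<in> V" and t: "t \<in> D j" "T - amax \<le> t"
  shows "u j t \<le> M"
proof -
  have "u j t \<le> M" if "j \<in> V" "t \<in> D j" "T - amax \<le> t" "t < T + real n * amin" for n j t
    using that
  proof (induction n arbitrary: j t)
    case 0
    thus ?case by (intro win) auto
  next
    case (Suc n)
    show ?case
    proof (cases "t < T")
      case True
      thus ?thesis using Suc.prems by (intro win) auto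
    next
      case False
      have "u j t \<le> (\<Sum>e\<in>E j. p e * u (head G e) (t - a e))"
        using Suc.prems False by (intro sub) auto
      also have "\<dots> \<le> (\<Sum>e\<in>E j. p e * M)"
      proof (rule sum_mono)
        fix e assume "e \<in> E j"
        hence e: "e \<in> arcs G" "tail G e = j" by auto
        have "u (head G e) (t - a e) \<le> M"
        proof (rule Suc.IH)
          show "t - a e < T + real n * amin"
            using Suc.prems(4) amin_le[OF e(1)] by (simp add: algebra_simps)
        qed (use e D[OF e(1)] Suc.prems False amax_ge[OF e(1)] in auto)
        thus "p e * u (head G e) (t - a e) \<le> p e * M" using p_pos[OF e(1)] by simp
      qed
      also have "\<dots> = M" using p_sum[OF Suc.prems(1)] by (simp flip: sum_distrib_right)
      finally show ?thesis .
    qed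
  qed
  moreover obtain n where "(t - T) / amin < real n" using reals_Archimedean2 by blast
  hence "t < T + real n * amin" using amin_pos by (simp add: field_simps)
  ultimately show ?thesis using j t by blast
qed

text \<open>The recursion is unfolded along one walk while all branches leaving it are bounded by
  \<open>M\<close>. Read backwards, a value near \<open>M\<close> at the start forces values near
  \<open>M\<close> at the end, with an error enlarged by \<open>1 / weight \<gamma>\<close>.\<close>

lemma walk_inequality:
  assumes D: "\<And>e t. e \<in> arcs G \<Longrightarrow> t \<in> D (tail G e) \<Longrightarrow> t - a e \<in> D (head G e)"
    and sub: "\<And>j t. j \<in> V \<Longrightarrow> t \<in> D j \<Longrightarrow> t \<ge> T \<Longrightarrow>
      u j t \<le> (\<Sum>e\<in>E j. p e * u (head G e) (t - a e))"
    and bound: "\<And>j t. j \<in> V \<Longrightarrow> t \<in> D j \<Longrightarrow> T - amax \<le> t \<Longrightarrow> u j t \<le> M"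
    and "awalk i \<gamma> j" "t \<in> D i" "t - len \<gamma> \<ge> T"
  shows "u i t \<le> weight \<gamma> * u j (t - len \<gamma>) + (1 - weight \<gamma>) * M"
  using assms(4-6)
proof (induction \<gamma> arbitrary: i t)
  case Nil
  thus ?case by (simp add: awalk_Nil_iff)
next
  case (Cons e \<gamma>)
  hence e: "e \<in> arcs G" "tail G e = i" "awalk (head G e) \<gamma> j" by (auto simp: awalk_Cons_iff)
  have i: "i \<in> V" using e tail_in_verts by blast
  have \<gamma>: "set \<gamma> \<subseteq> arcs G" using e(3) by blast
  have tT: "t \<ge> T + a e" "t \<ge> T" using Cons.prems(3) len_nonneg[OF \<gamma>] a_pos[OF e(1)] by auto
  have "u i t \<le> (\<Sum>e\<in>E i. p e * u (head G e) (t - a e))"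
    by (rule sub) (use i Cons.prems tT in auto)
  also have "\<dots> = p e * u (head G e) (t - a e) + (\<Sum>e\<in>E i - {e}. p e * u (head G e) (t - a e))"
    by (rule sum.remove) (use e in auto)
  also have "(\<Sum>e\<in>E i - {e}. p e * u (head G e) (t - a e)) \<le> (\<Sum>e\<in>E i - {e}. p e * M)"
  proof (rule sum_mono)
    fix e' assume "e' \<in> E i - {e}"
    hence e': "e' \<in> arcs G" "tail G e' = i" by auto
    have "u (head G e') (t - a e') \<le> M"
      by (rule bound) (use e' D[OF e'(1)] Cons.prems(2) tT amax_ge[OF e'(1)] in auto)
    thus "p e' * u (head G e') (t - a e') \<le> p e' * M" using p_pos[OF e'(1)] by simp
  qed
  also have "(\<Sum>e\<in>E i - {e}. p e * M) = (1 - p e) * M"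
  proof -
    have "(\<Sum>e\<in>E i. p e) = p e + (\<Sum>e\<in>E i - {e}. p e)"
      by (rule sum.remove) (use e in auto)
    thus ?thesis using p_sum[OF i] by (simp flip: sum_distrib_right)
  qed
  also have "p e * u (head G e) (t - a e) \<le>
      p e * (weight \<gamma> * u j (t - a e - len \<gamma>) + (1 - weight \<gamma>) * M)"
  proof (rule mult_left_mono)
    show "u (head G e) (t - a e) \<le> weight \<gamma> * u j (t - a e - len \<gamma>) + (1 - weight \<gamma>) * M"
      by (rule Cons.IH[OF e(3)]) (use D[OF e(1)] e(2) Cons.prems in auto)
  qed (use p_pos[OF e(1)] in simp)
  finally show ?case by (simp add: algebra_simps)
qed

text \<open>Regularity bounds \<open>f\<close> on the initial window by its values at the right end
  \<open>T\<close>, and the maximum principle keeps that bound for all later times.\<close>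

lemma subsolution_bounded:
  fixes f :: "'v \<Rightarrow> real \<Rightarrow> real" and rest :: "real \<Rightarrow> real"
  assumes s: "s \<ge> 0"
    and f0: "\<And>i t. i \<in> V \<Longrightarrow> 0 \<le> f i t"
    and reg: "\<And>i t x. i \<in> V \<Longrightarrow> 0 \<le> x \<Longrightarrow> exp (- s * x) * f i t \<le> f i (t + x)"
    and sub: "\<And>i t. i \<in> V \<Longrightarrow> t \<ge> T0 \<Longrightarrow>
      f i t + rest t \<le> (\<Sum>e\<in>E i. p e * (f (head G e) (t - a e) + rest (t - a e)))"
    and rest0: "\<And>t. rest t \<ge> 0" and rest_lim: "(rest \<longlongrightarrow> 0) at_top"
  shows "\<exists>B T. \<forall>j\<in>V. \<forall>t\<ge>T. f j t \<le> B"
proof -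
  have "eventually (\<lambda>t. rest t < 1) at_top" using order_tendstoD(2)[OF rest_lim, of 1] by simp
  then obtain T1 where T1: "\<And>t. t \<ge> T1 \<Longrightarrow> rest t < 1" unfolding eventually_at_top_linorder by blast
  define T where "T = max (T1 + amax) T0"
  \<comment> \<open>The factor \<open>exp (s * amax)\<close> is the worst loss in regularity across
    a window of length \<open>amax\<close>; the summand 1 bounds \<open>rest\<close> there.\<close>
  define B where "B = exp (s * amax) * (\<Sum>i\<in>V. f i T) + 1"
  have *: "f j t + rest t \<le> B" if "j \<in> V" "T - amax \<le> t" for j t
  proof (rule maximum_principle[of "\<lambda>_. UNIV" T "\<lambda>j t. f j t + rest t"])
    fix j t assume t: "j \<in> V" "T - amax \<le> t" "t < T"
    have "f j t = exp (s * (T - t)) * (exp (- s * (T - t)) * f j t)" by (simp add: mult.assoc[symmetric] flip: exp_add)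
    also have "\<dots> \<le> exp (s * (T - t)) * f j T"
      using reg[OF t(1), of "T - t" t] t(3) by (intro mult_left_mono) auto
    also have "\<dots> \<le> exp (s * amax) * (\<Sum>i\<in>V. f i T)"
      using t s f0 by (intro mult_mono member_le_sum) (auto intro!: mult_left_mono)
    finally show "f j t + rest t \<le> B" using T1[of t] t(2) unfolding B_def T_def by (simp add: max_def split: if_splits)
  qed (use that sub in \<open>auto simp: T_def\<close>)
  have "f j t \<le> B" if "j \<in> V" "T - amax \<le> t" for j t
    using *[OF that] rest0[of t] by linarith
  thus ?thesis by blast
qed

text \<open>On the cosets reachable from \<open>(i0, y)\<close> let \<open>M\<close> be the upper limit of \<open>f\<close>. A value of \<open>f\<close> near
  \<open>M\<close> forces values near \<open>M\<close> at the endpoints of all short walks; these are dense enough, by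
  one-sided regularity, to cover a whole time window, and from there the minimum principle
  for \<open>\<nu>\<close> propagates the lower bound to all later times.\<close>

theorem renewal_limit:
  fixes f \<nu> :: "'v \<Rightarrow> real \<Rightarrow> real" and rest :: "real \<Rightarrow> real"
  assumes s: "s \<ge> 0"
    and f0: "\<And>i t. i \<in> V \<Longrightarrow> 0 \<le> f i t"
    and reg: "\<And>i t x. i \<in> V \<Longrightarrow> 0 \<le> x \<Longrightarrow> exp (- s * x) * f i t \<le> f i (t + x)"
    and sub: "\<And>i t. i \<in> V \<Longrightarrow> t \<ge> T0 \<Longrightarrow>
      f i t + rest t \<le> (\<Sum>e\<in>E i. p e * (f (head G e) (t - a e) + rest (t - a e)))"
    and rest0: "\<And>t. rest t \<ge> 0" and rest_lim: "(rest \<longlongrightarrow> 0) at_top"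
    and super: "\<And>i t. i \<in> V \<Longrightarrow> (\<Sum>e\<in>E i. p e * \<nu> (head G e) (t - a e)) \<le> \<nu> i t"
    and \<nu>f: "\<And>i t. i \<in> V \<Longrightarrow> \<nu> i t \<le> f i t"
    and f\<nu>: "\<And>i. i \<in> V \<Longrightarrow> ((\<lambda>t. f i t - \<nu> i t) \<longlongrightarrow> 0) at_top"
    and i0: "i0 \<in> V"
  shows "\<exists>L. (f i0 \<longlongrightarrow> L) (inf at_top (principal {t. t - y \<in> H}))"
proof -
  note HD = closed_real_subgroupD[OF H_subgroup]
  \<comment> \<open>Times at \<open>j\<close> that arise from the coset \<open>y + H\<close> at
    \<open>i0\<close> by subtracting the length of a walk to \<open>j\<close>; the choice of the
    walk is immaterial, since lengths of parallel walks differ by elements of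
    \<open>H\<close>.\<close>
  define D where "D j = {t. \<exists>\<alpha>. awalk i0 \<alpha> j \<and> t + len \<alpha> - y \<in> H}" for j
  have Dstep: "t - a e \<in> D (head G e)" if e: "e \<in> arcs G" and t: "t \<in> D (tail G e)" for e t
  proof -
    obtain \<alpha> where \<alpha>: "awalk i0 \<alpha> (tail G e)" "t + len \<alpha> - y \<in> H" using t unfolding D_def by blast
    have "awalk i0 (\<alpha> @ [e]) (head G e)" using \<alpha>(1) arc_implies_awalk[OF e] by (rule awalk_appendI)
    moreover have "t - a e + len (\<alpha> @ [e]) - y = t + len \<alpha> - y" by simp
    ultimately show ?thesis using \<alpha>(2) unfolding D_def by (metis (mono_tags, lifting) mem_Collect_eq)
  qed
  have Ddiff: "t - t' - len \<pi> \<in> H" if t: "t \<in> D i" and t': "t' \<in> D j" and \<pi>: "awalk i \<pi> j" for t t' i j \<pi>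
  proof -
    obtain \<alpha> where \<alpha>: "awalk i0 \<alpha> i" "t + len \<alpha> - y \<in> H" using t unfolding D_def by blast
    obtain \<beta> where \<beta>: "awalk i0 \<beta> j" "t' + len \<beta> - y \<in> H" using t' unfolding D_def by blast
    have "len (\<alpha> @ \<pi>) - len \<beta> \<in> H"
      by (rule parallel_walks_in_H[OF awalk_appendI[OF \<alpha>(1) \<pi>] \<beta>(1)])
    with HD(5)[OF \<alpha>(2) \<beta>(2)]
    have "(t + len \<alpha> - y) - (t' + len \<beta> - y) - (len (\<alpha> @ \<pi>) - len \<beta>) \<in> H" by (rule HD(5))
    moreover have "(t + len \<alpha> - y) - (t' + len \<beta> - y) - (len (\<alpha> @ \<pi>) - len \<beta>) = t - t' - len \<pi>" by simp
    ultimately show ?thesis by (simp only:)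
  qed
  have D0: "t \<in> D i0" if "t - y \<in> H" for t
    unfolding D_def using that i0 by (auto intro!: exI[of _ "[]"] simp: awalk_Nil_iff)
  have D_unbounded: "\<exists>t\<ge>T. t \<in> D i0" for T
  proof -
    obtain h where "h \<in> cycle_lengths i0" using cycle_lengths_semigroup(3)[OF i0] by blast
    hence h: "h \<in> H" "h > 0"
      using cycle_in_H cycle_lengths_semigroup(2)[OF i0] unfolding cycle_lengths_def by blast+
    obtain n where n: "(T - y) / h < real n" using reals_Archimedean2 by blast
    have "of_int (int n) * h \<in> H" by (rule HD(6)[OF h(1)])
    hence "y + real n * h \<in> D i0" by (intro D0) simp
    moreover have "T \<le> y + real n * h" using n h(2) by (simp add: field_simps)
    ultimately show ?thesis by blast
  qed
  define u where "u i t = f i t + rest t" for i t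
  have usub: "u j t \<le> (\<Sum>e\<in>E j. p e * u (head G e) (t - a e))"
    if "j \<in> V" "t \<ge> T0" for j t
    using sub[OF that] unfolding u_def .
  have ev_rest: "\<exists>T. \<forall>t\<ge>T. rest t \<le> \<delta>" if "\<delta> > 0" for \<delta>
  proof -
    have "eventually (\<lambda>t. rest t < \<delta>) at_top" using order_tendstoD(2)[OF rest_lim that] .
    thus ?thesis unfolding eventually_at_top_linorder by (meson less_imp_le)
  qed
  define Z where "Z = {m. \<exists>T. \<forall>j\<in>V. \<forall>t\<ge>T. t \<in> D j \<longrightarrow> f j t \<le> m}"
  have Zne: "Z \<noteq> {}"
  proof -
    obtain B T where "\<forall>j\<in>V. \<forall>t\<ge>T. f j t \<le> B"
      using subsolution_bounded[OF s f0 reg sub rest0 rest_lim] by blast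
    thus ?thesis unfolding Z_def by blast
  qed
  have Z0: "m \<ge> 0" if m: "m \<in> Z" for m
  proof -
    obtain T where T: "\<And>j t. j \<in> V \<Longrightarrow> t \<ge> T \<Longrightarrow> t \<in> D j \<Longrightarrow> f j t \<le> m"
      using m unfolding Z_def by blast
    obtain t where "t \<ge> T" "t \<in> D i0" using D_unbounded by blast
    from T[OF i0 this] f0[OF i0, of t] show ?thesis by simp
  qed
  hence Zb: "bdd_below Z" by (rule bdd_belowI)
  define M where "M = Inf Z"
  have M0: "M \<ge> 0" unfolding M_def by (rule cInf_greatest[OF Zne Z0])
  have upper: "\<exists>T. \<forall>j\<in>V. \<forall>t\<ge>T. t \<in> D j \<longrightarrow> f j t \<le> M + \<delta>" if \<delta>: "\<delta> > 0" for \<delta>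
  proof -
    obtain m where m: "m \<in> Z" "m < M + \<delta>" using cInf_lessD[OF Zne, of "M + \<delta>"] \<delta> unfolding M_def by auto
    then obtain T where "\<forall>j\<in>V. \<forall>t\<ge>T. t \<in> D j \<longrightarrow> f j t \<le> m" unfolding Z_def by blast
    thus ?thesis using m(2) by (meson less_imp_le order_trans)
  qed
  have freq: "\<exists>j\<in>V. \<exists>t\<ge>T. t \<in> D j \<and> f j t > M - \<delta>" if \<delta>: "\<delta> > 0" for \<delta> T
  proof (rule ccontr)
    assume "\<not> ?thesis"
    hence "M - \<delta> \<in> Z" unfolding Z_def by (force simp: not_less)
    hence "M \<le> M - \<delta>" unfolding M_def by (rule cInf_lower[OF _ Zb])
    thus False using \<delta> by simp
  qed
  have lower: "\<exists>T. \<forall>j\<in>V. \<forall>t\<ge>T. t \<in> D j \<longrightarrow> M - \<eta> \<le> f j t" if \<eta>: "\<eta> > 0" for \<eta>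
  proof -
    \<comment> \<open>Chosen so that overshooting by \<epsilon> costs at most
      \<open>\<eta> / 2\<close>, by \<open>exp (- s * \<epsilon>) \<ge> 1 - s * \<epsilon>\<close>;
      the 1 in the denominator covers \<open>M * s = 0\<close>.\<close>
    define \<epsilon> where "\<epsilon> = \<eta> / (2 * (M * s + 1))"
    have Ms: "M * s \<ge> 0" using M0 s by simp
    have \<epsilon>: "\<epsilon> > 0" unfolding \<epsilon>_def using \<eta> Ms by (intro divide_pos_pos) auto
    have "(M * s + 1) * \<epsilon> = \<eta> / 2" unfolding \<epsilon>_def using Ms by (simp add: field_simps add_nonneg_eq_0_iff)
    hence "M * s * \<epsilon> \<le> \<eta> / 2" using \<epsilon> by (simp add: algebra_simps)
    moreover have "1 - s * \<epsilon> \<le> exp (- s * \<epsilon>)" using exp_ge_add_one_self[of "- s * \<epsilon>"] by simp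
    hence "M * (1 - s * \<epsilon>) \<le> M * exp (- s * \<epsilon>)" using M0 by (intro mult_left_mono) auto
    ultimately have M\<epsilon>: "M - \<eta> / 2 \<le> exp (- s * \<epsilon>) * M" by (simp add: algebra_simps)
    obtain R where R: "R \<ge> 0" "\<And>i j \<gamma>' x. awalk i \<gamma>' j \<Longrightarrow> x - len \<gamma>' \<in> H \<Longrightarrow> x \<ge> R \<Longrightarrow>
        \<exists>\<gamma>. awalk i \<gamma> j \<and> x \<le> len \<gamma> \<and> len \<gamma> \<le> x + \<epsilon>"
      using approximate_walk_length[OF \<epsilon>] by blast
    \<comment> \<open>The longest walk that occurs: a window point lies at most
      \<open>R + amax\<close> before \<open>t\<close>, and the approximation overshoots by at most
      \<epsilon>.\<close>
    define Q where "Q = R + amax + \<epsilon>"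
    obtain q where q: "q > 0" "q \<le> 1" "\<And>\<gamma>. set \<gamma> \<subseteq> arcs G \<Longrightarrow> len \<gamma> \<le> Q \<Longrightarrow> q \<le> weight \<gamma>"
      using weight_lower_bound by blast
    \<comment> \<open>The defect \<open>3 * \<delta>\<close> at \<open>t\<close> is divided by a
      weight of at least \<open>q\<close>, leaving \<open>3 * \<eta> / 10\<close>. With
      \<open>\<eta> / 2\<close> from the overshoot and \<delta> from \<open>f - \<nu>\<close> the
      total stays below \<eta>.\<close>
    define \<delta> where "\<delta> = \<eta> * q / 10"
    have \<delta>: "\<delta> > 0" "3 * \<delta> / q = 3 * \<eta> / 10" "\<delta> \<le> \<eta> / 10" unfolding \<delta>_def using \<eta> q by auto
    obtain T1 where T1: "\<And>t. t \<ge> T1 \<Longrightarrow> rest t \<le> \<delta>" using ev_rest[OF \<delta>(1)] by blast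
    obtain T2 where T2: "\<And>j t. j \<in> V \<Longrightarrow> t \<ge> T2 \<Longrightarrow> t \<in> D j \<Longrightarrow> f j t \<le> M + \<delta>"
      using upper[OF \<delta>(1)] by blast
    have "\<forall>\<^sub>F t in at_top. \<forall>i\<in>V. f i t - \<nu> i t < \<delta>"
      by (intro eventually_ball_finite finite_verts ballI order_tendstoD(2)[OF f\<nu>] \<delta>)
    then obtain T3 where T3: "\<And>i t. i \<in> V \<Longrightarrow> t \<ge> T3 \<Longrightarrow> f i t - \<nu> i t < \<delta>"
      unfolding eventually_at_top_linorder by blast
    define T where "T = max (max T0 T1) (max T2 T3) + amax"
    have T: "T \<ge> T0" "T - amax \<ge> T1" "T - amax \<ge> T2" "T \<ge> T3" using amax_pos by (auto simp: T_def)
    obtain i t where it: "i \<in> V" "t \<ge> T + Q" "t \<in> D i" "f i t > M - \<delta>"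
      using freq[OF \<delta>(1)] by blast
    have ubound: "u j t \<le> M + 2 * \<delta>" if "j \<in> V" "t \<in> D j" "T - amax \<le> t" for j t
      using T1[of t] T2[of j t] that T unfolding u_def by simp
    \<comment> \<open>The window ends at \<open>t - R\<close>, so every walk sought has length at
      least \<open>R\<close>, where approximation is available; its length \<open>amax\<close> is
      what the comparison principle asks for.\<close>
    have window: "M - \<eta> \<le> \<nu> j x" if j: "j \<in> V" and x: "x \<in> D j" "t - R - amax \<le> x" "x \<le> t - R" for j x
    proof -
      obtain \<pi> where \<pi>: "awalk i \<pi> j" using walk_exists[OF it(1) j] by blast
      obtain \<gamma> where \<gamma>: "awalk i \<gamma> j" "t - x \<le> len \<gamma>" "len \<gamma> \<le> t - x + \<epsilon>"
        using R(2)[OF \<pi> Ddiff[OF it(3) x(1) \<pi>]] x by auto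
      have \<gamma>a: "set \<gamma> \<subseteq> arcs G" using \<gamma>(1) by blast
      have lQ: "len \<gamma> \<le> Q" using \<gamma>(3) x unfolding Q_def by simp
      define z where "z = t - len \<gamma>"
      have zT: "z \<ge> T" using lQ it(2) unfolding z_def by simp
      have wq: "weight \<gamma> \<ge> q" by (rule q(3)[OF \<gamma>a lQ])
      have "u i t \<le> weight \<gamma> * u j z + (1 - weight \<gamma>) * (M + 2 * \<delta>)"
        unfolding z_def
        by (rule walk_inequality[of D T u, OF Dstep])
          (use usub T ubound \<gamma> it zT in \<open>auto simp: z_def\<close>)
      moreover have "u i t > M - \<delta>" using it(4) rest0[of t] by (simp add: u_def)
      ultimately have "weight \<gamma> * (M + 2 * \<delta> - u j z) \<le> 3 * \<delta>" by (simp add: algebra_simps)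
      hence "M + 2 * \<delta> - u j z \<le> 3 * \<delta> / weight \<gamma>"
        using wq q(1) by (simp add: field_simps)
      also have "\<dots> \<le> 3 * \<delta> / q" using wq q(1) \<delta>(1) by (intro divide_left_mono) auto
      finally have "u j z \<ge> M + 2 * \<delta> - 3 * \<eta> / 10" using \<delta>(2) by simp
      moreover have "rest z \<le> \<delta>" using T1[of z] zT T(2) amax_pos by simp
      ultimately have fz: "f j z \<ge> M - 3 * \<eta> / 10" using \<delta>(1) unfolding u_def by simp
      have fx: "f j x \<ge> exp (- s * \<epsilon>) * f j z"
      proof -
        have "exp (- s * \<epsilon>) * f j z \<le> exp (- s * (x - z)) * f j z"
          using \<gamma>(3) s f0[OF j] unfolding z_def by (intro mult_right_mono) (auto intro!: mult_left_mono)
        also have "\<dots> \<le> f j x" using reg[OF j, of "x - z" z] \<gamma>(2) unfolding z_def by simp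
        finally show ?thesis .
      qed
      have "f j x \<ge> M - \<eta> / 2 - 3 * \<eta> / 10"
      proof (cases "M - 3 * \<eta> / 10 \<ge> 0")
        case True
        have e1: "exp (- s * \<epsilon>) \<le> 1" using s \<epsilon> by simp
        have "M - \<eta> / 2 - 3 * \<eta> / 10 \<le> exp (- s * \<epsilon>) * M - exp (- s * \<epsilon>) * (3 * \<eta> / 10)"
        proof -
          have "exp (- s * \<epsilon>) * (3 * \<eta> / 10) \<le> 3 * \<eta> / 10"
            using mult_right_mono[OF e1, of "3 * \<eta> / 10"] \<eta> by simp
          thus ?thesis using M\<epsilon> by linarith
        qed
        also have "\<dots> = exp (- s * \<epsilon>) * (M - 3 * \<eta> / 10)" by (simp add: right_diff_distrib)
        also have "\<dots> \<le> exp (- s * \<epsilon>) * f j z" using fz by (intro mult_left_mono) auto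
        finally show ?thesis using fx by simp
      next
        \<comment> \<open>Here the claimed lower bound is negative and \<open>f \<ge> 0\<close>
          suffices.\<close>
        case False
        thus ?thesis using f0[OF j, of x] \<eta> by simp
      qed
      moreover have "x \<ge> T3" using x(2) it(2) T(4) \<epsilon> unfolding Q_def by simp
      hence "f j x - \<nu> j x < \<delta>" using T3[OF j] by blast
      ultimately show ?thesis using \<delta>(3) \<eta> by linarith
    qed
    have "- \<nu> j x \<le> - (M - \<eta>)" if "j \<in> V" "x \<in> D j" "t - R - amax \<le> x" for j x
    proof (rule maximum_principle[of D "t - R" "\<lambda>j x. - \<nu> j x", OF Dstep])
      show "- \<nu> j x \<le> (\<Sum>e\<in>E j. p e * - \<nu> (head G e) (x - a e))" if "j \<in> V" for j x
        using super[OF that, of x] by (simp add: sum_negf)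
      show "- \<nu> j x \<le> - (M - \<eta>)" if "j \<in> V" "x \<in> D j" "t - R - amax \<le> x" "x < t - R" for j x
        using window[of j x] that by simp
    qed (use that in auto)
    hence "M - \<eta> \<le> f j x" if "j \<in> V" "x \<in> D j" "t - R - amax \<le> x" for j x
      using that \<nu>f[of j x] by fastforce
    thus ?thesis by blast
  qed
  have "(f i0 \<longlongrightarrow> M) (inf at_top (principal {t. t - y \<in> H}))"
  proof (rule tendstoI)
    fix \<eta> :: real assume "\<eta> > 0"
    hence \<eta>: "\<eta> / 2 > 0" by simp
    obtain T1 where T1: "\<And>j t. j \<in> V \<Longrightarrow> t \<ge> T1 \<Longrightarrow> t \<in> D j \<Longrightarrow> f j t \<le> M + \<eta> / 2"
      using upper[OF \<eta>] by blast
    obtain T2 where T2: "\<And>j t. j \<in> V \<Longrightarrow> t \<ge> T2 \<Longrightarrow> t \<in> D j \<Longrightarrow> M - \<eta> / 2 \<le> f j t"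
      using lower[OF \<eta>] by blast
    have "dist (f i0 t) M < \<eta>" if "t \<ge> max T1 T2" "t - y \<in> H" for t
      using T1[OF i0, of t] T2[OF i0, of t] D0[OF that(2)] that(1) \<open>\<eta> > 0\<close> by (simp add: dist_real_def)
    thus "\<forall>\<^sub>F t in inf at_top (principal {t. t - y \<in> H}). dist (f i0 t) M < \<eta>"
      unfolding eventually_inf_principal eventually_at_top_linorder by blast
  qed
  thus ?thesis by blast
qed

end

section \<open>Covering numbers of the attractor\<close>

text \<open>Regularity, \<open>g (t + x) \<ge> exp (- s x) g t\<close>, bounds \<open>g t\<close> by its integral over \<open>[t, t + c]\<close>.\<close>

lemma integrable_regular_tail:
  fixes g :: "real \<Rightarrow> real"
  assumes meas: "g \<in> borel_measurable borel" and g0: "\<And>t. g t \<ge> 0" and s: "s \<ge> 0" and c: "c > 0"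
    and reg: "\<And>t x. x \<ge> 0 \<Longrightarrow> exp (- s * x) * g t \<le> g (t + x)"
    and fin: "(\<integral>\<^sup>+t\<in>{0..}. ennreal (g t) \<partial>lborel) < \<infinity>"
  obtains rest :: "real \<Rightarrow> real" where "\<And>t. rest t \<ge> 0" "(rest \<longlongrightarrow> 0) at_top"
    "\<And>t b. t \<ge> 0 \<Longrightarrow> b \<ge> c \<Longrightarrow> g t + rest t \<le> rest (t - b)"
proof -
  define h where "h t = indicator {0..} t * g t" for t
  have hm: "h \<in> borel_measurable lborel" unfolding h_def using meas by measurable
  have h0: "h t \<ge> 0" for t unfolding h_def using g0 by simp
  have int: "integrable lborel h"
  proof (rule integrableI_nonneg[OF hm])
    have "(\<integral>\<^sup>+t. ennreal (h t) \<partial>lborel) = (\<integral>\<^sup>+t\<in>{0..}. ennreal (g t) \<partial>lborel)"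
      by (rule nn_integral_cong) (simp add: h_def indicator_def)
    thus "(\<integral>\<^sup>+t. ennreal (h t) \<partial>lborel) < \<infinity>" using fin by simp
  qed (use h0 in simp)
  have intS: "integrable lborel (\<lambda>x. indicator A x * h x)" if "A \<in> sets borel" for A
    using integrable_real_mult_indicator[of A lborel h] int that by (simp add: mult.commute)
  define J where "J t = (\<integral>x. indicator {t..} x * h x \<partial>lborel)" for t
  have J0: "J t \<ge> 0" for t unfolding J_def using h0 by (intro integral_nonneg_AE) auto
  have Janti: "J t \<le> J t'" if "t' \<le> t" for t t'
    unfolding J_def using h0 that by (intro integral_mono intS) (auto simp: indicator_def)
  have Jlim: "(J \<longlongrightarrow> 0) at_top"
  proof -
    have "((\<lambda>t. \<integral>x. indicator {t..} x * h x \<partial>lborel) \<longlongrightarrow> (\<integral>x. 0 \<partial>(lborel :: real measure))) at_top"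
    proof (rule integral_dominated_convergence_at_top[where w = h])
      show "\<forall>\<^sub>F i in at_top. AE x in lborel. norm (indicator {i..} x * h x) \<le> h x"
        using h0 by (intro always_eventually) (auto simp: indicator_def)
      show "AE x in lborel. ((\<lambda>i. indicator {i..} x * h x) \<longlongrightarrow> 0) at_top"
      proof (rule AE_I2)
        fix x :: real
        have "\<forall>\<^sub>F i in at_top. indicator {i..} x * h x = 0"
          using eventually_gt_at_top[of x] by eventually_elim (simp add: indicator_def)
        thus "((\<lambda>i. indicator {i..} x * h x) \<longlongrightarrow> 0) at_top" by (rule tendsto_eventually)
      qed
    qed (use hm int in auto)
    thus ?thesis unfolding J_def by simp
  qed
  have key: "c * exp (- s * c) * g t \<le> J t - J (t + c)" if t: "t \<ge> 0" for t
  proof -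
    have "J t - J (t + c) = (\<integral>x. indicator {t..} x * h x - indicator {t+c..} x * h x \<partial>lborel)"
      unfolding J_def by (intro Bochner_Integration.integral_diff[symmetric] intS) auto
    also have "\<dots> = (\<integral>x. indicator {t..<t+c} x * h x \<partial>lborel)"
      by (rule Bochner_Integration.integral_cong) (use c in \<open>auto simp: indicator_def\<close>)
    also have "\<dots> \<ge> (\<integral>x. indicator {t..<t+c} x * (exp (- s * c) * g t) \<partial>lborel)"
    proof (rule integral_mono[OF _ intS])
      fix x
      show "indicator {t..<t+c} x * (exp (- s * c) * g t) \<le> indicator {t..<t+c} x * h x"
      proof (cases "x \<in> {t..<t+c}")
        case True
        have "exp (- s * c) * g t \<le> exp (- s * (x - t)) * g t"
          using True s g0 by (intro mult_right_mono) (auto intro!: mult_left_mono)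
        also have "\<dots> \<le> g x" using reg[of "x - t" t] True by simp
        also have "\<dots> = h x" using True t by (simp add: h_def)
        finally show ?thesis using True by simp
      qed simp
    qed (use c in auto)
    also have "(\<integral>x. indicator {t..<t+c} x * (exp (- s * c) * g t) \<partial>lborel) = c * (exp (- s * c) * g t)"
      using c by simp
    finally show ?thesis by simp
  qed
  \<comment> \<open>Normalizes the factor \<open>c * exp (- s * c)\<close> of the integral bound to
    1.\<close>
  define \<kappa> where "\<kappa> = exp (s * c) / c"
  have \<kappa>: "\<kappa> > 0" unfolding \<kappa>_def using c by simp
  \<comment> \<open>The shift by \<open>c\<close> makes \<open>rest (t - b)\<close> at least
    \<open>\<kappa> * J t\<close> for every \<open>b \<ge> c\<close>, so that its excess over
    \<open>rest t\<close> contains the whole integral over \<open>[t, t + c]\<close>.\<close>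
  define rest where "rest t = \<kappa> * J (t + c)" for t
  show thesis
  proof (rule that[of rest])
    show "rest t \<ge> 0" for t unfolding rest_def using \<kappa> J0 by simp
    have "filterlim (\<lambda>t. t + c) at_top at_top"
      using filterlim_tendsto_add_at_top[OF tendsto_const filterlim_ident, of c] by (simp add: add.commute)
    hence "((\<lambda>t. \<kappa> * J (t + c)) \<longlongrightarrow> \<kappa> * 0) at_top"
      by (intro tendsto_mult tendsto_const filterlim_compose[OF Jlim])
    thus "(rest \<longlongrightarrow> 0) at_top" unfolding rest_def by simp
    fix t b :: real assume tb: "t \<ge> 0" "b \<ge> c"
    have "\<kappa> * (c * exp (- s * c) * g t) = (exp (s * c) * exp (- s * c)) * g t"
      unfolding \<kappa>_def using c by simp
    also have "\<dots> = g t" by (simp flip: exp_add)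
    finally have "g t = \<kappa> * (c * exp (- s * c) * g t)" by simp
    also have "\<dots> \<le> \<kappa> * (J t - J (t + c))" using \<kappa> by (intro mult_left_mono key[OF tb(1)]) simp
    also have "\<dots> \<le> \<kappa> * (J (t - b + c) - J (t + c))"
      using Janti[of "t - b + c" t] tb(2) \<kappa> by (intro mult_left_mono) auto
    finally show "g t + rest t \<le> rest (t - b)" unfolding rest_def by (simp add: algebra_simps)
  qed
qed

lemma infdist_Compl_gt_mem:
  assumes "infdist x (- W) > d" "dist x y \<le> d"
  shows "y \<in> W"
proof (rule ccontr)
  assume "y \<notin> W"
  hence "infdist x (- W) \<le> dist x y" by (intro infdist_le) simp
  thus False using assms by simp
qed

text \<open>Collects the witnesses of the open set condition, the global extensions \<open>T\<close>
  of the edge maps and a positive eigenvector \<open>w\<close> for the exponent \<open>s\<close>;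
  that \<open>s\<close> is the critical exponent enters when the locale is instantiated.\<close>

locale sosc_graph = inhomogeneous_mw_graph G X S r C
  for G :: "('v, 'e) pre_digraph"
    and X :: "'v \<Rightarrow> 'a::euclidean_space set"
    and S :: "'e \<Rightarrow> 'a \<Rightarrow> 'a"
    and r :: "'e \<Rightarrow> real"
    and C :: "'v \<Rightarrow> 'a set" +
  fixes U :: "'v \<Rightarrow> 'a set" and T :: "'e \<Rightarrow> 'a \<Rightarrow> 'a" and w :: "'v \<Rightarrow> real" and s :: real
  assumes sc: "mw_strongly_connected G"
    and U_bounded: "i \<in> verts G \<Longrightarrow> bounded (U i)"
    and U_open: "i \<in> verts G \<Longrightarrow> open (U i)"
    and U_subset: "i \<in> verts G \<Longrightarrow> U i \<subseteq> X i"
    and U_maps: "e \<in> arcs G \<Longrightarrow> S e ` U (head G e) \<subseteq> U (tail G e)"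
    and U_disjoint: "e \<in> arcs G \<Longrightarrow> e' \<in> arcs G \<Longrightarrow> tail G e = tail G e' \<Longrightarrow> e \<noteq> e' \<Longrightarrow>
      S e ` U (head G e) \<inter> S e' ` U (head G e') = {}"
    and U_attractor: "i \<in> verts G \<Longrightarrow> U i \<inter> homogeneous_attractor G X S i \<noteq> {}"
    and T_similarity: "e \<in> arcs G \<Longrightarrow> similarity (r e) (T e)"
    and T_eq_S: "e \<in> arcs G \<Longrightarrow> x \<in> X (head G e) \<Longrightarrow> T e x = S e x"
    and s_nonneg: "s \<ge> 0"
    and w_pos: "i \<in> verts G \<Longrightarrow> w i > 0"
    and w_eigen: "i \<in> verts G \<Longrightarrow> (\<Sum>e\<in>out_arcs G i. r e powr s * w (head G e)) = w i"
    and C_integrable: "i \<in> verts G \<Longrightarrow>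
      (\<integral>\<^sup>+t\<in>{0..}. ennreal (exp (- s * t) * real (covering_number (exp (- t)) (C i))) \<partial>lborel) < \<infinity>"
begin

abbreviation "K \<equiv> inhomogeneous_attractor G X S C"

sublocale markov_renewal G "\<lambda>e. r e powr s * w (head G e) / w (tail G e)" "\<lambda>e. - ln (r e)"
proof unfold_locales
  show "mw_strongly_connected G" by (rule sc)
  show "V \<noteq> {}" by (rule verts_nonempty)
  show "0 < r e powr s * w (head G e) / w (tail G e)" if e: "e \<in> arcs G" for e
    using w_pos[of "head G e"] w_pos[of "tail G e"] ratio_pos[OF e] e by simp
  show "0 < - ln (r e)" if e: "e \<in> arcs G" for e
    using ratio_pos[OF e] ratio_less_1[OF e] by simp
  show "(\<Sum>e\<in>E i. r e powr s * w (head G e) / w (tail G e)) = 1" if i: "i \<in> V" for i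
  proof -
    have "(\<Sum>e\<in>E i. r e powr s * w (head G e) / w (tail G e))
      = (\<Sum>e\<in>E i. r e powr s * w (head G e) / w i)"
      by (rule sum.cong) auto
    also have "\<dots> = 1" using w_eigen[OF i] w_pos[OF i] by (simp flip: sum_divide_distrib)
    finally show ?thesis .
  qed
qed

text \<open>Names for the two parameters of the sublocale. Facts inherited from
  \<open>markov_renewal\<close> show these parameters written out, which is why \<open>p_def\<close>
  and \<open>a_def\<close> are unfolded at the interface.\<close>

definition "p e = r e powr s * w (head G e) / w (tail G e)"
definition "a e = - ln (r e)"

abbreviation N :: "real \<Rightarrow> 'a set \<Rightarrow> real" where
  "N t A \<equiv> real (covering_number (exp (- t)) A)"

definition normalized :: "'v \<Rightarrow> real \<Rightarrow> 'a set \<Rightarrow> real" where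
  "normalized i t A = exp (- s * t) * N t A / w i"

text \<open>A covering ball has diameter \<open>2 * exp (- t)\<close>, so one that meets the core
  lies entirely in \<open>U i\<close>.\<close>

definition core :: "'v \<Rightarrow> real \<Rightarrow> 'a set" where
  "core i t = {x\<in>K i. infdist x (- U i) > 2 * exp (- t)}"

text \<open>The set \<open>W\<close> is left free because passing to a piece replaces it by its
  preimage under \<open>T e\<close>, which may be larger than \<open>U (head G e)\<close>.\<close>

definition layer :: "'a set \<Rightarrow> 'v \<Rightarrow> real \<Rightarrow> 'a set" where
  "layer W i t = {x\<in>K i. infdist x (- W) \<le> 2 * exp (- t)}"

lemmas K_props = attractor[OF sc]

lemma bounded_K: "i \<in> V \<Longrightarrow> bounded (K i)"
  using K_props(2) by (rule compact_imp_bounded)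

lemma bounded_C: "i \<in> V \<Longrightarrow> bounded (C i)"
  using C_compact by (rule compact_imp_bounded)

lemma Compl_U_ne: "i \<in> V \<Longrightarrow> - U i \<noteq> {}"
  using U_bounded not_bounded_UNIV by (metis Compl_empty_eq double_compl)

lemma S_image_eq: "e \<in> arcs G \<Longrightarrow> B \<subseteq> X (head G e) \<Longrightarrow> S e ` B = T e ` B"
  using T_eq_S by (intro image_cong) auto

lemma normalized_nonneg: "i \<in> V \<Longrightarrow> normalized i t A \<ge> 0"
  unfolding normalized_def using w_pos[of i] by simp

lemma normalized_mono:
  "i \<in> V \<Longrightarrow> A \<subseteq> B \<Longrightarrow> bounded B \<Longrightarrow> normalized i t A \<le> normalized i t B"
  unfolding normalized_def using covering_number_mono[of A B "exp (- t)" "exp (- t)"] w_pos[of i]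
  by (intro divide_right_mono mult_left_mono) auto

text \<open>The delay \<open>a e\<close> turns scaling by \<open>r e\<close> into a time shift, and
  the factor \<open>r e powr s\<close> left behind combines with the weights \<open>w\<close> to
  \<open>p e\<close>.\<close>

lemma normalized_S:
  assumes e: "e \<in> arcs G" and B: "B \<subseteq> X (head G e)"
  shows "normalized (tail G e) t (S e ` B) = p e * normalized (head G e) (t - a e) B"
proof -
  have bB: "bounded B" using bounded_subset[OF compact_imp_bounded[OF X_compact] B] e by simp
  have r: "exp (- t) = r e * exp (- (t - a e))"
    unfolding a_def using ratio_pos[OF e] by (simp add: exp_diff exp_minus exp_add field_simps)
  have "covering_number (exp (- t)) (S e ` B) = covering_number (exp (- (t - a e))) B"
    unfolding S_image_eq[OF assms] unfolding r
    by (rule covering_number_similarity[OF T_similarity[OF e] bB]) simp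
  moreover have "exp (- s * t) = r e powr s * exp (- s * (t - a e))"
    unfolding a_def using ratio_pos[OF e] by (simp add: powr_def algebra_simps flip: exp_add)
  moreover have "w (head G e) > 0" "w (tail G e) > 0" using w_pos e by auto
  ultimately show ?thesis unfolding normalized_def p_def by simp
qed

text \<open>The pieces \<open>B e\<close> are arbitrary so that the same estimate serves
  \<open>K\<close> and its layers.\<close>

lemma normalized_cover:
  assumes i: "i \<in> V" and A: "A \<subseteq> C i \<union> (\<Union>e\<in>E i. S e ` B e)"
    and B: "\<And>e. e \<in> E i \<Longrightarrow> B e \<subseteq> X (head G e)"
  shows "normalized i t A \<le> normalized i t (C i) + (\<Sum>e\<in>E i. p e * normalized (head G e) (t - a e) (B e))"
proof -
  have bd: "bounded (S e ` B e)" if e: "e \<in> E i" for e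
  proof -
    have e': "e \<in> arcs G" using e by simp
    have "bounded (B e)" using bounded_subset[OF compact_imp_bounded[OF X_compact] B[OF e]] e by simp
    thus ?thesis unfolding S_image_eq[OF e' B[OF e]] by (rule bounded_similarity_image[OF T_similarity[OF e']])
  qed
  have bU: "bounded (\<Union>e\<in>E i. S e ` B e)" using bd by (intro bounded_UN) auto
  have "covering_number (exp (- t)) A \<le> covering_number (exp (- t)) (C i \<union> (\<Union>e\<in>E i. S e ` B e))"
    by (rule covering_number_mono[OF A]) (use bounded_C[OF i] bU in auto)
  also have "\<dots> \<le> covering_number (exp (- t)) (C i) + covering_number (exp (- t)) (\<Union>e\<in>E i. S e ` B e)"
    by (rule covering_number_Un[OF bounded_C[OF i] bU]) simp
  also have "covering_number (exp (- t)) (\<Union>e\<in>E i. S e ` B e)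
      \<le> (\<Sum>e\<in>E i. covering_number (exp (- t)) (S e ` B e))"
    by (rule covering_number_UN) (use bd in auto)
  finally have "N t A \<le> N t (C i)
      + (\<Sum>e\<in>E i. N t (S e ` B e))"
    by (simp flip: of_nat_sum of_nat_add)
  hence "normalized i t A \<le> exp (- s * t) * (N t (C i)
      + (\<Sum>e\<in>E i. N t (S e ` B e))) / w i"
    unfolding normalized_def using w_pos[OF i] by (intro divide_right_mono mult_left_mono) auto
  also have "\<dots> = normalized i t (C i) + (\<Sum>e\<in>E i. normalized i t (S e ` B e))"
    unfolding normalized_def by (simp add: algebra_simps add_divide_distrib sum_distrib_left sum_divide_distrib)
  also have "(\<Sum>e\<in>E i. normalized i t (S e ` B e)) =
      (\<Sum>e\<in>E i. p e * normalized (head G e) (t - a e) (B e))"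
  proof (rule sum.cong[OF refl])
    fix e assume e: "e \<in> E i"
    thus "normalized i t (S e ` B e) = p e * normalized (head G e) (t - a e) (B e)"
      using normalized_S[OF _ B[OF e]] by auto
  qed
  finally show ?thesis .
qed

lemma K_decomp:
  assumes "i \<in> V"
  shows "K i \<subseteq> C i \<union> (\<Union>e\<in>E i. S e ` K (head G e))"
  using K_props(4)[OF assms] by simp

lemma normalized_regular:
  assumes "i \<in> V" "bounded A" "x \<ge> 0"
  shows "exp (- s * x) * normalized i t A \<le> normalized i (t + x) A"
proof -
  have "covering_number (exp (- t)) A \<le> covering_number (exp (- (t + x))) A"
    by (rule covering_number_mono) (use assms in auto)
  hence "exp (- s * (t + x)) * N t A / w i
      \<le> exp (- s * (t + x)) * real (covering_number (exp (- (t + x))) A) / w i"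
    using w_pos[OF assms(1)] by (intro divide_right_mono mult_left_mono) auto
  moreover have "exp (- s * (t + x)) = exp (- s * x) * exp (- s * t)"
    by (simp add: algebra_simps flip: exp_add)
  ultimately show ?thesis unfolding normalized_def by (simp add: mult.assoc)
qed

text \<open>An edge map carries the core at the earlier time to points deeper than
  \<open>2 * exp (- t)\<close> inside the image of \<open>U (head G e)\<close>. Images belonging to
  different edges lie in disjoint sets and are therefore too far apart for a common ball, and
  \<open>U_maps\<close> puts them into the core at \<open>i\<close>.\<close>

lemma core_superadditive:
  assumes i: "i \<in> V"
  shows "(\<Sum>e\<in>E i. p e * normalized (head G e) (t - a e) (core (head G e) (t - a e)))
    \<le> normalized i t (core i t)"
proof -
  define B where "B e = S e ` core (head G e) (t - a e)" for e
  have subX: "core (head G e) (t - a e) \<subseteq> X (head G e)" if "e \<in> E i" for e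
    using K_props(3)[of "head G e"] that unfolding core_def by auto
  have dist_gt: "infdist x (- S e ` U (head G e)) > 2 * exp (- t)" if e: "e \<in> E i" and x: "x \<in> B e" for e x
  proof -
    have e': "e \<in> arcs G" "head G e \<in> V" using e by auto
    obtain z where z: "z \<in> core (head G e) (t - a e)" "x = S e z" using x unfolding B_def by blast
    have "x = T e z" using z subX[OF e] T_eq_S[OF e'(1)] by auto
    hence "infdist x (- S e ` U (head G e)) = r e * infdist z (- U (head G e))"
      unfolding S_image_eq[OF e'(1) U_subset[OF e'(2)]]
      by (simp add: infdist_Compl_similarity[OF T_similarity[OF e'(1)] Compl_U_ne[OF e'(2)]])
    also have "\<dots> > r e * (2 * exp (- (t - a e)))"
      using z(1) ratio_pos[OF e'(1)] unfolding core_def by (intro mult_strict_left_mono) auto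
    also have "r e * (2 * exp (- (t - a e))) = 2 * exp (- t)"
      unfolding a_def using ratio_pos[OF e'(1)] by (simp add: exp_diff exp_minus exp_add field_simps)
    finally show ?thesis by simp
  qed
  have BU: "B e \<subseteq> S e ` U (head G e)" if "e \<in> E i" for e
  proof
    fix x assume "x \<in> B e"
    from infdist_Compl_gt_mem[OF dist_gt[OF that this], of x] show "x \<in> S e ` U (head G e)" by simp
  qed
  have Bcore: "B e \<subseteq> core i t" if e: "e \<in> E i" for e
  proof
    fix x assume x: "x \<in> B e"
    hence "x \<in> S e ` K (head G e)" unfolding B_def core_def by blast
    hence xK: "x \<in> K i" using K_props(4)[OF i] e by blast
    have "- U i \<subseteq> - S e ` U (head G e)" using U_maps[of e] e by auto
    from infdist_mono[OF this Compl_U_ne[OF i], of x] dist_gt[OF e x]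
    show "x \<in> core i t" using xK unfolding core_def by simp
  qed
  have "(\<Sum>e\<in>E i. covering_number (exp (- t)) (B e)) \<le> covering_number (exp (- t)) (core i t)"
  proof (rule sum_covering_number_le)
    show "bounded (core i t)" by (rule bounded_subset[OF bounded_K[OF i]]) (auto simp: core_def)
    fix e e' x y assume e: "e \<in> E i" "e' \<in> E i" "e \<noteq> e'" and xy: "x \<in> B e" "y \<in> B e'"
    show "2 * exp (- t) < dist x y"
    proof (rule ccontr)
      assume "\<not> 2 * exp (- t) < dist x y"
      hence "y \<in> S e ` U (head G e)" using infdist_Compl_gt_mem[OF dist_gt[OF e(1) xy(1)], of y] by simp
      moreover have "y \<in> S e' ` U (head G e')" using BU[OF e(2)] xy(2) by blast
      ultimately show False using U_disjoint[of e e'] e by auto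
    qed
  qed (use Bcore in \<open>simp_all only: finite_out_arcs exp_gt_zero\<close>)
  hence "(\<Sum>e\<in>E i. N t (B e)) \<le> N t (core i t)"
    by (simp flip: of_nat_sum)
  hence "exp (- s * t) * (\<Sum>e\<in>E i. N t (B e)) / w i \<le> normalized i t (core i t)"
    unfolding normalized_def using w_pos[OF i] by (intro divide_right_mono mult_left_mono) auto
  also have "exp (- s * t) * (\<Sum>e\<in>E i. N t (B e)) / w i
      = (\<Sum>e\<in>E i. normalized i t (B e))"
    unfolding normalized_def by (simp add: sum_distrib_left sum_divide_distrib)
  also have "\<dots> = (\<Sum>e\<in>E i. p e * normalized (head G e) (t - a e) (core (head G e) (t - a e)))"
  proof (rule sum.cong[OF refl])
    fix e assume e: "e \<in> E i"
    thus "normalized i t (B e) = p e * normalized (head G e) (t - a e) (core (head G e) (t - a e))"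
      using normalized_S[OF _ subX[OF e]] unfolding B_def by auto
  qed
  finally show ?thesis .
qed

end

lemma eventually_exp_uminus_less:
  assumes "\<eta> > 0"
  shows "\<forall>\<^sub>F t::real in at_top. 2 * exp (- t) < \<eta>"
proof -
  have "((\<lambda>t::real. exp (- t)) \<longlongrightarrow> 0) at_top"
    by (rule filterlim_compose[OF exp_at_bot filterlim_uminus_at_bot_at_top])
  from order_tendstoD(2)[OF this, of "\<eta> / 2"] assms show ?thesis by (simp add: mult.commute)
qed

lemma filterlim_minus_const_at_top: "filterlim (\<lambda>t::real. t - b) at_top at_top"
  using filterlim_tendsto_add_at_top[OF tendsto_const filterlim_ident, of "- b"] by simp

section \<open>The contribution of the inhomogeneous sets\<close>

context sosc_graph
begin

lemma infdist_Compl_U_pos: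
  assumes "i \<in> V" "x \<in> U i"
  shows "infdist x (- U i) > 0"
  using infdist_pos_not_in_closed[OF closed_Compl[OF U_open] Compl_U_ne] assms by blast

text \<open>Summing over the vertices gives one function \<open>rest\<close> for all of them, and
  the shortest delay \<open>amin\<close> makes the decrease valid along every edge.\<close>

lemma C_remainder:
  obtains rest :: "real \<Rightarrow> real" where "\<And>t. rest t \<ge> 0" "(rest \<longlongrightarrow> 0) at_top"
    "\<And>i t b. i \<in> V \<Longrightarrow> t \<ge> 0 \<Longrightarrow> b \<ge> amin \<Longrightarrow> normalized i t (C i) + rest t \<le> rest (t - b)"
proof -
  define g where "g t = (\<Sum>i\<in>V. normalized i t (C i))" for t
  have meas: "(\<lambda>t. normalized i t (C i)) \<in> borel_measurable borel" if i: "i \<in> V" for i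
  proof -
    \<comment> \<open>Monotonicity in \<open>t\<close> is what provides measurability.\<close>
    have "mono (\<lambda>t. N t (C i))"
      by (rule monoI) (use covering_number_mono[OF order_refl bounded_C[OF i]] in auto)
    hence "(\<lambda>t. N t (C i)) \<in> borel_measurable borel"
      by (rule borel_measurable_mono)
    thus ?thesis unfolding normalized_def by measurable
  qed
  have fin: "(\<integral>\<^sup>+t\<in>{0..}. ennreal (normalized i t (C i)) \<partial>lborel) < \<infinity>" if i: "i \<in> V" for i
  proof -
    have "(\<integral>\<^sup>+t\<in>{0..}. ennreal (normalized i t (C i)) \<partial>lborel) =
      (\<integral>\<^sup>+t. ennreal (1 / w i) * (ennreal (exp (- s * t) * N t (C i)) * indicator {0..} t) \<partial>lborel)"
      unfolding normalized_def using w_pos[OF i]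
      by (intro nn_integral_cong) (simp add: ennreal_mult[symmetric] mult.assoc[symmetric])
    also have "\<dots> = ennreal (1 / w i) * (\<integral>\<^sup>+t\<in>{0..}. ennreal (exp (- s * t) * N t (C i)) \<partial>lborel)"
    proof (rule nn_integral_cmult)
      have "(\<lambda>t. w i * normalized i t (C i)) \<in> borel_measurable borel"
        using meas[OF i] by measurable
      hence "(\<lambda>t. exp (- s * t) * N t (C i)) \<in> borel_measurable borel"
        unfolding normalized_def using w_pos[OF i] by simp
      thus "(\<lambda>t. ennreal (exp (- s * t) * N t (C i)) * indicator {0..} t)
        \<in> borel_measurable lborel" by measurable
    qed
    also have "\<dots> < \<infinity>" using C_integrable[OF i] by (simp add: ennreal_mult_less_top)
    finally show ?thesis .
  qed
  have g0: "g t \<ge> 0" for t unfolding g_def by (intro sum_nonneg normalized_nonneg)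
  show thesis
  proof (rule integrable_regular_tail[of g s amin])
    show "g \<in> borel_measurable borel" unfolding g_def using meas by (intro borel_measurable_sum)
    show "0 \<le> s" by (rule s_nonneg)
    show "0 < amin" by (rule amin_pos)
    show "0 \<le> g t" for t by (rule g0)
    show "exp (- s * x) * g t \<le> g (t + x)" if "x \<ge> 0" for t x
      unfolding g_def sum_distrib_left by (intro sum_mono normalized_regular bounded_C that)
    have "(\<integral>\<^sup>+t\<in>{0..}. ennreal (g t) \<partial>lborel) =
        (\<integral>\<^sup>+t. (\<Sum>i\<in>V. ennreal (normalized i t (C i)) * indicator {0..} t) \<partial>lborel)"
      unfolding g_def
      by (intro nn_integral_cong) (simp add: sum_ennreal normalized_nonneg sum_distrib_right[symmetric])
    also have "\<dots> = (\<Sum>i\<in>V. (\<integral>\<^sup>+t\<in>{0..}. ennreal (normalized i t (C i)) \<partial>lborel))"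
      by (rule nn_integral_sum) (use meas in measurable)
    also have "\<dots> < \<infinity>" using fin by simp
    finally show "(\<integral>\<^sup>+t\<in>{0..}. ennreal (g t) \<partial>lborel) < \<infinity>" .
    fix rest :: "real \<Rightarrow> real"
    assume rest: "\<And>t. 0 \<le> rest t" "(rest \<longlongrightarrow> 0) at_top"
      "\<And>t b. 0 \<le> t \<Longrightarrow> amin \<le> b \<Longrightarrow> g t + rest t \<le> rest (t - b)"
    show thesis
    proof (rule that[OF rest(1,2)])
      fix i and t b :: real
      assume itb: "i \<in> V" "t \<ge> 0" "b \<ge> amin"
      have "normalized i t (C i) \<le> g t"
        unfolding g_def by (rule member_le_sum) (use itb normalized_nonneg in auto)
      thus "normalized i t (C i) + rest t \<le> rest (t - b)" using rest(3)[OF itb(2,3)] by linarith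
    qed
  qed
qed

lemma p_sum': "i \<in> V \<Longrightarrow> (\<Sum>e\<in>E i. p e) = 1"
  using p_sum unfolding p_def .

lemma p_nonneg: "e \<in> arcs G \<Longrightarrow> p e \<ge> 0"
  using p_pos unfolding p_def by (rule less_imp_le)

lemma a_ge: "e \<in> arcs G \<Longrightarrow> amin \<le> a e"
  using amin_le unfolding a_def .

text \<open>As the \<open>p e\<close> sum to 1, the term from \<open>C\<close> together with
  \<open>rest t\<close> can be distributed over the edges, where \<open>rest (t - a e)\<close>
  dominates it.\<close>

lemma K_subsolution:
  assumes rest: "\<And>i t b. i \<in> V \<Longrightarrow> t \<ge> 0 \<Longrightarrow> b \<ge> amin \<Longrightarrow> normalized i t (C i) + rest t \<le> rest (t - b)"
    and i: "i \<in> V" and t: "t \<ge> 0"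
  shows "normalized i t (K i) + rest t \<le>
    (\<Sum>e\<in>E i. p e * (normalized (head G e) (t - a e) (K (head G e)) + rest (t - a e)))"
proof -
  have "normalized i t (K i) \<le> normalized i t (C i)
      + (\<Sum>e\<in>E i. p e * normalized (head G e) (t - a e) (K (head G e)))"
    by (rule normalized_cover[OF i K_decomp[OF i]]) (auto intro: K_props(3)[THEN subsetD])
  moreover have "(\<Sum>e\<in>E i. p e * (normalized i t (C i) + rest t)) \<le> (\<Sum>e\<in>E i. p e * rest (t - a e))"
    by (intro sum_mono mult_left_mono rest i t) (auto intro: p_nonneg a_ge)
  moreover have "(\<Sum>e\<in>E i. p e * (normalized i t (C i) + rest t)) = normalized i t (C i) + rest t"
    using p_sum'[OF i] by (simp flip: sum_distrib_right)
  ultimately show ?thesis by (simp add: distrib_left sum.distrib)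
qed

text \<open>An integrable function need not decay; here the decay comes from domination by
  \<open>rest (t - amin)\<close>.\<close>

lemma normalized_C_tendsto_0:
  assumes i: "i \<in> V"
  shows "((\<lambda>t. normalized i t (C i)) \<longlongrightarrow> 0) at_top"
proof -
  obtain rest :: "real \<Rightarrow> real" where rest: "\<And>t. rest t \<ge> 0" "(rest \<longlongrightarrow> 0) at_top"
    "\<And>i t b. i \<in> V \<Longrightarrow> t \<ge> 0 \<Longrightarrow> b \<ge> amin \<Longrightarrow> normalized i t (C i) + rest t \<le> rest (t - b)"
    using C_remainder by blast
  have lim: "((\<lambda>t. rest (t - amin)) \<longlongrightarrow> 0) at_top"
    by (rule filterlim_compose[OF rest(2) filterlim_minus_const_at_top])
  show ?thesis
  proof (rule tendsto_sandwich[OF _ _ tendsto_const lim])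
    show "\<forall>\<^sub>F t in at_top. 0 \<le> normalized i t (C i)" using normalized_nonneg[OF i] by simp
    show "\<forall>\<^sub>F t in at_top. normalized i t (C i) \<le> rest (t - amin)"
      using eventually_ge_at_top[of 0]
    proof eventually_elim
      case (elim t)
      show ?case using rest(3)[OF i elim, of amin] rest(1)[of t] by simp
    qed
  qed
qed

section \<open>Decay of the boundary layers\<close>

lemma bounded_layer: "i \<in> V \<Longrightarrow> bounded (layer W i t)"
  by (rule bounded_subset[OF bounded_K]) (auto simp: layer_def)

lemma layer_subset_X: "i \<in> V \<Longrightarrow> layer W i t \<subseteq> X i"
  using K_props(3) by (auto simp: layer_def)

lemma infdist_T:
  assumes e: "e \<in> arcs G" and W: "- W \<noteq> {}"
  shows "infdist (T e x) (- W) = r e * infdist x (- (T e -` W))"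
proof -
  note bij = similarityD(2)[OF T_similarity[OF e]]
  have "T e ` (T e -` W) = W" using bij by (rule surj_image_vimage_eq)
  moreover have "- (T e -` W) \<noteq> {}"
  proof -
    obtain y where "y \<notin> W" using W by blast
    moreover obtain z where "y = T e z" using bij by blast
    ultimately show ?thesis by blast
  qed
  ultimately show ?thesis using infdist_Compl_similarity[OF T_similarity[OF e], of "T e -` W" x] by simp
qed

text \<open>Pulling a point back through \<open>T e\<close> divides its distance to the complement
  of \<open>W\<close> by \<open>r e\<close>, which is exactly the change of scale from
  \<open>t\<close> to \<open>t - a e\<close>.\<close>

lemma layer_step:
  assumes i: "i \<in> V" and W: "- W \<noteq> {}"
  shows "layer W i t \<subseteq> C i \<union> (\<Union>e\<in>E i. S e ` layer (T e -` W) (head G e) (t - a e))"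
proof
  fix x assume x: "x \<in> layer W i t"
  show "x \<in> C i \<union> (\<Union>e\<in>E i. S e ` layer (T e -` W) (head G e) (t - a e))"
  proof (cases "x \<in> C i")
    case False
    moreover have "x \<in> K i" using x by (simp add: layer_def)
    ultimately obtain e z where e: "e \<in> E i" "z \<in> K (head G e)" "x = S e z"
      using K_decomp[OF i] by blast
    hence e': "e \<in> arcs G" "head G e \<in> V" by auto
    have "x = T e z" using T_eq_S[OF e'(1)] K_props(3)[OF e'(2)] e(2,3) by auto
    hence "r e * infdist z (- (T e -` W)) \<le> 2 * exp (- t)"
      using x infdist_T[OF e'(1) W] by (simp add: layer_def)
    also have "2 * exp (- t) = r e * (2 * exp (- (t - a e)))"
      unfolding a_def using ratio_pos[OF e'(1)] by (simp add: exp_diff exp_minus exp_add field_simps)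
    finally have "infdist z (- (T e -` W)) \<le> 2 * exp (- (t - a e))"
      using ratio_pos[OF e'(1)] by (simp only: mult_le_cancel_left_pos)
    hence "z \<in> layer (T e -` W) (head G e) (t - a e)" using e(2) by (simp add: layer_def)
    thus ?thesis using e(1,3) by blast
  qed simp
qed

text \<open>Encodes that the upper limit is at most \<open>b\<close>; the slack \<epsilon> makes the
  infimum of such bounds again a bound.\<close>

definition layer_bound :: "'v \<Rightarrow> 'a set \<Rightarrow> real \<Rightarrow> bool" where
  "layer_bound i W b \<longleftrightarrow> (\<forall>\<epsilon>>0. \<forall>\<^sub>F t in at_top. normalized i t (layer W i t) \<le> b + \<epsilon>)"

text \<open>A larger set has a smaller complement, hence a thinner layer.\<close>

lemma layer_bound_antimono:
  assumes "layer_bound i W b" "W \<subseteq> W'" "- W' \<noteq> {}" "i \<in> V"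
  shows "layer_bound i W' b"
  unfolding layer_bound_def
proof (intro allI impI)
  fix \<epsilon> :: real assume "\<epsilon> > 0"
  hence "\<forall>\<^sub>F t in at_top. normalized i t (layer W i t) \<le> b + \<epsilon>" using assms(1) unfolding layer_bound_def by blast
  thus "\<forall>\<^sub>F t in at_top. normalized i t (layer W' i t) \<le> b + \<epsilon>"
  proof eventually_elim
    case (elim t)
    have "- W' \<subseteq> - W" using assms(2) by blast
    hence "layer W' i t \<subseteq> layer W i t"
      using infdist_mono[OF _ assms(3), of "- W"] unfolding layer_def by (auto intro: order_trans)
    from normalized_mono[OF assms(4) this bounded_layer[OF assms(4)], of t] elim show ?case by simp
  qed
qed

text \<open>In the limit the term from \<open>C\<close> disappears, so the bounds average with the
  probabilities \<open>p\<close> alone; the slack is split evenly between that term and the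
  pieces.\<close>

lemma layer_bound_step:
  assumes i: "i \<in> V" and W: "- W \<noteq> {}"
    and b: "\<And>e. e \<in> E i \<Longrightarrow> layer_bound (head G e) (T e -` W) (b e)"
  shows "layer_bound i W (\<Sum>e\<in>E i. p e * b e)"
  unfolding layer_bound_def
proof (intro allI impI)
  fix \<epsilon> :: real assume \<epsilon>: "\<epsilon> > 0"
  have "\<forall>\<^sub>F t in at_top. normalized (head G e) (t - a e) (layer (T e -` W) (head G e) (t - a e)) \<le> b e + \<epsilon> / 2"
    if e: "e \<in> E i" for e
  proof -
    have "\<forall>\<^sub>F t in at_top. normalized (head G e) t (layer (T e -` W) (head G e) t) \<le> b e + \<epsilon> / 2"
      using b[OF e] \<epsilon> unfolding layer_bound_def by (meson half_gt_zero)
    thus ?thesis by (rule eventually_compose_filterlim[OF _ filterlim_minus_const_at_top])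
  qed
  hence "\<forall>\<^sub>F t in at_top. \<forall>e\<in>E i.
      normalized (head G e) (t - a e) (layer (T e -` W) (head G e) (t - a e)) \<le> b e + \<epsilon> / 2"
    by (intro eventually_ball_finite finite_out_arcs ballI)
  moreover have "\<forall>\<^sub>F t in at_top. normalized i t (C i) < \<epsilon> / 2"
    using order_tendstoD(2)[OF normalized_C_tendsto_0[OF i], of "\<epsilon> / 2"] \<epsilon> by simp
  ultimately show "\<forall>\<^sub>F t in at_top. normalized i t (layer W i t) \<le> (\<Sum>e\<in>E i. p e * b e) + \<epsilon>"
  proof eventually_elim
    case (elim t)
    have "normalized i t (layer W i t) \<le> normalized i t (C i) + (\<Sum>e\<in>E i. p e *
        normalized (head G e) (t - a e) (layer (T e -` W) (head G e) (t - a e)))"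
      by (rule normalized_cover[OF i layer_step[OF i W]], rule layer_subset_X) auto
    also have "(\<Sum>e\<in>E i. p e * normalized (head G e) (t - a e) (layer (T e -` W) (head G e) (t - a e)))
        \<le> (\<Sum>e\<in>E i. p e * (b e + \<epsilon> / 2))"
      by (intro sum_mono mult_left_mono) (use elim p_nonneg in auto)
    also have "\<dots> = (\<Sum>e\<in>E i. p e * b e) + \<epsilon> / 2"
      unfolding distrib_left sum.distrib sum_distrib_right[symmetric] p_sum'[OF i] by simp
    finally show ?case using elim by simp
  qed
qed

primrec walk_map :: "'e list \<Rightarrow> 'a \<Rightarrow> 'a" where
  "walk_map [] x = x"
| "walk_map (e # \<gamma>) x = T e (walk_map \<gamma> x)"

text \<open>Pieces \<open>S_\<gamma> (X j)\<close> inside \<open>W\<close> stay away from the layer along the complement of \<open>W\<close>, so they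
  do not contribute to its covering number.\<close>

lemma layer_bound_walk:
  assumes B: "\<And>k. k \<in> V \<Longrightarrow> layer_bound k (U k) B"
    and "awalk i \<gamma> j" "U i \<subseteq> W" "- W \<noteq> {}" "\<eta> > 0"
    and "\<And>z. z \<in> X j \<Longrightarrow> \<eta> \<le> infdist (walk_map \<gamma> z) (- W)"
  shows "layer_bound i W (B - weight \<gamma> * B)"
  using assms(2-)
proof (induction \<gamma> arbitrary: i W \<eta>)
  case Nil
  hence ij: "i = j" "j \<in> V" by (auto simp: awalk_Nil_iff)
  note ev = eventually_exp_uminus_less[OF Nil.prems(4)]
  show ?case
    unfolding layer_bound_def
  proof (intro allI impI)
    fix \<epsilon> :: real assume "\<epsilon> > 0"
    show "\<forall>\<^sub>F t in at_top. normalized i t (layer W i t) \<le> B - weight [] * B + \<epsilon>"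
      using ev
    proof eventually_elim
      case (elim t)
      have "layer W i t = {}"
      proof (rule equals0I)
        fix x assume "x \<in> layer W i t"
        hence "x \<in> X j" "infdist x (- W) \<le> 2 * exp (- t)"
          using K_props(3)[OF ij(2)] ij(1) by (auto simp: layer_def)
        thus False using Nil.prems(5)[of x] elim by simp
      qed
      thus ?case using \<open>\<epsilon> > 0\<close> by (simp add: normalized_def)
    qed
  qed
next
  case (Cons e \<gamma>)
  hence e: "e \<in> E i" "e \<in> arcs G" "tail G e = i" "awalk (head G e) \<gamma> j"
    by (auto simp: awalk_Cons_iff)
  have i: "i \<in> V" using e tail_in_verts by blast
  have sub: "U (head G e') \<subseteq> T e' -` W" "- (T e' -` W) \<noteq> {}" if e': "e' \<in> E i" for e'
  proof -
    have "e' \<in> arcs G" "tail G e' = i" using e' by auto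
    hence "T e' ` U (head G e') \<subseteq> W"
      using U_maps[of e'] S_image_eq[of e' "U (head G e')"] U_subset[of "head G e'"] Cons.prems(2) by auto
    thus "U (head G e') \<subseteq> T e' -` W" by blast
    obtain y where "y \<notin> W" using Cons.prems(3) by blast
    moreover obtain z where "y = T e' z" using similarityD(2)[OF T_similarity[OF \<open>e' \<in> arcs G\<close>]] by blast
    ultimately show "- (T e' -` W) \<noteq> {}" by blast
  qed
  \<comment> \<open>Only the branch along the walk gains. The others keep \<open>B\<close>, since
    the preimage of \<open>W\<close> contains the open set at the head and its layer is
    thinner.\<close>
  define b where "b e' = (if e' = e then B - weight \<gamma> * B else B)" for e'
  have "layer_bound i W (\<Sum>e\<in>E i. p e * b e)"
  proof (rule layer_bound_step[OF i Cons.prems(3)])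
    fix e' assume e': "e' \<in> E i"
    show "layer_bound (head G e') (T e' -` W) (b e')"
    proof (cases "e' = e")
      case True
      have "layer_bound (head G e) (T e -` W) (B - weight \<gamma> * B)"
      proof (rule Cons.IH[OF e(4) sub[OF e(1)], of "\<eta> / r e"])
        show "\<eta> / r e > 0" using Cons.prems(4) ratio_pos[OF e(2)] by simp
        fix z assume "z \<in> X j"
        hence "\<eta> \<le> r e * infdist (walk_map \<gamma> z) (- (T e -` W))"
          using Cons.prems(5) infdist_T[OF e(2) Cons.prems(3)] by simp
        thus "\<eta> / r e \<le> infdist (walk_map \<gamma> z) (- (T e -` W))"
          using ratio_pos[OF e(2)] by (simp add: field_simps)
      qed
      thus ?thesis using True by (simp add: b_def)
    next
      case False
      have h: "head G e' \<in> V" using e' by auto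
      have "layer_bound (head G e') (T e' -` W) B"
        by (rule layer_bound_antimono[OF B[OF h] sub[OF e'] h])
      thus ?thesis using False by (simp add: b_def)
    qed
  qed
  moreover have "(\<Sum>e\<in>E i. p e * b e) = B - weight (e # \<gamma>) * B"
  proof -
    have "(\<Sum>e'\<in>E i. p e' * b e') = (\<Sum>e'\<in>E i. p e' * B - (if e' = e then p e * (weight \<gamma> * B) else 0))"
      by (rule sum.cong) (auto simp: b_def algebra_simps)
    also have "\<dots> = B - p e * (weight \<gamma> * B)"
      unfolding sum_subtractf sum_distrib_right[symmetric] p_sum'[OF i] sum.delta[OF finite_out_arcs]
      using e(1) by simp
    finally show ?thesis by (simp add: p_def)
  qed
  ultimately show ?case by simp
qed

lemma dist_walk_map:
  assumes \<rho>: "0 < \<rho>" "\<And>e. e \<in> arcs G \<Longrightarrow> r e \<le> \<rho>" and "set \<gamma> \<subseteq> arcs G"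
  shows "dist (walk_map \<gamma> x) (walk_map \<gamma> y) \<le> \<rho> ^ length \<gamma> * dist x y"
  using assms(3)
proof (induction \<gamma>)
  case (Cons e \<gamma>)
  hence e: "e \<in> arcs G" by simp
  have "dist (walk_map (e # \<gamma>) x) (walk_map (e # \<gamma>) y) = r e * dist (walk_map \<gamma> x) (walk_map \<gamma> y)"
    using similarityD(3)[OF T_similarity[OF e]] by simp
  also have "\<dots> \<le> \<rho> * (\<rho> ^ length \<gamma> * dist x y)"
    using Cons \<rho> ratio_pos[OF e] by (intro mult_mono) auto
  finally show ?case by simp
qed simp

text \<open>Unfolds the equation of the homogeneous attractor \<open>n\<close> times; as no sets
  \<open>C\<close> interrupt the unfolding, every point has an address of each length.\<close>

lemma homogeneous_attractor_coding:
  assumes "i \<in> V" "x \<in> homogeneous_attractor G X S i"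
  shows "\<exists>\<gamma> j z. awalk i \<gamma> j \<and> length \<gamma> = n \<and> z \<in> homogeneous_attractor G X S j \<and> x = walk_map \<gamma> z"
  using assms
proof (induction n arbitrary: i x)
  case 0
  thus ?case by (intro exI[of _ "[]"]) (auto simp: awalk_Nil_iff)
next
  case (Suc n)
  interpret h: inhomogeneous_mw_graph G X S r "\<lambda>_. {}"
    by unfold_locales auto
  obtain e y where e: "e \<in> E i" "y \<in> homogeneous_attractor G X S (head G e)" "x = S e y"
    using h.attractor(4)[OF sc Suc.prems(1)] Suc.prems(2) by blast
  hence e': "e \<in> arcs G" "tail G e = i" "head G e \<in> V" by auto
  obtain \<gamma> j z where \<gamma>: "awalk (head G e) \<gamma> j" "length \<gamma> = n" "z \<in> homogeneous_attractor G X S j" "y = walk_map \<gamma> z"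
    using Suc.IH[OF e'(3) e(2)] by blast
  have "x = T e y" using T_eq_S[OF e'(1)] h.attractor(3)[OF sc e'(3)] e(2,3) by auto
  hence "x = walk_map (e # \<gamma>) z" using \<gamma>(4) by simp
  moreover have "awalk i (e # \<gamma>) j" using \<gamma>(1) e' by (auto simp: awalk_Cons_iff)
  ultimately show ?case using \<gamma>(2,3) by (metis length_Cons)
qed

text \<open>A point of the homogeneous attractor in \<open>U i\<close> has positive distance to the
  complement. A long enough address confines it to a piece of diameter below half that distance, so
  the whole piece keeps the other half.\<close>

lemma interior_walk:
  assumes i: "i \<in> V"
  obtains \<gamma> j \<eta> where "awalk i \<gamma> j" "\<eta> > 0" "\<And>z. z \<in> X j \<Longrightarrow> \<eta> \<le> infdist (walk_map \<gamma> z) (- U i)"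
proof -
  obtain x where x: "x \<in> U i" "x \<in> homogeneous_attractor G X S i" using U_attractor[OF i] by blast
  define \<eta> where "\<eta> = infdist x (- U i) / 2"
  have \<eta>: "\<eta> > 0" using infdist_Compl_U_pos[OF i x(1)] by (simp add: \<eta>_def)
  obtain \<rho> where \<rho>: "0 < \<rho>" "\<rho> < 1" "\<And>e. e \<in> arcs G \<Longrightarrow> r e \<le> \<rho>" using max_ratio by blast
  obtain D where D: "D > 0" "\<And>i x y. i \<in> V \<Longrightarrow> x \<in> X i \<Longrightarrow> y \<in> X i \<Longrightarrow> dist x y \<le> D"
    using X_diameter by blast
  obtain n where "\<rho> ^ n < \<eta> / D" using real_arch_pow_inv[of "\<eta> / D" \<rho>] \<rho> D(1) \<eta> by auto
  hence n: "\<rho> ^ n * D < \<eta>" using D(1) by (simp add: field_simps)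
  obtain \<gamma> j z where \<gamma>: "awalk i \<gamma> j" "length \<gamma> = n" "z \<in> homogeneous_attractor G X S j" "x = walk_map \<gamma> z"
    using homogeneous_attractor_coding[OF i x(2), of n] by blast
  have j: "j \<in> V" using awalk_last_in_verts[OF \<gamma>(1)] .
  have zX: "z \<in> X j" using homogeneous_attractor_subset[OF sc j] K_props(3)[OF j] \<gamma>(3) by blast
  show thesis
  proof (rule that[OF \<gamma>(1) \<eta>])
    fix y assume y: "y \<in> X j"
    have "dist x (walk_map \<gamma> y) \<le> \<rho> ^ n * dist z y"
      using dist_walk_map[OF \<rho>(1,3), of \<gamma> z y] \<gamma>(1,2,4) by auto
    also have "\<dots> \<le> \<rho> ^ n * D" using D(2)[OF j zX y] \<rho>(1) by (intro mult_left_mono) auto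
    finally have "dist x (walk_map \<gamma> y) < \<eta>" using n by simp
    moreover have "infdist x (- U i) \<le> infdist (walk_map \<gamma> y) (- U i) + dist x (walk_map \<gamma> y)"
      by (rule infdist_triangle)
    ultimately show "\<eta> \<le> infdist (walk_map \<gamma> y) (- U i)" by (simp add: \<eta>_def)
  qed
qed

lemma K_bounded:
  "\<exists>B t0. \<forall>i\<in>V. \<forall>t\<ge>t0. normalized i t (K i) \<le> B"
proof -
  obtain rest :: "real \<Rightarrow> real" where rest: "\<And>t. rest t \<ge> 0" "(rest \<longlongrightarrow> 0) at_top"
    "\<And>i t b. i \<in> V \<Longrightarrow> t \<ge> 0 \<Longrightarrow> b \<ge> amin \<Longrightarrow> normalized i t (C i) + rest t \<le> rest (t - b)"
    using C_remainder by blast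
  show ?thesis
  proof (rule subsolution_bounded[OF s_nonneg _ _ _ rest(1,2), of "\<lambda>i t. normalized i t (K i)" 0])
    show "0 \<le> normalized i t (K i)" if "i \<in> V" for i t by (rule normalized_nonneg[OF that])
    show "exp (- s * x) * normalized i t (K i) \<le> normalized i (t + x) (K i)"
      if "i \<in> V" "0 \<le> x" for i t x by (rule normalized_regular[OF that(1) bounded_K that(2)]) fact
  qed (use K_subsolution[OF rest(3)] in \<open>simp add: p_def a_def\<close>)
qed

text \<open>Let \<open>B\<close> be the best common bound for the upper limits at all vertices. A
  walk whose piece lies well inside \<open>U k\<close> improves \<open>B\<close> at \<open>k\<close>
  to \<open>B - c * B\<close> with \<open>c > 0\<close>; doing so at every vertex contradicts
  minimality unless \<open>B = 0\<close>.\<close>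

lemma layer_tendsto_0:
  assumes i: "i \<in> V"
  shows "((\<lambda>t. normalized i t (layer (U i) i t)) \<longlongrightarrow> 0) at_top"
proof -
  define Z where "Z = {b. b \<ge> 0 \<and> (\<forall>k\<in>V. layer_bound k (U k) b)}"
  have Zne: "Z \<noteq> {}"
  proof -
    obtain B t0 where B: "\<And>i t. i \<in> V \<Longrightarrow> t \<ge> t0 \<Longrightarrow> normalized i t (K i) \<le> B"
      using K_bounded by blast
    have "B \<ge> 0" using B[OF i, of t0] normalized_nonneg[OF i, of t0 "K i"] by simp
    moreover have "layer_bound k (U k) B" if k: "k \<in> V" for k
      unfolding layer_bound_def
    proof (intro allI impI)
      fix \<epsilon> :: real assume \<epsilon>: "\<epsilon> > 0"
      show "\<forall>\<^sub>F t in at_top. normalized k t (layer (U k) k t) \<le> B + \<epsilon>"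
        using eventually_ge_at_top[of t0]
      proof eventually_elim
        case (elim t)
        have "normalized k t (layer (U k) k t) \<le> normalized k t (K k)"
          by (rule normalized_mono[OF k _ bounded_K[OF k]]) (auto simp: layer_def)
        thus ?case using B[OF k elim] \<epsilon> by simp
      qed
    qed
    ultimately show ?thesis unfolding Z_def by blast
  qed
  have Zb: "bdd_below Z" by (rule bdd_belowI[of _ 0]) (simp add: Z_def)
  define B where "B = Inf Z"
  have B0: "B \<ge> 0" unfolding B_def by (rule cInf_greatest[OF Zne]) (simp add: Z_def)
  have BZ: "layer_bound k (U k) B" if k: "k \<in> V" for k
    unfolding layer_bound_def
  proof (intro allI impI)
    fix \<epsilon> :: real assume \<epsilon>: "\<epsilon> > 0"
    then obtain b where b: "b \<in> Z" "b < B + \<epsilon> / 2" using cInf_lessD[OF Zne, of "B + \<epsilon> / 2"] unfolding B_def by auto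
    have "layer_bound k (U k) b" using b(1) k unfolding Z_def by blast
    moreover have "\<epsilon> / 2 > 0" using \<epsilon> by simp
    ultimately have "\<forall>\<^sub>F t in at_top. normalized k t (layer (U k) k t) \<le> b + \<epsilon> / 2"
      unfolding layer_bound_def by blast
    thus "\<forall>\<^sub>F t in at_top. normalized k t (layer (U k) k t) \<le> B + \<epsilon>"
      by eventually_elim (use b(2) in simp)
  qed
  have "\<exists>c>0. c \<le> 1 \<and> layer_bound k (U k) (B - c * B)" if k: "k \<in> V" for k
  proof -
    obtain \<gamma> j \<eta> where \<gamma>: "awalk k \<gamma> j" "\<eta> > 0" "\<And>z. z \<in> X j \<Longrightarrow> \<eta> \<le> infdist (walk_map \<gamma> z) (- U k)"
      using interior_walk[OF k] by blast
    have "set \<gamma> \<subseteq> arcs G" using \<gamma>(1) by blast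
    thus ?thesis
      using layer_bound_walk[OF BZ \<gamma>(1) order_refl Compl_U_ne[OF k] \<gamma>(2,3)] weight_pos weight_le_1 by blast
  qed
  then obtain c where c: "\<And>k. k \<in> V \<Longrightarrow> c k > 0 \<and> c k \<le> 1 \<and> layer_bound k (U k) (B - c k * B)" by metis
  \<comment> \<open>The smallest of the finitely many gains is available at every vertex.\<close>
  define c0 where "c0 = Min (c ` V)"
  have c0: "c0 > 0" "\<And>k. k \<in> V \<Longrightarrow> c0 \<le> c k"
    unfolding c0_def using c verts_nonempty by (auto simp: Min_gr_iff)
  have c01: "c0 \<le> 1" using c0(2)[OF i] c[OF i] by simp
  have "B - c0 * B \<in> Z"
    unfolding Z_def
  proof (intro CollectI conjI ballI)
    show "0 \<le> B - c0 * B" using mult_right_mono[OF c01 B0] by simp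
    fix k assume k: "k \<in> V"
    have le: "B - c k * B \<le> B - c0 * B" using mult_right_mono[OF c0(2)[OF k] B0] by simp
    show "layer_bound k (U k) (B - c0 * B)"
      unfolding layer_bound_def
    proof (intro allI impI)
      fix \<epsilon> :: real assume "\<epsilon> > 0"
      hence "\<forall>\<^sub>F t in at_top. normalized k t (layer (U k) k t) \<le> B - c k * B + \<epsilon>"
        using c[OF k] unfolding layer_bound_def by blast
      thus "\<forall>\<^sub>F t in at_top. normalized k t (layer (U k) k t) \<le> B - c0 * B + \<epsilon>"
        by eventually_elim (use le in simp)
    qed
  qed
  hence "B \<le> B - c0 * B" unfolding B_def by (rule cInf_lower[OF _ Zb])
  hence "c0 * B \<le> 0" by simp
  hence "B = 0" using c0(1) B0 by (simp add: mult_le_0_iff)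
  hence small: "\<forall>\<^sub>F t in at_top. normalized i t (layer (U i) i t) \<le> \<epsilon>" if "\<epsilon> > 0" for \<epsilon>
    using BZ[OF i] that unfolding layer_bound_def by simp
  show ?thesis
  proof (rule tendstoI)
    fix \<epsilon> :: real assume "\<epsilon> > 0"
    hence "\<forall>\<^sub>F t in at_top. normalized i t (layer (U i) i t) \<le> \<epsilon> / 2" by (intro small) simp
    thus "\<forall>\<^sub>F t in at_top. dist (normalized i t (layer (U i) i t)) 0 < \<epsilon>"
      by eventually_elim (use normalized_nonneg[OF i] \<open>\<epsilon> > 0\<close> in \<open>simp add: dist_real_def\<close>)
  qed
qed

text \<open>Core and layer of \<open>U i\<close> together make up \<open>K i\<close>, so the
  difference is at most the contribution of the layer.\<close>

lemma K_minus_core_tendsto_0: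
  assumes i: "i \<in> V"
  shows "((\<lambda>t. normalized i t (K i) - normalized i t (core i t)) \<longlongrightarrow> 0) at_top"
proof (rule tendsto_sandwich[OF _ _ tendsto_const layer_tendsto_0[OF i]])
  have core: "core i t \<subseteq> K i" for t by (auto simp: core_def)
  show "\<forall>\<^sub>F t in at_top. 0 \<le> normalized i t (K i) - normalized i t (core i t)"
    using normalized_mono[OF i core bounded_K[OF i]] by simp
  have "normalized i t (K i) \<le> normalized i t (core i t) + normalized i t (layer (U i) i t)" for t
  proof -
    have "K i = core i t \<union> layer (U i) i t" by (auto simp: core_def layer_def)
    hence "covering_number (exp (- t)) (K i) \<le> covering_number (exp (- t)) (core i t) + covering_number (exp (- t)) (layer (U i) i t)"
      using covering_number_Un[OF bounded_subset[OF bounded_K[OF i] core] bounded_layer[OF i], of "exp (- t)"] by simp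
    hence "exp (- s * t) * N t (K i) / w i \<le> exp (- s * t) *
        (N t (core i t) + N t (layer (U i) i t)) / w i"
      using w_pos[OF i] by (intro divide_right_mono mult_left_mono) (auto simp flip: of_nat_add)
    thus ?thesis unfolding normalized_def by (simp add: distrib_left add_divide_distrib)
  qed
  thus "\<forall>\<^sub>F t in at_top. normalized i t (K i) - normalized i t (core i t) \<le> normalized i t (layer (U i) i t)"
    by (simp add: algebra_simps)
qed

text \<open>Once \<open>exp (- t)\<close> is small, each core contains a point of the homogeneous
  attractor and takes at least one ball; the maximum principle for the negated normalized core
  preserves the resulting bound. This is what keeps the limits positive.\<close>

lemma core_lower_bound:
  obtains c t0 where "c > 0" "\<And>i t. i \<in> V \<Longrightarrow> t \<ge> t0 \<Longrightarrow> normalized i t (core i t) \<ge> c"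
proof -
  have "\<forall>\<^sub>F t in at_top. \<forall>i\<in>V. core i t \<noteq> {}"
  proof (intro eventually_ball_finite finite_verts ballI)
    fix i assume i: "i \<in> V"
    obtain x where x: "x \<in> U i" "x \<in> homogeneous_attractor G X S i" using U_attractor[OF i] by blast
    have xK: "x \<in> K i" using homogeneous_attractor_subset[OF sc i] x(2) by blast
    have "\<forall>\<^sub>F t in at_top. 2 * exp (- t) < infdist x (- U i)"
      by (rule eventually_exp_uminus_less[OF infdist_Compl_U_pos[OF i x(1)]])
    thus "\<forall>\<^sub>F t in at_top. core i t \<noteq> {}"
      by eventually_elim (use xK in \<open>auto simp: core_def\<close>)
  qed
  then obtain t1 where t1: "\<And>i t. i \<in> V \<Longrightarrow> t \<ge> t1 \<Longrightarrow> core i t \<noteq> {}"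
    unfolding eventually_at_top_linorder by blast
  define t2 where "t2 = t1 + amax"
  \<comment> \<open>On the window before \<open>t2\<close> the factor \<open>exp (- s * t)\<close>
    is at least its value at \<open>t2\<close>, and the sum of the weights dominates each
    \<open>w i\<close>.\<close>
  define c where "c = exp (- s * t2) / (\<Sum>i\<in>V. w i)"
  have sw: "(\<Sum>i\<in>V. w i) > 0" using verts_nonempty w_pos by (intro sum_pos) auto
  show thesis
  proof (rule that)
    show "c > 0" unfolding c_def using sw by simp
    fix i t assume i: "i \<in> V" and t: "t \<ge> t1"
    have "- normalized i t (core i t) \<le> - c"
    proof (rule maximum_principle[of "\<lambda>_. UNIV" t2 "\<lambda>i t. - normalized i t (core i t)"])
      show "- normalized j t (core j t) \<le> (\<Sum>e\<in>E j. r e powr s * w (head G e) / w (tail G e) *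
          - normalized (head G e) (t - - ln (r e)) (core (head G e) (t - - ln (r e))))" if "j \<in> V" for j t
        using core_superadditive[OF that, of t] unfolding p_def a_def by (simp add: sum_negf)
      show "- normalized j x (core j x) \<le> - c" if j: "j \<in> V" and x: "t2 - amax \<le> x" "x < t2" for j x
      proof -
        have "covering_number (exp (- x)) (core j x) \<ge> 1"
          by (rule covering_number_pos[OF bounded_subset[OF bounded_K[OF j]]])
            (use t1[OF j, of x] x in \<open>auto simp: core_def t2_def\<close>)
        hence "exp (- s * t2) * 1 \<le> exp (- s * x) * N x (core j x)"
          using x s_nonneg by (intro mult_mono) (auto intro!: mult_left_mono)
        hence "exp (- s * t2) / w j \<le> normalized j x (core j x)"
          unfolding normalized_def using w_pos[OF j] by (simp add: divide_right_mono)
        moreover have "c \<le> exp (- s * t2) / w j"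
          unfolding c_def using sw w_pos j by (intro divide_left_mono member_le_sum) (auto intro: less_imp_le)
        ultimately show ?thesis by simp
      qed
    qed (use i t in \<open>auto simp: t2_def\<close>)
    thus "normalized i t (core i t) \<ge> c" by simp
  qed
qed

end

section \<open>Limits along cosets of the cycle group\<close>

context sosc_graph
begin

text \<open>Logarithms turn products of ratios into sums of delays, so both groups have the same
  generators.\<close>

lemma H_eq_mw_group: "H = mw_group G r"
proof -
  have len: "len \<gamma> = - ln (path_ratio r \<gamma>) \<and> path_ratio r \<gamma> > 0" if "set \<gamma> \<subseteq> arcs G" for \<gamma>
    using that
  proof (induction \<gamma>)
    case (Cons e \<gamma>)
    hence "r e > 0" "path_ratio r \<gamma> > 0" "len \<gamma> = - ln (path_ratio r \<gamma>)" using ratio_pos by auto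
    moreover have "path_ratio r (e # \<gamma>) = r e * path_ratio r \<gamma>" by (simp add: path_ratio_def)
    ultimately show ?case by (simp add: ln_mult)
  qed (simp add: path_ratio_def)
  have "cycle_lengths i = (\<Union>n\<in>{1..}. (\<lambda>p. - ln (path_ratio r p)) ` paths_of_length G i i n)" for i
  proof (rule equalityI; rule subsetI)
    fix x assume "x \<in> cycle_lengths i"
    then obtain \<gamma> where \<gamma>: "awalk i \<gamma> i" "\<gamma> \<noteq> []" "x = len \<gamma>" unfolding cycle_lengths_def by blast
    hence "length \<gamma> \<in> {1..}" "\<gamma> \<in> paths_of_length G i i (length \<gamma>)" "x = - ln (path_ratio r \<gamma>)"
      using len[of \<gamma>] by (auto simp: paths_of_length_def Suc_le_eq)
    thus "x \<in> (\<Union>n\<in>{1..}. (\<lambda>p. - ln (path_ratio r p)) ` paths_of_length G i i n)" by blast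
  next
    fix x assume "x \<in> (\<Union>n\<in>{1..}. (\<lambda>p. - ln (path_ratio r p)) ` paths_of_length G i i n)"
    then obtain n \<gamma> where "n \<ge> 1" "\<gamma> \<in> paths_of_length G i i n" "x = - ln (path_ratio r \<gamma>)" by auto
    hence "awalk i \<gamma> i" "\<gamma> \<noteq> []" "x = len \<gamma>" using len[of \<gamma>] by (auto simp: paths_of_length_def)
    thus "x \<in> cycle_lengths i" unfolding cycle_lengths_def by blast
  qed
  thus ?thesis unfolding H_def mw_group_def by simp
qed

lemma positive_element_H: "\<exists>h\<in>H. h > 0"
proof -
  obtain i where i: "i \<in> V" using verts_nonempty by blast
  obtain x where x: "x \<in> cycle_lengths i" using cycle_lengths_semigroup(3)[OF i] by blast
  thus ?thesis using cycle_lengths_semigroup(2)[OF i x] cycle_in_H unfolding cycle_lengths_def by blast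
qed

text \<open>Convergence to infinity inside the coset \<open>y + H\<close>. For
  \<open>H = UNIV\<close> this is \<open>at_top\<close>, and for multiples of \<tau> the sequence
  \<open>n * \<tau> + y\<close> tends along it; one filter serves both cases.\<close>

definition coset_at_top :: "real \<Rightarrow> real filter" where
  "coset_at_top y = inf at_top (principal {t. t - y \<in> H})"

lemma coset_at_top_le: "coset_at_top y \<le> at_top"
  unfolding coset_at_top_def by (rule inf_le1)

lemma coset_at_top_neq_bot: "coset_at_top y \<noteq> bot"
proof
  assume "coset_at_top y = bot"
  hence "\<forall>\<^sub>F t in coset_at_top y. False" by simp
  then obtain N where N: "\<And>t. t \<ge> N \<Longrightarrow> t - y \<notin> H"
    unfolding coset_at_top_def eventually_inf_principal eventually_at_top_linorder by auto
  obtain h where h: "h \<in> H" "h > 0" using positive_element_H by blast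
  obtain n where n: "(N - y) / h < real n" using reals_Archimedean2 by blast
  have "of_int (int n) * h \<in> H" by (rule closed_real_subgroupD(6)[OF H_subgroup h(1)])
  moreover have "N \<le> y + real n * h" using n h(2) by (simp add: field_simps)
  ultimately show False using N[of "y + real n * h"] by simp
qed

lemma coset_at_top_shift: "\<tau> \<in> H \<Longrightarrow> coset_at_top (y + \<tau>) = coset_at_top y"
proof -
  assume \<tau>: "\<tau> \<in> H"
  have "t - (y + \<tau>) \<in> H \<longleftrightarrow> t - y \<in> H" for t
    using closed_real_subgroupD(3,5)[OF H_subgroup _ \<tau>, of "t - (y + \<tau>)"]
      closed_real_subgroupD(5)[OF H_subgroup _ \<tau>, of "t - y"] by (auto simp: algebra_simps)
  thus ?thesis unfolding coset_at_top_def by simp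
qed

text \<open>Dependence on \<open>y\<close> only through the filter makes periodicity automatic:
  shifting \<open>y\<close> by an element of \<open>H\<close> does not change the coset. The factor
  \<open>w i\<close> undoes the normalization.\<close>

definition limit :: "'v \<Rightarrow> real \<Rightarrow> real" where
  "limit i y = w i * Lim (coset_at_top y) (\<lambda>t. normalized i t (K i))"

lemma limit_shift: "\<tau> \<in> H \<Longrightarrow> limit i (y + \<tau>) = limit i y"
  unfolding limit_def by (simp add: coset_at_top_shift)

lemma covering_number_eq_normalized:
  "i \<in> V \<Longrightarrow> exp (- s * t) * N t A = w i * normalized i t A"
  unfolding normalized_def using w_pos[of i] by simp

lemma K_limit:
  assumes i: "i \<in> V"
  shows "((\<lambda>t. exp (- s * t) * N t (K i)) \<longlongrightarrow> limit i y) (coset_at_top y)"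
proof -
  obtain rest :: "real \<Rightarrow> real" where rest: "\<And>t. rest t \<ge> 0" "(rest \<longlongrightarrow> 0) at_top"
    "\<And>i t b. i \<in> V \<Longrightarrow> t \<ge> 0 \<Longrightarrow> b \<ge> amin \<Longrightarrow> normalized i t (C i) + rest t \<le> rest (t - b)"
    using C_remainder by blast
  have "\<exists>L. ((\<lambda>t. normalized i t (K i)) \<longlongrightarrow> L) (inf at_top (principal {t. t - y \<in> H}))"
  proof (rule renewal_limit[OF s_nonneg, where f = "\<lambda>i t. normalized i t (K i)" and \<nu> = "\<lambda>i t. normalized i t (core i t)"
        and rest = rest and ?T0.0 = 0])
    fix j t assume j: "j \<in> V"
    show "0 \<le> normalized j t (K j)" by (rule normalized_nonneg[OF j])
    show "exp (- s * x) * normalized j t (K j) \<le> normalized j (t + x) (K j)" if "0 \<le> x" for x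
      by (rule normalized_regular[OF j bounded_K[OF j] that])
    show "normalized j t (K j) + rest t \<le> (\<Sum>e\<in>E j. r e powr s * w (head G e) / w (tail G e) *
        (normalized (head G e) (t - - ln (r e)) (K (head G e)) + rest (t - - ln (r e))))" if "t \<ge> 0"
      using K_subsolution[OF rest(3) j that] unfolding p_def a_def by simp
    show "(\<Sum>e\<in>E j. r e powr s * w (head G e) / w (tail G e) *
        normalized (head G e) (t - - ln (r e)) (core (head G e) (t - - ln (r e)))) \<le> normalized j t (core j t)"
      using core_superadditive[OF j, of t] unfolding p_def a_def by simp
    show "normalized j t (core j t) \<le> normalized j t (K j)"
      by (rule normalized_mono[OF j _ bounded_K[OF j]]) (auto simp: core_def)
  qed (use rest(1,2) i K_minus_core_tendsto_0 in auto)
  then obtain L where L: "((\<lambda>t. normalized i t (K i)) \<longlongrightarrow> L) (coset_at_top y)"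
    unfolding coset_at_top_def by blast
  have "Lim (coset_at_top y) (\<lambda>t. normalized i t (K i)) = L"
    by (rule tendsto_Lim[OF coset_at_top_neq_bot L])
  hence "limit i y = w i * L" by (simp add: limit_def)
  moreover have "((\<lambda>t. w i * normalized i t (K i)) \<longlongrightarrow> w i * L) (coset_at_top y)"
    by (intro tendsto_mult tendsto_const L)
  ultimately show ?thesis by (simp only: covering_number_eq_normalized[OF i])
qed

lemma limit_lower_bound:
  obtains \<delta> where "\<delta> > 0" "\<And>i y. i \<in> V \<Longrightarrow> limit i y \<ge> \<delta>"
proof -
  obtain c t0 where c: "c > 0" "\<And>i t. i \<in> V \<Longrightarrow> t \<ge> t0 \<Longrightarrow> normalized i t (core i t) \<ge> c"
    using core_lower_bound by blast
  define m where "m = Min (w ` V)"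
  have m: "m > 0" "\<And>i. i \<in> V \<Longrightarrow> m \<le> w i"
    unfolding m_def using verts_nonempty w_pos by (auto simp: Min_gr_iff)
  have "limit i y \<ge> m * c" if i: "i \<in> V" for i y
  proof (rule tendsto_lowerbound[OF K_limit[OF i] _ coset_at_top_neq_bot])
    have "\<forall>\<^sub>F t in at_top. m * c \<le> exp (- s * t) * N t (K i)"
      using eventually_ge_at_top[of t0]
    proof eventually_elim
      case (elim t)
      have "c \<le> normalized i t (core i t)" by (rule c(2)[OF i elim])
      also have "\<dots> \<le> normalized i t (K i)"
        by (rule normalized_mono[OF i _ bounded_K[OF i]]) (auto simp: core_def)
      finally show ?case
        unfolding covering_number_eq_normalized[OF i] using m(1) m(2)[OF i] c(1) by (intro mult_mono) auto
    qed
    thus "\<forall>\<^sub>F t in coset_at_top y. m * c \<le> exp (- s * t) * N t (K i)"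
      by (rule filter_leD[OF coset_at_top_le])
  qed
  thus thesis using that[of "m * c"] m(1) c(1) by simp
qed

text \<open>Cores of distinct vertices lie deep in disjoint open sets, so no ball serves two of
  them. Their covering numbers add up to a lower bound, which has the same limit as the subadditive
  upper bound.\<close>

lemma union_limit:
  assumes disj: "\<And>i j. i \<in> V \<Longrightarrow> j \<in> V \<Longrightarrow> i \<noteq> j \<Longrightarrow> interior (X i) \<inter> interior (X j) = {}"
  shows "((\<lambda>t. exp (- s * t) * N t (\<Union>i\<in>V. K i))
    \<longlongrightarrow> (\<Sum>i\<in>V. limit i y)) (coset_at_top y)"
proof (rule tendsto_sandwich)
  let ?N = "\<lambda>t A. exp (- s * t) * N t A"
  show "((\<lambda>t. \<Sum>i\<in>V. ?N t (core i t)) \<longlongrightarrow> (\<Sum>i\<in>V. limit i y)) (coset_at_top y)"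
  proof (rule tendsto_sum)
    fix i assume i: "i \<in> V"
    have "((\<lambda>t. normalized i t (K i) - normalized i t (core i t)) \<longlongrightarrow> 0) (coset_at_top y)"
      by (rule tendsto_mono[OF coset_at_top_le K_minus_core_tendsto_0[OF i]])
    hence "((\<lambda>t. ?N t (K i) - w i * (normalized i t (K i) - normalized i t (core i t))) \<longlongrightarrow> limit i y - w i * 0) (coset_at_top y)"
      by (intro tendsto_diff tendsto_mult tendsto_const K_limit[OF i])
    moreover have "?N t (K i) - w i * (normalized i t (K i) - normalized i t (core i t)) = ?N t (core i t)" for t
      unfolding covering_number_eq_normalized[OF i] by (simp add: algebra_simps)
    ultimately show "((\<lambda>t. ?N t (core i t)) \<longlongrightarrow> limit i y) (coset_at_top y)" by (simp only: mult_zero_right diff_zero)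
  qed
  show "((\<lambda>t. \<Sum>i\<in>V. ?N t (K i)) \<longlongrightarrow> (\<Sum>i\<in>V. limit i y)) (coset_at_top y)"
    by (intro tendsto_sum K_limit)
  have bU: "bounded (\<Union>i\<in>V. K i)" using bounded_K by (intro bounded_UN) auto
  have "?N t (\<Union>i\<in>V. K i) \<le> (\<Sum>i\<in>V. ?N t (K i))" for t
  proof -
    have "covering_number (exp (- t)) (\<Union>i\<in>V. K i) \<le> (\<Sum>i\<in>V. covering_number (exp (- t)) (K i))"
      by (rule covering_number_UN) (use bounded_K in auto)
    hence "N t (\<Union>i\<in>V. K i) \<le> (\<Sum>i\<in>V. N t (K i))"
      by (simp flip: of_nat_sum)
    thus ?thesis unfolding sum_distrib_left[symmetric] by (intro mult_left_mono) auto
  qed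
  thus "\<forall>\<^sub>F t in coset_at_top y. ?N t (\<Union>i\<in>V. K i) \<le> (\<Sum>i\<in>V. ?N t (K i))" by simp
  have "(\<Sum>i\<in>V. ?N t (core i t)) \<le> ?N t (\<Union>i\<in>V. K i)" for t
  proof -
    have "(\<Sum>i\<in>V. covering_number (exp (- t)) (core i t)) \<le> covering_number (exp (- t)) (\<Union>i\<in>V. K i)"
    proof (rule sum_covering_number_le[OF finite_verts bU])
      show "core i t \<subseteq> (\<Union>i\<in>V. K i)" if "i \<in> V" for i using that unfolding core_def by blast
      fix i j x z assume ij: "i \<in> V" "j \<in> V" "i \<noteq> j" and xz: "x \<in> core i t" "z \<in> core j t"
      show "2 * exp (- t) < dist x z"
      proof (rule ccontr)
        assume "\<not> 2 * exp (- t) < dist x z"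
        hence "z \<in> U i" using xz(1) infdist_Compl_gt_mem[of "2 * exp (- t)" x "U i" z] by (simp add: core_def)
        moreover have "z \<in> U j" using xz(2) infdist_Compl_gt_mem[of "2 * exp (- t)" z "U j" z] by (simp add: core_def)
        moreover have "U k \<subseteq> interior (X k)" if "k \<in> V" for k
          by (rule interior_maximal[OF U_subset[OF that] U_open[OF that]])
        from this[OF ij(1)] this[OF ij(2)] have "U i \<inter> U j \<subseteq> {}" using disj[OF ij] by blast
        ultimately show False by blast
      qed
    qed simp
    hence "(\<Sum>i\<in>V. N t (core i t)) \<le> N t (\<Union>i\<in>V. K i)"
      by (simp flip: of_nat_sum)
    thus ?thesis unfolding sum_distrib_left[symmetric] by (intro mult_left_mono) auto
  qed
  thus "\<forall>\<^sub>F t in coset_at_top y. (\<Sum>i\<in>V. ?N t (core i t)) \<le> ?N t (\<Union>i\<in>V. K i)" by simp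
qed

end

section \<open>The dichotomy\<close>

lemma sosc_graph_exists:
  assumes "inhomogeneous_mw_graph G X S r C" and sc: "mw_strongly_connected G"
    and sosc: "strong_open_set_condition G X S C"
    and int: "\<forall>i\<in>verts G. (\<integral>\<^sup>+t\<in>{0..}. ennreal (exp (- critical_exponent G r * t) *
      real (covering_number (exp (- t)) (C i))) \<partial>lborel) < \<infinity>"
  shows "\<exists>U T w. sosc_graph G X S r C U T w (critical_exponent G r)"
proof -
  interpret inhomogeneous_mw_graph G X S r C by fact
  obtain U where U: "\<forall>i\<in>verts G.
    U i \<noteq> {} \<and> bounded (U i) \<and> open (U i) \<and> U i \<subseteq> X i \<and>
    (\<Union>e\<in>out_arcs G i. S e ` U (head G e)) \<subseteq> U i \<and>
    (\<forall>e\<in>out_arcs G i. \<forall>e'\<in>out_arcs G i. e \<noteq> e' \<longrightarrow>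
      S e ` U (head G e) \<inter> S e' ` U (head G e') = {}) \<and>
    U i \<inter> homogeneous_attractor G X S i \<noteq> {} \<and>
    C i \<subseteq> closure (U i)"
    using sosc unfolding strong_open_set_condition_def by blast
  obtain T where T: "\<And>e. e \<in> arcs G \<Longrightarrow> similarity (r e) (T e)"
    "\<And>e x. e \<in> arcs G \<Longrightarrow> x \<in> X (head G e) \<Longrightarrow> T e x = S e x"
    using similarity_family by blast
  obtain w where w: "critical_exponent G r \<ge> 0" "\<And>i. i \<in> verts G \<Longrightarrow> w i > 0"
    "\<And>i. i \<in> verts G \<Longrightarrow> (\<Sum>e\<in>out_arcs G i. r e powr critical_exponent G r * w (head G e)) = w i"
    using critical_exponent_eigenvector[OF sc] by blast
  have "sosc_graph G X S r C U T w (critical_exponent G r)"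
  proof (intro sosc_graph.intro sosc_graph_axioms.intro)
    show "inhomogeneous_mw_graph G X S r C" "mw_strongly_connected G" "0 \<le> critical_exponent G r"
      by (fact assms(1) sc w(1))+
    fix i assume i: "i \<in> verts G"
    show "bounded (U i)" "open (U i)" "U i \<subseteq> X i" "U i \<inter> homogeneous_attractor G X S i \<noteq> {}"
      using bspec[OF U i] by auto
    show "0 < w i" by (rule w(2)[OF i])
    show "(\<Sum>e\<in>out_arcs G i. r e powr critical_exponent G r * w (head G e)) = w i" by (rule w(3)[OF i])
    show "(\<integral>\<^sup>+t\<in>{0..}. ennreal (exp (- critical_exponent G r * t) *
      real (covering_number (exp (- t)) (C i))) \<partial>lborel) < \<infinity>"
      using int i by blast
  next
    fix e assume e: "e \<in> arcs G"
    hence oe: "e \<in> out_arcs G (tail G e)" and te: "tail G e \<in> verts G" by auto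
    show "S e ` U (head G e) \<subseteq> U (tail G e)" using U oe te by blast
    show "similarity (r e) (T e)" by (rule T(1)[OF e])
    show "T e x = S e x" if "x \<in> X (head G e)" for x by (rule T(2)[OF e that])
    fix e' assume e': "e' \<in> arcs G" "tail G e = tail G e'" "e \<noteq> e'"
    hence "e' \<in> out_arcs G (tail G e)" by simp
    thus "S e ` U (head G e) \<inter> S e' ` U (head G e') = {}" using U oe te e'(3) by blast
  qed
  thus ?thesis by blast
qed

theorem theorem1p1:
  fixes G :: "('v, 'e) pre_digraph"
    and X :: "'v \<Rightarrow> 'a::euclidean_space set"
    and S :: "'e \<Rightarrow> 'a \<Rightarrow> 'a"
    and r :: "'e \<Rightarrow> real"
    and C :: "'v \<Rightarrow> 'a set"
    and KC :: "'v \<Rightarrow> 'a set"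
    and s0 :: real
    and X_interiors_disjoint :: bool
  defines "KC \<equiv> inhomogeneous_attractor G X S C"
    and "s0 \<equiv> critical_exponent G r"
    and "X_interiors_disjoint \<equiv>
      (\<forall>i\<in>verts G. \<forall>j\<in>verts G. i \<noteq> j \<longrightarrow> interior (X i) \<inter> interior (X j) = {})"
  assumes "inhomogeneous_mw_graph G X S r C"
    and "mw_strongly_connected G"
    and "strong_open_set_condition G X S C"
    and "\<forall>i\<in>verts G.
      (\<integral>\<^sup>+t\<in>{0..}. ennreal (exp (- s0 * t) * real (covering_number (exp (- t)) (C i))) \<partial>lborel) < \<infinity>"
  shows
    "(mw_group G r = UNIV \<and>
      (\<exists>h :: 'v \<Rightarrow> real.
        (\<forall>i\<in>verts G. h i > 0 \<and>
          ((\<lambda>t. real (covering_number (exp (- t)) (KC i)) / (h i * exp (s0 * t))) \<longlongrightarrow> 1) at_top) \<and>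
        (X_interiors_disjoint \<longrightarrow>
          ((\<lambda>t. exp (- s0 * t) * real (covering_number (exp (- t)) (\<Union>i\<in>verts G. KC i)))
            \<longlongrightarrow> (\<Sum>i\<in>verts G. h i)) at_top)))
     \<noteq>
     (\<exists>\<tau>>0. mw_group G r = closed_subgroup_generated {\<tau>} \<and>
      closed_subgroup_generated {\<tau>} = range (\<lambda>k::int. \<tau> * real_of_int k) \<and>
      (\<exists>h :: 'v \<Rightarrow> real \<Rightarrow> real.
        (\<forall>i\<in>verts G.
          (\<exists>\<delta>>0. \<forall>y. h i y \<ge> \<delta>) \<and> (\<forall>y. h i (y + \<tau>) = h i y) \<and>
          (\<forall>y\<in>{0..<\<tau>}.
            (\<lambda>n. real (covering_number (exp (- (real n * \<tau> + y))) (KC i))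
              / (h i y * exp (s0 * (real n * \<tau> + y)))) \<longlonglongrightarrow> 1)) \<and>
        (X_interiors_disjoint \<longrightarrow>
          (\<forall>y\<in>{0..<\<tau>}.
            (\<lambda>n. exp (- s0 * (real n * \<tau> + y))
              * real (covering_number (exp (- (real n * \<tau> + y))) (\<Union>i\<in>verts G. KC i)))
            \<longlonglongrightarrow> (\<Sum>i\<in>verts G. h i y)))))"
proof -
  obtain U T w where "sosc_graph G X S r C U T w s0"
    using sosc_graph_exists[OF assms(4,5,6) assms(7)[unfolded s0_def]] unfolding s0_def by blast
  then interpret sosc_graph G X S r C U T w s0 .
  obtain \<delta> where \<delta>: "\<delta> > 0" "\<And>i y. i \<in> verts G \<Longrightarrow> limit i y \<ge> \<delta>" using limit_lower_bound by blast
  have limit_ne: "limit i y \<noteq> 0" if "i \<in> verts G" for i y using \<delta>(2)[OF that, of y] \<delta>(1) by linarith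
  have quotient: "((\<lambda>t. real (covering_number (exp (- t)) (KC i)) / (limit i y * exp (s0 * t))) \<longlongrightarrow> 1) (coset_at_top y)"
    if i: "i \<in> verts G" for i y
  proof -
    have "((\<lambda>t. exp (- s0 * t) * real (covering_number (exp (- t)) (KC i)) / limit i y) \<longlongrightarrow> limit i y / limit i y) (coset_at_top y)"
      unfolding KC_def by (intro tendsto_divide K_limit[OF i] tendsto_const limit_ne[OF i])
    thus ?thesis using limit_ne[OF i] by (simp add: exp_minus field_simps)
  qed
  have union: "((\<lambda>t. exp (- s0 * t) * real (covering_number (exp (- t)) (\<Union>i\<in>verts G. KC i)))
      \<longlongrightarrow> (\<Sum>i\<in>verts G. limit i y)) (coset_at_top y)" if X_interiors_disjoint for y
    unfolding KC_def by (rule union_limit) (use that in \<open>auto simp: X_interiors_disjoint_def\<close>)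
  have H: "H = mw_group G r" by (rule H_eq_mw_group)
  \<comment> \<open>Half a period is not an integer multiple of the period; this makes the two
    alternatives exclude each other.\<close>
  have not_UNIV: "range (\<lambda>k::int. \<tau> * real_of_int k) \<noteq> UNIV" if "\<tau> > 0" for \<tau> :: real
  proof
    assume "range (\<lambda>k::int. \<tau> * real_of_int k) = UNIV"
    then obtain k :: int where "\<tau> / 2 = \<tau> * real_of_int k" by blast
    hence "1 = 2 * real_of_int k" using that by (simp add: field_simps)
    hence "(1::int) = 2 * k" by linarith
    thus False by presburger
  qed
  obtain h where "h \<in> H" "h > 0" using positive_element_H by blast
  from closed_real_subgroup_cases[OF H_subgroup this] show ?thesis
  proof cases
    case 1
    \<comment> \<open>With \<open>H\<close> the whole line there is a single coset, so the
      representative 0 stands for all of them.\<close>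
    have top: "coset_at_top 0 = at_top" unfolding coset_at_top_def 1 by simp
    have "\<exists>h :: 'v \<Rightarrow> real.
        (\<forall>i\<in>verts G. h i > 0 \<and>
          ((\<lambda>t. real (covering_number (exp (- t)) (KC i)) / (h i * exp (s0 * t))) \<longlongrightarrow> 1) at_top) \<and>
        (X_interiors_disjoint \<longrightarrow>
          ((\<lambda>t. exp (- s0 * t) * real (covering_number (exp (- t)) (\<Union>i\<in>verts G. KC i)))
            \<longlongrightarrow> (\<Sum>i\<in>verts G. h i)) at_top)"
    proof (intro exI[of _ "\<lambda>i. limit i 0"] conjI ballI impI)
      fix i assume i: "i \<in> verts G"
      show "limit i 0 > 0" using \<delta>(2)[OF i, of 0] \<delta>(1) by linarith
      show "((\<lambda>t. real (covering_number (exp (- t)) (KC i)) / (limit i 0 * exp (s0 * t))) \<longlongrightarrow> 1) at_top"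
        using quotient[OF i, of 0] unfolding top .
    next
      assume X_interiors_disjoint
      from union[OF this, of 0] show "((\<lambda>t. exp (- s0 * t) * real (covering_number (exp (- t)) (\<Union>i\<in>verts G. KC i)))
            \<longlongrightarrow> (\<Sum>i\<in>verts G. limit i 0)) at_top" unfolding top .
    qed
    moreover have "mw_group G r \<noteq> closed_subgroup_generated {\<tau>}" if "\<tau> > 0" for \<tau>
      using not_UNIV[OF that] 1 H closed_subgroup_generated_singleton[of \<tau>] by simp
    moreover have "mw_group G r = UNIV" using 1 H by simp
    ultimately show ?thesis by blast
  next
    case (2 \<tau>)
    have \<tau>H: "real n * \<tau> \<in> H" for n
      unfolding 2(2) by (rule range_eqI[of _ _ "int n"]) simp
    \<comment> \<open>The sequence stays in its coset, so limits along the filter restrict to limits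
      in \<open>n\<close>.\<close>
    have seq: "filterlim (\<lambda>n. real n * \<tau> + y) (coset_at_top y) sequentially" for y
      unfolding coset_at_top_def filterlim_inf filterlim_principal
    proof
      have "filterlim (\<lambda>n. real n * \<tau>) at_top sequentially"
        by (rule filterlim_at_top_mult_tendsto_pos[OF tendsto_const 2(1) filterlim_real_sequentially])
      from filterlim_tendsto_add_at_top[OF tendsto_const this, of y]
      show "filterlim (\<lambda>n. real n * \<tau> + y) at_top sequentially" by (simp add: add.commute)
    qed (use \<tau>H in simp)
    have "\<exists>h :: 'v \<Rightarrow> real \<Rightarrow> real.
        (\<forall>i\<in>verts G.
          (\<exists>\<delta>>0. \<forall>y. h i y \<ge> \<delta>) \<and> (\<forall>y. h i (y + \<tau>) = h i y) \<and>
          (\<forall>y\<in>{0..<\<tau>}.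
            (\<lambda>n. real (covering_number (exp (- (real n * \<tau> + y))) (KC i))
              / (h i y * exp (s0 * (real n * \<tau> + y)))) \<longlonglongrightarrow> 1)) \<and>
        (X_interiors_disjoint \<longrightarrow>
          (\<forall>y\<in>{0..<\<tau>}.
            (\<lambda>n. exp (- s0 * (real n * \<tau> + y))
              * real (covering_number (exp (- (real n * \<tau> + y))) (\<Union>i\<in>verts G. KC i)))
            \<longlonglongrightarrow> (\<Sum>i\<in>verts G. h i y)))"
    proof (intro exI[of _ limit] conjI ballI impI)
      fix i assume i: "i \<in> verts G"
      show "\<exists>\<delta>>0. \<forall>y. \<delta> \<le> limit i y" using \<delta>(1) \<delta>(2)[OF i] by blast
      show "\<forall>y. limit i (y + \<tau>) = limit i y" using limit_shift \<tau>H[of 1] by simp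
      show "(\<lambda>n. real (covering_number (exp (- (real n * \<tau> + y))) (KC i))
          / (limit i y * exp (s0 * (real n * \<tau> + y)))) \<longlonglongrightarrow> 1" for y
        by (rule filterlim_compose[OF quotient[OF i] seq])
    next
      fix y assume X_interiors_disjoint
      show "(\<lambda>n. exp (- s0 * (real n * \<tau> + y))
          * real (covering_number (exp (- (real n * \<tau> + y))) (\<Union>i\<in>verts G. KC i)))
          \<longlonglongrightarrow> (\<Sum>i\<in>verts G. limit i y)"
        by (rule filterlim_compose[OF union[OF \<open>X_interiors_disjoint\<close>] seq])
    qed
    moreover have "mw_group G r = closed_subgroup_generated {\<tau>}"
      using 2(2) H closed_subgroup_generated_singleton[of \<tau>] by simp
    moreover have "mw_group G r \<noteq> UNIV" using not_UNIV[OF 2(1)] 2(2) H by simp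
    ultimately show ?thesis using 2(1) closed_subgroup_generated_singleton[of \<tau>] by blast
  qed
qed

end
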